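(* Let $\Omega \subset \mathbb{R}^d$ be a bounded domain with a Lipschitz boundary. Then the set $\{ v \in L^\infty(\Omega) \mid -1 \le v \le 1 \ \mathcal{L}^d\text{-a.e. in } \Omega \}$ is non-polyhedric in the dual of the space $W^{s,p}(\Omega)$ for all $0 < s \le 1$ and all $1 < p < \infty$ with $sp > d$.
   Context: $\mathcal{L}^d$ is the $d$-dimensional Lebesgue measure. All function spaces are real; $W^{s,p}(\Omega)$ is the usual Sobolev space for $s=1$ and the fractional Sobolev (Sobolev–Slobodeckij) space for $0<s<1$. A function $v \in L^\infty(\Omega)$ is identified with the functional $u \mapsto \int_\Omega v\,u\,\mathrm{d}\mathcal{L}^d$ in the dual of $W^{s,p}(\Omega)$. Polyhedricity: for a closed, convex, non-empty subset $K$ of a Banach space $W$ and $w \in K$, let $\mathcal{R}_K(w) := \mathbb{R}^+(K - w)$, $\mathcal{T}_K(w) := \overline{\mathcal{R}_K(w)}$ (closure in $W$) and $\mathcal{N}_K(w) := \mathcal{T}_K(w)^\circ = \{\eta \in W^\star \mid \langle \eta, h\rangle \le 0 \ \forall h \in \mathcal{T}_K(w)\}$. For $\eta \in W^\star$ let $\eta^\perp \subset W$ denote the kernel of $\eta$. $K$ is polyhedric at $w \in K$ with respect to $\eta \in \mathcal{N}_K(w)$ if $\mathcal{T}_K(w) \cap \eta^\perp = \overline{\mathcal{R}_K(w) \cap \eta^\perp}$. $K$ is called polyhedric if it is polyhedric at every $w \in K$ with respect to all $\eta \in \mathcal{N}_K(w)$, and non-polyhedric otherwise. Here $W = W^{s,p}(\Omega)^\star$.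 *)

theory Defs
  imports "HOL-Analysis.Analysis" "HOL-Library.Function_Algebras"
begin

section \<open>Pointwise real vector space structure on functions\<close>

instantiation "fun" :: (type, real_vector) real_vector
begin

definition scaleR_fun :: "real \<Rightarrow> ('a \<Rightarrow> 'b) \<Rightarrow> 'a \<Rightarrow> 'b"
  where "scaleR_fun c f = (\<lambda>x. c *\<^sub>R f x)"

instance
  by standard (simp_all add: scaleR_fun_def fun_eq_iff scaleR_add_right scaleR_add_left)

end

section \<open>Polyhedric sets\<close>

text \<open>
  A (semi)normed space is given by a linear subspace \<open>V\<close> of some real vector space together with
  a (semi)norm \<open>N\<close> on \<open>V\<close>. Function spaces consist of functions rather than of classes of almost
  everywhere equal functions, and hence carry seminorms. Their duals are the duals of the associated
  normed quotients, since a functional that is bounded by a seminorm vanishes where the seminorm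
  does. Functionals on \<open>V\<close> are extended by \<open>0\<close> outside of \<open>V\<close>, so that equality of functionals
  is equality on \<open>V\<close> and the dual is a linear subspace on which the dual norm is definite.
\<close>

definition dual_space :: "'v::real_vector set \<Rightarrow> ('v \<Rightarrow> real) \<Rightarrow> ('v \<Rightarrow> real) set" where
  "dual_space V N = {\<eta>.
     (\<forall>x\<in>V. \<forall>y\<in>V. \<eta> (x + y) = \<eta> x + \<eta> y) \<and>
     (\<forall>c. \<forall>x\<in>V. \<eta> (c *\<^sub>R x) = c * \<eta> x) \<and>
     (\<exists>C. \<forall>x\<in>V. \<bar>\<eta> x\<bar> \<le> C * N x) \<and>
     (\<forall>x. x \<notin> V \<longrightarrow> \<eta> x = 0)}"

definition dual_norm :: "'v::real_vector set \<Rightarrow> ('v \<Rightarrow> real) \<Rightarrow> ('v \<Rightarrow> real) \<Rightarrow> real" where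
  "dual_norm V N \<eta> = (SUP x\<in>{x\<in>V. N x \<le> 1}. \<bar>\<eta> x\<bar>)"

definition norm_closure :: "'v::real_vector set \<Rightarrow> ('v \<Rightarrow> real) \<Rightarrow> 'v set \<Rightarrow> 'v set" where
  "norm_closure V N A = {x\<in>V. \<forall>\<epsilon>>0. \<exists>a\<in>A. N (x - a) < \<epsilon>}"

definition radial_cone :: "'v::real_vector set \<Rightarrow> 'v \<Rightarrow> 'v set" where
  "radial_cone K w = {t *\<^sub>R (k - w) | t k. t > 0 \<and> k \<in> K}"

definition tangent_cone :: "'v::real_vector set \<Rightarrow> ('v \<Rightarrow> real) \<Rightarrow> 'v set \<Rightarrow> 'v \<Rightarrow> 'v set" where
  "tangent_cone V N K w = norm_closure V N (radial_cone K w)"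

definition normal_cone ::
  "'v::real_vector set \<Rightarrow> ('v \<Rightarrow> real) \<Rightarrow> 'v set \<Rightarrow> 'v \<Rightarrow> ('v \<Rightarrow> real) set" where
  "normal_cone V N K w = {\<eta> \<in> dual_space V N. \<forall>h\<in>tangent_cone V N K w. \<eta> h \<le> 0}"

definition kernel_on :: "'v set \<Rightarrow> ('v \<Rightarrow> real) \<Rightarrow> 'v set" where
  "kernel_on V \<eta> = {h\<in>V. \<eta> h = 0}"

definition polyhedric_at ::
  "'v::real_vector set \<Rightarrow> ('v \<Rightarrow> real) \<Rightarrow> 'v set \<Rightarrow> 'v \<Rightarrow> ('v \<Rightarrow> real) \<Rightarrow> bool" where
  "polyhedric_at V N K w \<eta> \<longleftrightarrow>
     tangent_cone V N K w \<inter> kernel_on V \<eta> =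
     norm_closure V N (radial_cone K w \<inter> kernel_on V \<eta>)"

definition polyhedric :: "'v::real_vector set \<Rightarrow> ('v \<Rightarrow> real) \<Rightarrow> 'v set \<Rightarrow> bool" where
  "polyhedric V N K \<longleftrightarrow> (\<forall>w\<in>K. \<forall>\<eta>\<in>normal_cone V N K w. polyhedric_at V N K w \<eta>)"

section \<open>Lipschitz boundaries\<close>

text \<open>
  Near each boundary point, the set is the strict epigraph, in the direction of a unit vector
  \<open>e\<close>, of a Lipschitz function \<open>\<gamma>\<close> on the hyperplane orthogonal to \<open>e\<close>.
\<close>

definition lipschitz_boundary :: "'a::euclidean_space set \<Rightarrow> bool" where
  "lipschitz_boundary \<Omega> \<longleftrightarrow>
     (\<forall>x0\<in>frontier \<Omega>. \<exists>r>0. \<exists>e \<gamma> L. norm e = 1 \<and> L-lipschitz_on {y. y \<bullet> e = 0} \<gamma> \<and>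
        \<Omega> \<inter> ball x0 r = {x \<in> ball x0 r. \<gamma> (x - (x \<bullet> e) *\<^sub>R e) < x \<bullet> e})"

section \<open>Lebesgue and Sobolev spaces\<close>

definition Lp_space :: "'a::euclidean_space set \<Rightarrow> real \<Rightarrow> ('a \<Rightarrow> real) set" where
  "Lp_space \<Omega> p = {u \<in> borel_measurable (lebesgue_on \<Omega>).
     integrable (lebesgue_on \<Omega>) (\<lambda>x. \<bar>u x\<bar> powr p)}"

definition Linfty_space :: "'a::euclidean_space set \<Rightarrow> ('a \<Rightarrow> real) set" where
  "Linfty_space \<Omega> = {v \<in> borel_measurable (lebesgue_on \<Omega>).
     \<exists>C. AE x in lebesgue_on \<Omega>. \<bar>v x\<bar> \<le> C}"

primrec Ck :: "nat \<Rightarrow> ('a::euclidean_space \<Rightarrow> real) \<Rightarrow> bool" where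
  "Ck 0 f \<longleftrightarrow> continuous_on UNIV f"
| "Ck (Suc k) f \<longleftrightarrow> (\<forall>x. f differentiable (at x)) \<and>
     (\<forall>b\<in>Basis. Ck k (\<lambda>x. frechet_derivative f (at x) b))"

definition test_functions :: "'a::euclidean_space set \<Rightarrow> ('a \<Rightarrow> real) set" where
  "test_functions \<Omega> = {\<phi>. (\<forall>k. Ck k \<phi>) \<and>
     compact (closure {x. \<phi> x \<noteq> 0}) \<and> closure {x. \<phi> x \<noteq> 0} \<subseteq> \<Omega>}"

definition has_weak_partial ::
  "'a::euclidean_space set \<Rightarrow> 'a \<Rightarrow> ('a \<Rightarrow> real) \<Rightarrow> ('a \<Rightarrow> real) \<Rightarrow> bool" where
  "has_weak_partial \<Omega> b u g \<longleftrightarrow> (\<forall>\<phi>\<in>test_functions \<Omega>.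
     (LINT x|lebesgue_on \<Omega>. u x * frechet_derivative \<phi> (at x) b) =
     - (LINT x|lebesgue_on \<Omega>. g x * \<phi> x))"

text \<open>The choice is immaterial: weak derivatives are unique up to null sets.\<close>

definition weak_partial ::
  "'a::euclidean_space set \<Rightarrow> real \<Rightarrow> 'a \<Rightarrow> ('a \<Rightarrow> real) \<Rightarrow> 'a \<Rightarrow> real" where
  "weak_partial \<Omega> p b u = (SOME g. g \<in> Lp_space \<Omega> p \<and> has_weak_partial \<Omega> b u g)"

definition slobodeckij_integrand ::
  "real \<Rightarrow> real \<Rightarrow> ('a::euclidean_space \<Rightarrow> real) \<Rightarrow> 'a \<times> 'a \<Rightarrow> real" where
  "slobodeckij_integrand s p u =
     (\<lambda>(x, y). \<bar>u x - u y\<bar> powr p / norm (x - y) powr (real DIM('a) + s * p))"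

text \<open>The following two definitions are meant for \<open>0 < s \<le> 1\<close> and \<open>1 \<le> p < \<infinity>\<close>.\<close>

definition sobolev_space :: "'a::euclidean_space set \<Rightarrow> real \<Rightarrow> real \<Rightarrow> ('a \<Rightarrow> real) set" where
  "sobolev_space \<Omega> s p =
     (if s = 1
      then {u \<in> Lp_space \<Omega> p. \<forall>b\<in>Basis. \<exists>g\<in>Lp_space \<Omega> p. has_weak_partial \<Omega> b u g}
      else {u \<in> Lp_space \<Omega> p.
              integrable (lebesgue_on \<Omega> \<Otimes>\<^sub>M lebesgue_on \<Omega>) (slobodeckij_integrand s p u)})"

definition sobolev_norm :: "'a::euclidean_space set \<Rightarrow> real \<Rightarrow> real \<Rightarrow> ('a \<Rightarrow> real) \<Rightarrow> real" where
  "sobolev_norm \<Omega> s p u =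
     ((LINT x|lebesgue_on \<Omega>. \<bar>u x\<bar> powr p) +
      (if s = 1
       then (\<Sum>b\<in>Basis. LINT x|lebesgue_on \<Omega>. \<bar>weak_partial \<Omega> p b u x\<bar> powr p)
       else (LINT z|(lebesgue_on \<Omega> \<Otimes>\<^sub>M lebesgue_on \<Omega>). slobodeckij_integrand s p u z)))
     powr (1 / p)"

definition sobolev_dual ::
  "'a::euclidean_space set \<Rightarrow> real \<Rightarrow> real \<Rightarrow> (('a \<Rightarrow> real) \<Rightarrow> real) set" where
  "sobolev_dual \<Omega> s p = dual_space (sobolev_space \<Omega> s p) (sobolev_norm \<Omega> s p)"

definition sobolev_dual_norm ::
  "'a::euclidean_space set \<Rightarrow> real \<Rightarrow> real \<Rightarrow> (('a \<Rightarrow> real) \<Rightarrow> real) \<Rightarrow> real" where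
  "sobolev_dual_norm \<Omega> s p = dual_norm (sobolev_space \<Omega> s p) (sobolev_norm \<Omega> s p)"

text \<open>The functional on the Sobolev space with which an \<open>L\<^sup>\<infinity>\<close> function is identified.\<close>

definition Linfty_functional ::
  "'a::euclidean_space set \<Rightarrow> real \<Rightarrow> real \<Rightarrow> ('a \<Rightarrow> real) \<Rightarrow> ('a \<Rightarrow> real) \<Rightarrow> real" where
  "Linfty_functional \<Omega> s p v =
     (\<lambda>u. if u \<in> sobolev_space \<Omega> s p then LINT x|lebesgue_on \<Omega>. v x * u x else 0)"

end

theory Submission
  imports Defs
begin

text \<open>
  Let \<open>x\<^sub>0 \<in> \<Omega>\<close>, \<open>w = -1\<close> and \<open>u(x) = -\<bar>x - x\<^sub>0\<bar>\<^sup>2\<close>, regarded as an element \<open>\<eta>\<close> of the bidual. Elements of the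
  radial cone at \<open>w\<close> are nonnegative functions, so \<open>\<eta>\<close> is normal, and those in the kernel of \<open>\<eta>\<close>
  vanish because \<open>u < 0\<close> almost everywhere. Since \<open>s p > d\<close>, the evaluation \<open>\<delta>\<close> at \<open>x\<^sub>0\<close> lies in the dual space
  and is the norm limit of nonnegative mollifiers, hence belongs to the tangent cone; it is annihilated
  by \<open>\<eta>\<close> as \<open>u(x\<^sub>0) = 0\<close>, but it is not zero.

  To obtain \<open>\<delta>\<close> as the limit of mollifiers \<open>h\<^sub>r\<close> along \<open>r = R / 2\<^sup>n\<close>, the difference
  \<open>\<integral> f h\<^sub>r - \<integral> f h\<^bsub>r/2\<^esub>\<close> is bounded by a multiple of \<open>r\<close> to the power \<open>s - d / p\<close> on the unit ball of the
  Sobolev space. For \<open>s = 1\<close>, \<open>h\<^sub>r - h\<^bsub>r/2\<^esub>\<close> is the divergence of an explicit smooth radial field and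
  the weak derivative is inserted; for \<open>s < 1\<close>, the difference is a double integral of
  \<open>(f(x) - f(y)) h\<^sub>r(x) h\<^bsub>r/2\<^esub>(y)\<close>.
\<close>

section \<open>Functions of class \<open>C\<^sup>k\<close>\<close>

text \<open>The analytic core is one estimate for differences of mollifiers. The exponent s - d / p
  is positive exactly when s p > d; along dyadic radii the bound is then a geometric sequence,
  uniform over the unit ball, and the functionals converge in the dual norm. The limit \<delta> is
  defined as the limit of the averages, which makes sense for every element of the Sobolev space,
  and two of its values decide the proof. At \<open>u\<close> it is 0, since \<open>u\<close> is
  small on the shrinking supports. At the constant function 1 it is the common mass \<open>m\<close>
  > 0 of the mollifiers, which is why their mass must not vary with r; it is not normalised to 1.
  Evaluation at 1 is continuous in the dual norm and vanishes on the radial directions in the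
  kernel, so it separates \<delta> from their closure. The function \<open>u\<close> is a
  polynomial, so its membership in the space for all s and p is a special case of that of smooth
  functions. The duality arguments rest on homogeneity and non-negativity of the Sobolev norm
  together with estimates on its unit ball.\<close>

lemma Ck_Suc_D: "Ck (Suc k) f \<Longrightarrow> Ck k f"
proof (induction k arbitrary: f)
  case 0
  then show ?case
    by (simp add: continuous_on_eq_continuous_at differentiable_imp_continuous_within)
next
  case (Suc k)
  have "(\<forall>x. f differentiable (at x)) \<and>
      (\<forall>b\<in>Basis. Ck (Suc k) (\<lambda>x. frechet_derivative f (at x) b))"
    using Suc.prems by (rule Ck.simps(2)[THEN iffD1])
  with Suc.IH show ?case
    by (intro Ck.simps(2)[THEN iffD2]) blast
qed

declare Ck.simps(2) [simp del]

lemma Ck_continuous_on: "Ck k f \<Longrightarrow> continuous_on S f"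
proof (induction k)
  case 0
  then show ?case by (auto intro: continuous_on_subset)
next
  case (Suc k)
  show ?case by (rule Suc.IH[OF Ck_Suc_D[OF Suc.prems]])
qed

lemma Ck_SucI:
  assumes "\<And>x. (f has_derivative f' x) (at x)" "\<And>b. b \<in> Basis \<Longrightarrow> Ck k (\<lambda>x. f' x b)"
  shows "Ck (Suc k) f"
proof -
  have "frechet_derivative f (at x) = f' x" for x
    using frechet_derivative_at[OF assms(1)[of x]] by simp
  moreover have "f differentiable (at x)" for x
    using assms(1) differentiable_def by blast
  ultimately show ?thesis using assms(2) by (simp add: Ck.simps(2))
qed

lemma Ck_has_derivative:
  "Ck (Suc k) f \<Longrightarrow> (f has_derivative frechet_derivative f (at x)) (at x)"
  by (simp add: Ck.simps(2) frechet_derivative_works[symmetric])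

lemma Ck_frechet: "Ck (Suc k) f \<Longrightarrow> b \<in> Basis \<Longrightarrow> Ck k (\<lambda>x. frechet_derivative f (at x) b)"
  by (simp add: Ck.simps(2))

lemma Ck_const: "Ck k (\<lambda>x. c)"
proof (induction k arbitrary: c)
  case (Suc k)
  show ?case by (rule Ck_SucI[where f'="\<lambda>x h. 0"]) (auto intro: Suc)
qed simp

lemma Ck_bounded_linear:
  assumes "bounded_linear f"
  shows "Ck k f"
proof (cases k)
  case 0
  then show ?thesis
    using assms by (simp add: linear_continuous_on)
next
  case (Suc m)
  show ?thesis unfolding Suc
    by (rule Ck_SucI[OF bounded_linear_imp_has_derivative[OF assms]]) (rule Ck_const)
qed

lemma Ck_add: "Ck k f \<Longrightarrow> Ck k g \<Longrightarrow> Ck k (\<lambda>x. f x + g x)"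
proof (induction k arbitrary: f g)
  case 0
  then show ?case by (auto intro: continuous_intros)
next
  case (Suc k)
  show ?case
    by (rule Ck_SucI[OF has_derivative_add[OF Ck_has_derivative Ck_has_derivative]])
       (use Suc.prems in \<open>auto intro!: Suc.IH Ck_frechet\<close>)
qed

lemma Ck_mult: "Ck k f \<Longrightarrow> Ck k g \<Longrightarrow> Ck k (\<lambda>x. f x * g x)"
proof (induction k arbitrary: f g)
  case 0
  then show ?case by (auto intro: continuous_intros)
next
  case (Suc k)
  show ?case
    by (rule Ck_SucI[OF has_derivative_mult[OF Ck_has_derivative Ck_has_derivative]])
       (use Suc.prems in \<open>auto intro!: Ck_add Suc.IH Ck_Suc_D[OF Suc.prems(1)] Ck_Suc_D[OF Suc.prems(2)] intro: Ck_frechet\<close>)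
qed

lemma Ck_diff: "Ck k f \<Longrightarrow> Ck k g \<Longrightarrow> Ck k (\<lambda>x. f x - g x)"
  using Ck_add[OF _ Ck_mult[OF Ck_const[of _ "-1"]], of k f g] by simp

lemma Ck_prod: "finite A \<Longrightarrow> (\<And>i. i \<in> A \<Longrightarrow> Ck k (f i)) \<Longrightarrow> Ck k (\<lambda>x. \<Prod>i\<in>A. f i x)"
  by (induction A rule: finite_induct) (auto intro: Ck_const Ck_mult)

lemma Ck_sum: "finite A \<Longrightarrow> (\<And>i. i \<in> A \<Longrightarrow> Ck k (f i)) \<Longrightarrow> Ck k (\<lambda>x. \<Sum>i\<in>A. f i x)"
  by (induction A rule: finite_induct) (auto intro: Ck_const Ck_add)

lemma Ck_real_SucI:
  fixes f :: "real \<Rightarrow> real"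
  assumes "\<And>x. (f has_real_derivative f' x) (at x)" "Ck k f'"
  shows "Ck (Suc k) f"
  by (rule Ck_SucI[OF has_field_derivative_imp_has_derivative[OF assms(1)]])
     (use assms(2) in auto)

lemma Ck_real_deriv:
  fixes f :: "real \<Rightarrow> real"
  assumes "Ck (Suc k) f"
  shows "(f has_real_derivative deriv f x) (at x)" "Ck k (deriv f)"
proof -
  show f: "(f has_real_derivative deriv f x) (at x)" for x
    using assms by (simp add: Ck.simps(2) DERIV_deriv_iff_real_differentiable)
  have "frechet_derivative f (at x) 1 = deriv f x" for x
    using frechet_derivative_at[OF has_field_derivative_imp_has_derivative[OF f[of x]]] by (metis mult.right_neutral)
  then show "Ck k (deriv f)"
    using assms by (simp add: Ck.simps(2))
qed

lemma Ck_compose: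
  fixes g :: "real \<Rightarrow> real"
  shows "Ck k g \<Longrightarrow> Ck k f \<Longrightarrow> Ck k (\<lambda>x. g (f x))"
proof (induction k arbitrary: f g)
  case 0
  then show ?case
    using continuous_on_compose2[of UNIV g UNIV f] by auto
next
  case (Suc k)
  have "((\<lambda>x. g (f x)) has_derivative (\<lambda>h. deriv g (f x) * frechet_derivative f (at x) h)) (at x)" for x
    using has_derivative_compose[OF Ck_has_derivative[OF Suc.prems(2), of x]
        has_field_derivative_imp_has_derivative[OF Ck_real_deriv(1)[OF Suc.prems(1), of "f x"]]] .
  then show ?case
    by (rule Ck_SucI)
       (intro Ck_mult Suc.IH[of "deriv g" f] Ck_real_deriv(2)[OF Suc.prems(1)]
         Ck_Suc_D[OF Suc.prems(2)] Ck_frechet[OF Suc.prems(2)])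
qed

lemma Ck_sqnorm: "Ck k (\<lambda>x::'a::euclidean_space. (norm (x - a))\<^sup>2)"
proof -
  have "Ck k (\<lambda>x::'a. \<Sum>b\<in>Basis. (x \<bullet> b - a \<bullet> b) * (x \<bullet> b - a \<bullet> b))"
    by (intro Ck_sum Ck_mult Ck_diff Ck_const Ck_bounded_linear bounded_linear_inner_left finite_Basis)
  moreover have "(\<Sum>b\<in>Basis. (x \<bullet> b - a \<bullet> b) * (x \<bullet> b - a \<bullet> b)) = (norm (x - a))\<^sup>2" for x :: 'a
    unfolding power2_norm_eq_inner euclidean_inner[of "x - a" "x - a"] by (simp add: inner_diff_left)
  ultimately show ?thesis by simp
qed

section \<open>Smooth functions on the line that vanish on a half-line\<close>

text \<open>The classical t^(-m) exp(-1/t), extended by zero. The power \<open>m\<close> is a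
  parameter because derivatives are linear combinations of members of the family, so smoothness
  follows by induction on the order for all \<open>m\<close> at once.\<close>

definition flat_exp :: "nat \<Rightarrow> real \<Rightarrow> real" where
  "flat_exp m t = (if t \<le> 0 then 0 else inverse t ^ m * exp (- inverse t))"

lemma flat_exp_nonneg: "0 \<le> flat_exp m t"
  by (auto simp: flat_exp_def)

lemma flat_exp_0_le_1: "flat_exp 0 t \<le> 1"
  by (auto simp: flat_exp_def)

lemma flat_exp_0_pos_iff: "0 < flat_exp 0 t \<longleftrightarrow> 0 < t"
  by (auto simp: flat_exp_def)

lemma DERIV_flat_exp:
  "(flat_exp m has_real_derivative flat_exp (m + 2) t - m * flat_exp (Suc m) t) (at t)"
proof (cases t "0::real" rule: linorder_cases)
  case less
  have "((\<lambda>_. 0) has_real_derivative 0) (at t)" by simp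
  then have "(flat_exp m has_real_derivative 0) (at t)"
    by (rule DERIV_cong_ev[THEN iffD1, OF refl _ refl, rotated])
       (use less eventually_nhds_in_open[of "{..<0}" t] in \<open>auto elim!: eventually_mono simp: flat_exp_def\<close>)
  then show ?thesis using less by (simp add: flat_exp_def)
next
  case greater
  have "((\<lambda>t. inverse t ^ m * exp (- inverse t)) has_real_derivative
      flat_exp (m + 2) t - m * flat_exp (Suc m) t) (at t)"
    using greater
    by (auto intro!: derivative_eq_intros simp: flat_exp_def)
       (cases m; simp add: field_simps power2_eq_square)
  then show ?thesis
    by (rule DERIV_cong_ev[THEN iffD1, OF refl _ refl, rotated])
       (use greater eventually_nhds_in_open[of "{0<..}" t] in \<open>auto elim!: eventually_mono simp: flat_exp_def\<close>)
next
  case equal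
  \<comment> \<open>With x = 1/h the difference quotient at 0 becomes x^(m+1) / exp x as x tends to
    infinity; from the left it is identically 0.\<close>
  have "((\<lambda>h. flat_exp m h / h) \<longlongrightarrow> 0) (at_right 0)"
  proof (rule Lim_transform_eventually)
    show "((\<lambda>h::real. inverse h ^ Suc m / exp (inverse h)) \<longlongrightarrow> 0) (at_right 0)"
      by (rule filterlim_compose[OF tendsto_power_div_exp_0 filterlim_inverse_at_top_right])
    show "\<forall>\<^sub>F h in at_right 0. inverse h ^ Suc m / exp (inverse h) = flat_exp m h / h"
      by (rule eventually_at_right_less[THEN eventually_mono])
         (simp add: flat_exp_def exp_minus divide_simps)
  qed
  moreover have "((\<lambda>h. flat_exp m h / h) \<longlongrightarrow> 0) (at_left 0)"
    by (rule tendsto_eventually)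
       (auto simp: eventually_at_filter flat_exp_def)
  ultimately have "((\<lambda>h. flat_exp m h / h) \<longlongrightarrow> 0) (at 0)"
    by (simp add: filterlim_at_split)
  then show ?thesis
    unfolding equal by (simp add: has_field_derivative_iff flat_exp_def)
qed

lemma Ck_flat_exp: "Ck k (flat_exp m)"
proof (induction k arbitrary: m)
  case 0
  show ?case
    using DERIV_flat_exp[THEN DERIV_isCont] by (auto intro: continuous_at_imp_continuous_on)
next
  case (Suc k)
  show ?case
    by (rule Ck_real_SucI[OF DERIV_flat_exp]) (intro Ck_diff Ck_mult Ck_const Suc)
qed

text \<open>A real power is smooth on the positive axis, and \<open>f\<close> vanishes on a
  neighbourhood of the half-line t \<le> 0, so the behaviour of \<open>powr\<close> there is masked.
  The derivative involves the exponent q - 1 and \<open>deriv f\<close>, hence the induction varies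
  both \<open>q\<close> and \<open>f\<close>.\<close>

lemma Ck_powr_mult:
  fixes f :: "real \<Rightarrow> real"
  assumes "Ck k f" "c > 0" "\<And>t. t < c \<Longrightarrow> f t = 0"
  shows "Ck k (\<lambda>t. t powr q * f t)"
  using assms(1,3)
proof (induction k arbitrary: f q)
  case 0
  have "isCont (\<lambda>t. t powr q * f t) t" for t
  proof (cases "t < c")
    case True
    have "\<forall>\<^sub>F t in nhds t. t powr q * f t = 0"
      using eventually_nhds_in_open[of "{..<c}" t] True 0 by (auto elim!: eventually_mono)
    then show ?thesis
      using isCont_cong[of "\<lambda>t. t powr q * f t" "\<lambda>_. 0" t] by simp
  next
    case False
    with assms 0 show ?thesis
      by (auto intro!: continuous_intros simp: continuous_on_eq_continuous_at)
  qed
  then show ?case by (auto intro: continuous_at_imp_continuous_on)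
next
  case (Suc k)
  \<comment> \<open>That \<open>deriv f\<close> again vanishes below \<open>c\<close> is proved
    along with the derivative formula, since the induction hypothesis for \<open>deriv f\<close>
    requires it.\<close>
  have "((\<lambda>t. t powr q * f t) has_real_derivative
    q * (t powr (q - 1) * f t) + t powr q * deriv f t) (at t) \<and> (t < c \<longrightarrow> deriv f t = 0)" for t
  proof (cases "t < c")
    case True
    have ev: "\<forall>\<^sub>F t in nhds t. f t = 0"
      using eventually_nhds_in_open[of "{..<c}" t] True Suc.prems(2) by (auto elim!: eventually_mono)
    have "((\<lambda>t. t powr q * f t) has_real_derivative 0) (at t)"
      by (rule DERIV_cong_ev[THEN iffD2, OF refl _ refl DERIV_const[of 0]]) (use ev in \<open>auto elim!: eventually_mono\<close>)
    moreover have "(f has_real_derivative 0) (at t)"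
      by (rule DERIV_cong_ev[THEN iffD2, OF refl _ refl DERIV_const[of 0]]) (use ev in \<open>auto elim!: eventually_mono\<close>)
    ultimately show ?thesis using True Suc.prems(2) by (auto dest: DERIV_imp_deriv)
  next
    case False
    then have "t > 0" using assms(2) by simp
    show ?thesis
      using False \<open>t > 0\<close> by (auto intro!: derivative_eq_intros Ck_real_deriv(1)[OF Suc.prems(1)])
  qed
  then have "((\<lambda>t. t powr q * f t) has_real_derivative
      q * (t powr (q - 1) * f t) + t powr q * deriv f t) (at t)"
    and f': "t < c \<Longrightarrow> deriv f t = 0" for t by blast+
  then show ?case
    by (intro Ck_real_SucI[where f'="\<lambda>t. q * (t powr (q - 1) * f t) + t powr q * deriv f t"] Ck_add
        Ck_mult[OF Ck_const Suc.IH[OF Ck_Suc_D[OF Suc.prems(1)] Suc.prems(2)]]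
        Suc.IH[OF Ck_real_deriv(2)[OF Suc.prems(1)] f'])
qed

section \<open>Test functions\<close>

lemma continuous_bounded_support_bound:
  fixes f :: "'a::euclidean_space \<Rightarrow> real"
  assumes "continuous_on UNIV f" "\<And>x. norm x > R \<Longrightarrow> f x = 0"
  obtains M where "M > 0" "\<And>x. \<bar>f x\<bar> \<le> M"
proof -
  have "bounded (f ` cball 0 R)"
    by (intro compact_imp_bounded compact_continuous_image continuous_on_subset[OF assms(1)]) auto
  then obtain M where M: "M > 0" "\<And>x. norm x \<le> R \<Longrightarrow> \<bar>f x\<bar> \<le> M"
    unfolding bounded_pos by auto
  have "\<bar>f x\<bar> \<le> M" for x
    using M assms(2)[of x] by (cases "norm x \<le> R") auto
  with M(1) show thesis by (rule that)
qed

lemma integrable_continuous_bounded_support: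
  fixes f :: "'a::euclidean_space \<Rightarrow> real"
  assumes "continuous_on UNIV f" "\<And>x. norm x > R \<Longrightarrow> f x = 0"
  shows "integrable lborel f"
proof -
  have "integrable lborel (\<lambda>x. indicator (cball 0 R) x *\<^sub>R f x)"
    by (intro borel_integrable_compact continuous_on_subset[OF assms(1)]) auto
  also have "(\<lambda>x. indicator (cball 0 R) x *\<^sub>R f x) = f"
    using assms(2) by (force simp: fun_eq_iff indicator_def not_le)
  finally show ?thesis .
qed

lemma frechet_derivative_eq_0:
  assumes "open S" "x \<in> S" "\<And>y. y \<in> S \<Longrightarrow> f y = 0"
  shows "frechet_derivative f (at x) = (\<lambda>h. 0)"
proof -
  have "(f has_derivative (\<lambda>h. 0)) (at x)"
    by (rule has_derivative_transform_within_open[OF has_derivative_const[of 0] assms(1,2)])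
       (use assms(3) in auto)
  then show ?thesis using frechet_derivative_at by metis
qed

text \<open>Every difference quotient has integral 0 by translation invariance of Lebesgue measure,
  and the quotients converge to the partial derivative under an integrable majorant.\<close>

lemma integral_partial_eq_0:
  fixes \<phi> :: "'a::euclidean_space \<Rightarrow> real"
  assumes C1: "Ck (Suc 0) \<phi>" and b: "b \<in> Basis" and R: "\<And>x. norm x > R \<Longrightarrow> \<phi> x = 0"
  shows "(LINT x|lborel. frechet_derivative \<phi> (at x) b) = 0"
proof -
  let ?g = "\<lambda>x. frechet_derivative \<phi> (at x) b"
  have R': "?g x = 0" if "norm x > R" for x
  proof -
    have "open {x::'a. norm x > R}" by (intro open_Collect_less continuous_intros)
    then show ?thesis
      using frechet_derivative_eq_0[of "{x. norm x > R}" x \<phi>] R that by auto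
  qed
  have cont: "continuous_on UNIV \<phi>" "continuous_on UNIV ?g"
    using Ck_continuous_on[OF C1] Ck_continuous_on[OF Ck_frechet[OF C1 b]] by auto
  obtain M where M: "M > 0" "\<And>x. \<bar>?g x\<bar> \<le> M"
    using continuous_bounded_support_bound[OF cont(2) R'] by blast
  define t where "t n = inverse (real (Suc n))" for n
  have t: "0 < t n" "t n \<le> 1" "t \<longlonglongrightarrow> 0" for n
    unfolding t_def by (simp, simp add: divide_simps, rule LIMSEQ_inverse_real_of_nat)
  define D where "D n x = (\<phi> (x + t n *\<^sub>R b) - \<phi> x) / t n" for n x
  have line: "((\<lambda>s. \<phi> (x + s *\<^sub>R b)) has_real_derivative ?g (x + s *\<^sub>R b)) (at s)" for x s
  proof -
    have "((\<lambda>s. \<phi> (x + s *\<^sub>R b)) has_derivative (\<lambda>h. frechet_derivative \<phi> (at (x + s *\<^sub>R b)) (h *\<^sub>R b))) (at s)"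
      by (rule has_derivative_compose[OF _ Ck_has_derivative[OF C1]]) (auto intro!: derivative_eq_intros)
    moreover have "frechet_derivative \<phi> (at (x + s *\<^sub>R b)) (h *\<^sub>R b) = ?g (x + s *\<^sub>R b) * h" for h
      using linear_cmul[OF has_derivative_linear[OF Ck_has_derivative[OF C1]], of "x + s *\<^sub>R b" h b] by simp
    ultimately show ?thesis
      by (simp add: has_field_derivative_def)
  qed
  \<comment> \<open>Inside the large ball the mean value theorem bounds the quotient by
    \<open>M\<close>. Outside it both points have norm above \<open>R\<close>, because
    \<open>b\<close> is a unit vector and the steps \<open>t n\<close> are at most 1; hence the
    radius |R| + 1.\<close>
  have bound: "norm (D n x) \<le> M * indicator (cball 0 (\<bar>R\<bar> + 1)) x" for n x
  proof (cases "x \<in> cball 0 (\<bar>R\<bar> + 1)")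
    case True
    obtain z where "\<phi> (x + t n *\<^sub>R b) - \<phi> (x + 0 *\<^sub>R b) = (t n - 0) * ?g (x + z *\<^sub>R b)"
      using MVT2[OF t(1)[of n], of "\<lambda>s. \<phi> (x + s *\<^sub>R b)" "\<lambda>s. ?g (x + s *\<^sub>R b)"] line by blast
    then have "D n x = ?g (x + z *\<^sub>R b)" using t(1)[of n] by (simp add: D_def)
    then show ?thesis using M(2) True by simp
  next
    case False
    have "norm x \<le> norm (x + t n *\<^sub>R b) + norm (t n *\<^sub>R b)"
      by (metis add_diff_cancel_right' norm_triangle_ineq4)
    then have "R < norm (x + t n *\<^sub>R b)" "R < norm x"
      using False b t(1)[of n] t(2)[of n] by auto
    then show ?thesis using False R by (simp add: D_def)
  qed
  have lim: "(\<lambda>n. D n x) \<longlonglongrightarrow> ?g x" for x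
  proof -
    have "((\<lambda>h. (\<phi> (x + h *\<^sub>R b) - \<phi> x) / h) \<longlongrightarrow> ?g x) (at 0)"
      using line[of x 0] by (simp add: has_field_derivative_iff)
    then show ?thesis
      unfolding D_def by (rule filterlim_compose) (simp add: filterlim_at t(3) t(1)[THEN less_imp_neq, THEN not_sym])
  qed
  have int: "integrable lborel \<phi>"
    by (rule integrable_continuous_bounded_support[OF cont(1) R])
  have "(\<lambda>n. LINT x|lborel. D n x) \<longlonglongrightarrow> (LINT x|lborel. ?g x)"
  proof (rule integral_dominated_convergence[where w="\<lambda>x. M * indicator (cball 0 (\<bar>R\<bar> + 1)) x"])
    show "integrable lborel (\<lambda>x. M * indicator (cball 0 (\<bar>R\<bar> + 1)) x :: real)"
      by (intro integrable_mult_right integrable_real_indicator)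
         (use emeasure_bounded_finite[OF bounded_cball] in auto)
    show "?g \<in> borel_measurable lborel"
      using borel_measurable_continuous_onI[OF cont(2)] by simp
    show "D n \<in> borel_measurable lborel" for n
      unfolding D_def using cont(1)
      by (auto intro!: borel_measurable_continuous_onI continuous_intros continuous_on_compose2[OF cont(1)] simp: t_def)
  qed (use bound lim in auto)
  moreover have "(LINT x|lborel. D n x) = 0" for n
  proof -
    have m: "(+) (t n *\<^sub>R b) \<in> lborel \<rightarrow>\<^sub>M borel" "\<phi> \<in> borel_measurable borel"
      using cont(1) by (auto intro: borel_measurable_continuous_onI)
    have "integrable (distr lborel borel ((+) (t n *\<^sub>R b))) \<phi>"
      using int by (simp only: lborel_distr_plus)
    then have "integrable lborel (\<lambda>x. \<phi> (t n *\<^sub>R b + x))"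
      by (rule integrable_distr[OF m(1)])
    moreover have "(LINT x|lborel. \<phi> (t n *\<^sub>R b + x)) = (LINT x|lborel. \<phi> x)"
      using integral_distr[OF m] by (simp only: lborel_distr_plus)
    ultimately show ?thesis
      unfolding D_def using int by (simp add: add.commute)
  qed
  ultimately show ?thesis
    by (simp add: LIMSEQ_const_iff)
qed

lemma borel_measurable_lebesgue_onI:
  "f \<in> borel_measurable borel \<Longrightarrow> f \<in> borel_measurable (lebesgue_on \<Omega>)"
  by (intro measurable_restrict_space1 measurable_completion) simp

text \<open>A bridge between two measures: weak derivatives integrate over
  \<open>lebesgue_on \<Omega>\<close>, whereas translation invariance was exploited on
  \<open>lborel\<close>.\<close>

lemma lebesgue_on_integral_eq_lborel:
  fixes f :: "'a::euclidean_space \<Rightarrow> real"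
  assumes "\<Omega> \<in> sets lebesgue" "f \<in> borel_measurable borel" "\<And>x. x \<notin> \<Omega> \<Longrightarrow> f x = 0"
  shows "integral\<^sup>L (lebesgue_on \<Omega>) f = integral\<^sup>L lborel f"
    and "integrable (lebesgue_on \<Omega>) f \<longleftrightarrow> integrable lborel f"
proof -
  have eq: "(\<lambda>x. indicator \<Omega> x * f x) = f"
    using assms(3) by (auto simp: fun_eq_iff indicator_def)
  show "integral\<^sup>L (lebesgue_on \<Omega>) f = integral\<^sup>L lborel f"
    using assms(1,2) by (simp add: integral_restrict_space eq integral_completion)
  show "integrable (lebesgue_on \<Omega>) f \<longleftrightarrow> integrable lborel f"
    using assms(1,2) by (simp add: integrable_restrict_space eq integrable_completion)
qed

lemma test_functions_Ck: "\<phi> \<in> test_functions \<Omega> \<Longrightarrow> Ck k \<phi>"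
  by (simp add: test_functions_def)

lemma test_functions_eq_0: "\<phi> \<in> test_functions \<Omega> \<Longrightarrow> x \<notin> \<Omega> \<Longrightarrow> \<phi> x = 0"
  using closure_subset[of "{x. \<phi> x \<noteq> 0}"] by (auto simp: test_functions_def)

lemma test_functions_frechet_eq_0:
  assumes "\<phi> \<in> test_functions \<Omega>" "x \<notin> \<Omega>"
  shows "frechet_derivative \<phi> (at x) h = 0"
proof -
  define S where "S = - closure {x. \<phi> x \<noteq> 0}"
  have "x \<in> S" "open S" using assms unfolding test_functions_def S_def by blast+
  moreover have "\<phi> y = 0" if "y \<in> S" for y
    using that closure_subset[of "{x. \<phi> x \<noteq> 0}"] unfolding S_def by blast
  ultimately have "frechet_derivative \<phi> (at x) = (\<lambda>h. 0)"
    by (intro frechet_derivative_eq_0)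
  then show ?thesis by simp
qed

lemma test_functions_support:
  assumes "\<phi> \<in> test_functions \<Omega>"
  obtains R where "\<And>x. norm x > R \<Longrightarrow> \<phi> x = 0" "\<And>x h. norm x > R \<Longrightarrow> frechet_derivative \<phi> (at x) h = 0"
proof -
  have "bounded {x. \<phi> x \<noteq> 0}"
    using assms compact_imp_bounded bounded_subset[OF _ closure_subset]
    unfolding test_functions_def by blast
  then obtain R where "\<And>x. \<phi> x \<noteq> 0 \<Longrightarrow> norm x \<le> R" by (auto simp: bounded_iff)
  then have *: "\<And>x. norm x > R \<Longrightarrow> \<phi> x = 0" by force
  have "open {x::'a. norm x > R}" by (intro open_Collect_less continuous_intros)
  then have "frechet_derivative \<phi> (at x) = (\<lambda>h. 0)" if "norm x > R" for x
    by (rule frechet_derivative_eq_0) (use that * in auto)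
  with * show thesis
    by (intro that[of R]) simp_all
qed

lemma test_functions_bounds:
  assumes "\<phi> \<in> test_functions \<Omega>" "b \<in> Basis"
  obtains M where "\<And>x. \<bar>\<phi> x\<bar> \<le> M" "\<And>x. \<bar>frechet_derivative \<phi> (at x) b\<bar> \<le> M"
proof -
  obtain R where R: "\<And>x. norm x > R \<Longrightarrow> \<phi> x = 0"
      "\<And>x h. norm x > R \<Longrightarrow> frechet_derivative \<phi> (at x) h = 0"
    using test_functions_support[OF assms(1)] by blast
  have R2: "\<And>x. norm x > R \<Longrightarrow> frechet_derivative \<phi> (at x) b = 0" by (rule R(2))
  have C: "continuous_on UNIV \<phi>" "continuous_on UNIV (\<lambda>x. frechet_derivative \<phi> (at x) b)"
    using test_functions_Ck[OF assms(1)] assms(2) by (auto intro: Ck_continuous_on Ck_frechet)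
  obtain M where M: "M > 0" "\<And>x. \<bar>\<phi> x\<bar> \<le> M"
    using continuous_bounded_support_bound[OF C(1) R(1)] by blast
  obtain N where N: "N > 0" "\<And>x. \<bar>frechet_derivative \<phi> (at x) b\<bar> \<le> N"
    using continuous_bounded_support_bound[OF C(2) R2] by blast
  show thesis
  proof (rule that)
    show "\<bar>\<phi> x\<bar> \<le> M + N" for x
      using M(2)[of x] N(1) by linarith
    show "\<bar>frechet_derivative \<phi> (at x) b\<bar> \<le> M + N" for x
      using N(2)[of x] M(1) by linarith
  qed
qed

lemma test_functionsI:
  assumes "\<And>k. Ck k \<phi>" "compact K" "K \<subseteq> \<Omega>" "\<And>x. x \<notin> K \<Longrightarrow> \<phi> x = 0"
  shows "\<phi> \<in> test_functions \<Omega>"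
proof -
  have "closure {x. \<phi> x \<noteq> 0} \<subseteq> K"
    using assms(2,4) by (intro closure_minimal) (auto simp: compact_imp_closed)
  moreover from this have "compact (closure {x. \<phi> x \<noteq> 0})"
    using compact_closure bounded_subset[OF compact_imp_bounded[OF assms(2)]]
      closure_subset[of "{x. \<phi> x \<noteq> 0}"] by (meson order_trans)
  ultimately show ?thesis using assms by (auto simp: test_functions_def)
qed

text \<open>The support of \<phi> makes u \<phi> compactly supported, so the integral of its partial
  derivative is 0. Both terms of the product rule vanish outside \<Omega>, so they may be integrated
  over the whole space.\<close>

lemma has_weak_partial_frechet:
  assumes "open \<Omega>" "Ck (Suc 0) u" "b \<in> Basis"
  shows "has_weak_partial \<Omega> b u (\<lambda>x. frechet_derivative u (at x) b)"
  unfolding has_weak_partial_def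
proof
  fix \<phi> assume \<phi>: "\<phi> \<in> test_functions \<Omega>"
  obtain R where R: "\<And>x. norm x > R \<Longrightarrow> \<phi> x = 0"
      "\<And>x h. norm x > R \<Longrightarrow> frechet_derivative \<phi> (at x) h = 0"
    using test_functions_support[OF \<phi>] by blast
  have sets: "\<Omega> \<in> sets lebesgue" using assms(1) by (simp add: borel_open)
  note C1 = assms(2) test_functions_Ck[OF \<phi>, of "Suc 0"]
  let ?A = "\<lambda>x. u x * frechet_derivative \<phi> (at x) b" and ?B = "\<lambda>x. frechet_derivative u (at x) b * \<phi> x"
  have "Ck 0 ?A" "Ck 0 ?B"
    using C1 assms(3) by (auto intro!: Ck_mult intro: Ck_frechet Ck_Suc_D simp del: Ck.simps)
  then have cont: "continuous_on UNIV ?A" "continuous_on UNIV ?B"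
    by (auto intro: Ck_continuous_on)
  have int: "integrable lborel ?A" "integrable lborel ?B"
    using R by (auto intro!: integrable_continuous_bounded_support[where R=R] cont)
  have "frechet_derivative (\<lambda>x. u x * \<phi> x) (at x) b = ?A x + ?B x" for x
    using frechet_derivative_at[OF has_derivative_mult[OF Ck_has_derivative[OF C1(1)] Ck_has_derivative[OF C1(2)]], of x]
    by (metis)
  then have "(LINT x|lborel. ?A x + ?B x) = 0"
    using integral_partial_eq_0[OF Ck_mult[OF C1] assms(3), of R] R by simp
  then have "(LINT x|lborel. ?A x) = - (LINT x|lborel. ?B x)"
    using int by simp
  moreover have "?A \<in> borel_measurable borel" "?B \<in> borel_measurable borel"
    using cont by (auto intro: borel_measurable_continuous_onI)
  ultimately show "(LINT x|lebesgue_on \<Omega>. ?A x) = - (LINT x|lebesgue_on \<Omega>. ?B x)"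
    using lebesgue_on_integral_eq_lborel(1)[OF sets, of ?A] lebesgue_on_integral_eq_lborel(1)[OF sets, of ?B]
      test_functions_eq_0[OF \<phi>] test_functions_frechet_eq_0[OF \<phi>] by simp
qed


section \<open>The fundamental lemma of the calculus of variations\<close>

lemma tendsto_flat_exp_mult:
  assumes "y > 0"
  shows "(\<lambda>n. flat_exp 0 (real (Suc n) * y)) \<longlonglongrightarrow> 1"
proof -
  have "(\<lambda>n. exp (- (inverse (real (Suc n)) * inverse y))) \<longlonglongrightarrow> exp (- (0 * inverse y))"
    by (intro tendsto_intros LIMSEQ_inverse_real_of_nat)
  then show ?thesis
    using assms by (simp add: flat_exp_def mult_le_0_iff)
qed

lemma box_indicator_limit_test_functions:
  fixes a c :: "'a::euclidean_space"
  assumes "cbox a c \<subseteq> \<Omega>"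
  obtains \<phi> where "\<And>n. \<phi> n \<in> test_functions \<Omega>" "\<And>n x. \<bar>\<phi> n x\<bar> \<le> 1"
    "\<And>x. (\<lambda>n. \<phi> n x) \<longlonglongrightarrow> indicator (box a c) x"
proof
  \<comment> \<open>Each factor is exactly 0 on the wrong side of its face of the box and tends to 1
    on the inner side, as -1/((n+1) y) tends to 0 for y > 0.\<close>
  define \<phi> where "\<phi> n x = (\<Prod>i\<in>Basis. flat_exp 0 (real (Suc n) * (x \<bullet> i - a \<bullet> i)) *
      flat_exp 0 (real (Suc n) * (c \<bullet> i - x \<bullet> i)))" for n and x :: 'a
  have 0: "\<phi> n x = 0" if x: "x \<notin> box a c" for x n
  proof -
    obtain i where i: "i \<in> Basis" "x \<bullet> i - a \<bullet> i \<le> 0 \<or> c \<bullet> i - x \<bullet> i \<le> 0"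
      using x by (force simp: mem_box)
    then have "real (Suc n) * (x \<bullet> i - a \<bullet> i) \<le> 0 \<or> real (Suc n) * (c \<bullet> i - x \<bullet> i) \<le> 0"
      by (auto simp only: mult_le_0_iff of_nat_0_le_iff)
    then show ?thesis
      unfolding \<phi>_def using i(1) by (intro prod_zero) (auto simp: flat_exp_def)
  qed
  show "\<phi> n \<in> test_functions \<Omega>" for n
  proof (rule test_functionsI[of _ "cbox a c"])
    show "Ck k (\<phi> n)" for k
      unfolding \<phi>_def
      by (intro Ck_prod finite_Basis Ck_mult[of k "\<lambda>x. flat_exp 0 (_ x)"]
          Ck_compose[OF Ck_flat_exp] Ck_mult[OF Ck_const] Ck_diff Ck_const
          Ck_bounded_linear bounded_linear_inner_left)
    show "\<phi> n x = 0" if "x \<notin> cbox a c" for x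
      using 0 that box_subset_cbox by blast
  qed (use assms in auto)
  show "\<bar>\<phi> n x\<bar> \<le> 1" for n x
    unfolding \<phi>_def abs_prod
    by (rule prod_le_1) (auto simp: abs_mult flat_exp_nonneg flat_exp_0_le_1 mult_le_one)
  show "(\<lambda>n. \<phi> n x) \<longlonglongrightarrow> indicator (box a c) x" for x
  proof (cases "x \<in> box a c")
    case True
    have "(\<lambda>n. \<phi> n x) \<longlonglongrightarrow> (\<Prod>i\<in>(Basis::'a set). 1 * 1)"
      unfolding \<phi>_def using True
      by (intro tendsto_prod tendsto_mult tendsto_flat_exp_mult) (auto simp: mem_box)
    then show ?thesis using True by simp
  next
    case False
    then show ?thesis using 0 by simp
  qed
qed

text \<open>Dominated convergence with majorant |f| gives the open box, and the boundary of a box is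
  a null set. Closed boxes are wanted because they are stable under intersection and exhaust open
  sets by countable unions.\<close>

lemma integral_box_eq_0_if_test_functions:
  fixes f :: "'a::euclidean_space \<Rightarrow> real"
  assumes "integrable (lebesgue_on \<Omega>) f" "open \<Omega>"
    and "\<And>\<phi>. \<phi> \<in> test_functions \<Omega> \<Longrightarrow> (LINT x|lebesgue_on \<Omega>. f x * \<phi> x) = 0"
    and "cbox a c \<subseteq> \<Omega>"
  shows "(LINT x|lebesgue_on \<Omega>. indicator (cbox a c) x * f x) = 0"
proof -
  obtain \<phi> where \<phi>: "\<And>n. \<phi> n \<in> test_functions \<Omega>" "\<And>n x. \<bar>\<phi> n x\<bar> \<le> 1"
    "\<And>x. (\<lambda>n. \<phi> n x) \<longlonglongrightarrow> indicator (box a c) x"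
    using box_indicator_limit_test_functions[OF assms(4)] by blast
  have [measurable]: "f \<in> borel_measurable (lebesgue_on \<Omega>)"
    using assms(1) by auto
  have b[measurable]: "A \<in> sets borel \<Longrightarrow> indicator A \<in> borel_measurable (lebesgue_on \<Omega>)" for A :: "'a set"
    by (intro borel_measurable_lebesgue_onI) simp
  have "(\<lambda>n. LINT x|lebesgue_on \<Omega>. f x * \<phi> n x) \<longlonglongrightarrow> (LINT x|lebesgue_on \<Omega>. f x * indicator (box a c) x)"
  proof (rule integral_dominated_convergence[where w="\<lambda>x. \<bar>f x\<bar>"])
    show "(\<lambda>x. f x * \<phi> n x) \<in> borel_measurable (lebesgue_on \<Omega>)" for n
    proof -
      have "\<phi> n \<in> borel_measurable borel"
        using test_functions_Ck[OF \<phi>(1), of 0] by (auto intro: borel_measurable_continuous_onI)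
      then have "\<phi> n \<in> borel_measurable (lebesgue_on \<Omega>)"
        by (rule borel_measurable_lebesgue_onI)
      then show ?thesis by simp
    qed
    show "(\<lambda>x. f x * indicator (box a c) x) \<in> borel_measurable (lebesgue_on \<Omega>)"
      by (intro borel_measurable_times) auto
    show "AE x in lebesgue_on \<Omega>. (\<lambda>n. f x * \<phi> n x) \<longlonglongrightarrow> f x * indicator (box a c) x"
      by (intro AE_I2 tendsto_intros \<phi>(3))
    show "AE x in lebesgue_on \<Omega>. norm (f x * \<phi> n x) \<le> \<bar>f x\<bar>" for n
      using \<phi>(2)[of n] by (intro AE_I2) (simp add: abs_mult mult_left_le)
  qed (use assms(1) in auto)
  then have "(LINT x|lebesgue_on \<Omega>. f x * indicator (box a c) x) = 0"
    using assms(3)[OF \<phi>(1)] by (simp add: LIMSEQ_const_iff)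
  moreover have "(LINT x|lebesgue_on \<Omega>. indicator (cbox a c) x * f x) = (LINT x|lebesgue_on \<Omega>. f x * indicator (box a c) x)"
  proof (rule integral_cong_AE)
    have "AE x in lebesgue. x \<notin> cbox a c - box a c"
      using negligible_frontier_interval[of a c] by (intro AE_not_in) (simp add: negligible_iff_null_sets)
    then have "AE x in lebesgue_on \<Omega>. x \<notin> cbox a c - box a c"
      using assms(2) by (subst AE_restrict_space_iff) (auto elim!: eventually_mono)
    then show "AE x in lebesgue_on \<Omega>. indicator (cbox a c) x * f x = f x * indicator (box a c) x"
      by eventually_elim (use box_subset_cbox[of a c] in \<open>auto simp: indicator_def\<close>)
  qed (auto intro!: borel_measurable_times)
  ultimately show ?thesis by simp
qed

text \<open>A Dynkin argument: the integrals of a localised \<open>f\<close> vanish on closed boxes,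
  hence on the sigma-algebra these generate within \<Omega>. It contains the open subsets of
  \<Omega>, and up to null sets all Lebesgue measurable ones.\<close>

lemma fundamental_lemma_calculus_of_variations:
  fixes f :: "'a::euclidean_space \<Rightarrow> real"
  assumes f: "integrable (lebesgue_on \<Omega>) f" and op: "open \<Omega>" and bd: "bounded \<Omega>"
    and test: "\<And>\<phi>. \<phi> \<in> test_functions \<Omega> \<Longrightarrow> (LINT x|lebesgue_on \<Omega>. f x * \<phi> x) = 0"
  shows "AE x in lebesgue_on \<Omega>. f x = 0"
proof -
  let ?M = "lebesgue_on \<Omega>"
  define G where "G = {X. X \<subseteq> \<Omega> \<and> (\<exists>a c. X = cbox a c)}"
  have G_Pow: "G \<subseteq> Pow \<Omega>" by (auto simp: G_def)
  have lebesgue: "\<Omega> \<in> sets lebesgue" using op by (simp add: borel_open)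
  have sets_M: "A \<in> sets ?M \<longleftrightarrow> A \<in> sets lebesgue \<and> A \<subseteq> \<Omega>" for A
    using lebesgue by (auto simp: sets_restrict_space_iff)
  have G_sets: "G \<subseteq> sets ?M"
    unfolding G_def by (auto simp: sets_M)
  then have sub: "sigma_sets \<Omega> G \<subseteq> sets ?M"
    using sets.sigma_sets_subset[of G ?M] by (simp add: space_restrict_space)
  have open_sigma: "U \<in> sigma_sets \<Omega> G" if U: "open U" "U \<subseteq> \<Omega>" for U
  proof -
    obtain D where D: "countable D" "D \<subseteq> Pow U" "\<And>X. X \<in> D \<Longrightarrow> \<exists>a b. X = cbox a b" "\<Union>D = U"
      by (rule open_countable_Union_open_cbox[OF U(1)]) (rule that)
    then have "D \<subseteq> sigma_sets \<Omega> G"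
      using U(2) by (auto simp: G_def intro!: sigma_sets.Basic)
    then show ?thesis
      using sigma_sets_UNION[OF D(1), of \<Omega> G] D(4) by auto
  qed
  have sfin: "sigma_finite_measure ?M"
    using finite_measure_lebesgue_on[OF lmeasurable_open[OF bd op]] by (simp add: finite_measure_def)
  have stable: "Int_stable G"
  proof (rule Int_stableI)
    fix A B assume "A \<in> G" "B \<in> G"
    then obtain a b c d where AB: "A = cbox a b" "B = cbox c d" and sub: "A \<subseteq> \<Omega>"
      by (auto simp: G_def)
    have "\<exists>a' b'. A \<inter> B = cbox a' b'"
      unfolding AB Int_interval by (intro exI) (rule refl)
    with sub show "A \<inter> B \<in> G" by (auto simp: G_def)
  qed
  have G_0: "(LINT x|?M. indicator B x * f x) = 0" if "B \<in> G" for B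
    using that integral_box_eq_0_if_test_functions[OF f op test] by (auto simp: G_def)
  \<comment> \<open>The complement step of the Dynkin induction needs the total integral to vanish,
    but \<Omega> need not be a box. So \<open>f\<close> is first cut off to one box
    \<open>B\<close>: the total integral is then the one over \<open>B\<close>, and boxes
    intersected with \<open>B\<close> remain boxes.\<close>
  have AE_G: "AE x in ?M. indicator B x * f x = 0" if B: "B \<in> G" for B
  proof (rule sigma_finite_measure.density_zero[OF sfin])
    let ?f = "\<lambda>x. indicator B x * f x"
    show fB: "integrable ?M ?f"
      using integrable_mult_indicator[OF _ f, of B] B G_sets by auto
    have int: "integrable ?M (\<lambda>x. indicator A x * ?f x)" if "A \<in> sets ?M" for A
      using integrable_mult_indicator[OF that fB] by simp
    have sigma: "(LINT x|?M. indicator A x * ?f x) = 0" if "A \<in> sigma_sets \<Omega> G" for A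
      using stable G_Pow that
    proof (induction rule: sigma_sets_induct_disjoint)
      case (basic A)
      then have "A \<inter> B \<in> G" using stable B by (auto simp: Int_stable_def)
      from G_0[OF this] show ?case by (simp add: indicator_inter_arith mult.assoc)
    next
      case (compl A)
      have "(LINT x|?M. indicator (\<Omega> - A) x * ?f x) = (LINT x|?M. ?f x - indicator A x * ?f x)"
        by (rule Bochner_Integration.integral_cong) (auto simp: space_restrict_space indicator_def)
      also have "\<dots> = 0"
        using compl int[of A] fB sub G_0[OF B] by auto
      finally show ?case .
    next
      case (union A)
      have A: "A i \<in> sets ?M" for i using union sub by auto
      have "set_lebesgue_integral ?M (\<Union>i. A i) ?f = (\<Sum>i. set_lebesgue_integral ?M (A i) ?f)"
      proof (rule lebesgue_integral_countable_add)
        show "set_integrable ?M (\<Union>i. A i) ?f"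
          unfolding set_integrable_def by (rule integrable_mult_indicator[OF _ fB]) (use A in auto)
      qed (use A union(1) in \<open>auto simp: disjoint_family_on_def\<close>)
      then show ?case using union(3) by (simp add: set_lebesgue_integral_def)
    qed simp
    show "set_lebesgue_integral ?M A ?f = 0" if A: "A \<in> sets ?M" for A
    proof -
      \<comment> \<open>Up to a null set, a Lebesgue measurable set is a countable union of compact
        sets; these arise from open sets as complements relative to \<Omega>.\<close>
      obtain C T where CT: "fsigma C" "T \<in> null_sets lebesgue" "C \<union> T = A"
        by (rule lebesgue_set_almost_fsigma[OF conjunct1[OF sets_M[THEN iffD1, OF A]]]) (rule that)
      obtain F :: "nat \<Rightarrow> 'a set" where F: "range F \<subseteq> Collect compact" "C = \<Union>(range F)"
        using CT(1) unfolding fsigma_Union_compact by blast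
      have "F i \<in> sigma_sets \<Omega> G" for i
      proof -
        have "\<Omega> - F i \<in> sigma_sets \<Omega> G"
          using F(1) op by (intro open_sigma) (auto intro!: open_Diff compact_imp_closed)
        then have "\<Omega> - (\<Omega> - F i) \<in> sigma_sets \<Omega> G" by (rule sigma_sets.Compl)
        moreover have "\<Omega> - (\<Omega> - F i) = F i"
          using CT(3) A UN_upper[of i UNIV F] F(2) by (auto simp: sets_M)
        ultimately show ?thesis by simp
      qed
      then have "C \<in> sigma_sets \<Omega> G"
        unfolding F(2) by (intro sigma_sets.Union)
      then have C: "(LINT x|?M. indicator C x * ?f x) = 0" "C \<in> sets ?M" using sigma sub by auto
      have "AE x in lebesgue. x \<notin> T" using CT(2) by (rule AE_not_in)
      then have "AE x in ?M. x \<notin> T"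
        using lebesgue by (subst AE_restrict_space_iff) (auto elim!: eventually_mono)
      then have ae: "AE x in ?M. indicator A x * ?f x = indicator C x * ?f x"
        by eventually_elim (use CT(3) in \<open>auto simp: indicator_def\<close>)
      have "(LINT x|?M. indicator A x * ?f x) = (LINT x|?M. indicator C x * ?f x)"
        by (rule integral_cong_AE[OF _ _ ae]) (use int[OF A] int[OF C(2)] in auto)
      with C show ?thesis by (simp add: set_lebesgue_integral_def)
    qed
  qed
  \<comment> \<open>Countably many closed boxes cover \<Omega>, so the exceptional null sets of the
    single boxes can be united.\<close>
  obtain D where D: "countable D" "D \<subseteq> Pow \<Omega>" "\<And>X. X \<in> D \<Longrightarrow> \<exists>a b. X = cbox a b" "\<Union>D = \<Omega>"
    by (rule open_countable_Union_open_cbox[OF op]) (rule that)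
  have "D \<subseteq> G" using D by (auto simp: G_def)
  then have "AE x in ?M. \<forall>B\<in>D. indicator B x * f x = 0"
    using AE_G D(1) by (subst AE_ball_countable) auto
  then show ?thesis
    using AE_space by eventually_elim (use D(4) in \<open>auto simp: space_restrict_space indicator_def split: if_splits\<close>)
qed

section \<open>Dual spaces and weak derivatives\<close>

lemma dual_space_add:
  assumes "\<eta> \<in> dual_space V N" "\<theta> \<in> dual_space V N"
  shows "\<eta> + \<theta> \<in> dual_space V N"
proof -
  obtain C D where C: "\<forall>x\<in>V. \<bar>\<eta> x\<bar> \<le> C * N x" and D: "\<forall>x\<in>V. \<bar>\<theta> x\<bar> \<le> D * N x"
    using assms unfolding dual_space_def by auto
  have "\<forall>x\<in>V. \<bar>(\<eta> + \<theta>) x\<bar> \<le> (C + D) * N x"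
    using C D by (force simp: distrib_right)
  then have "\<exists>C. \<forall>x\<in>V. \<bar>(\<eta> + \<theta>) x\<bar> \<le> C * N x" by blast
  then show ?thesis
    using assms unfolding dual_space_def by (simp add: algebra_simps)
qed

lemma dual_space_scaleR:
  assumes "\<eta> \<in> dual_space V N"
  shows "c *\<^sub>R \<eta> \<in> dual_space V N"
proof -
  obtain C where C: "\<forall>x\<in>V. \<bar>\<eta> x\<bar> \<le> C * N x"
    using assms unfolding dual_space_def by auto
  have "\<forall>x\<in>V. \<bar>(c *\<^sub>R \<eta>) x\<bar> \<le> (\<bar>c\<bar> * C) * N x"
    using C by (auto simp: scaleR_fun_def abs_mult mult.assoc mult_left_mono)
  then have "\<exists>C. \<forall>x\<in>V. \<bar>(c *\<^sub>R \<eta>) x\<bar> \<le> C * N x" by blast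
  then show ?thesis
    using assms unfolding dual_space_def by (simp add: algebra_simps scaleR_fun_def)
qed

lemma dual_space_diff:
  "\<eta> \<in> dual_space V N \<Longrightarrow> \<theta> \<in> dual_space V N \<Longrightarrow> \<eta> - \<theta> \<in> dual_space V N"
  using dual_space_add[of \<eta> V N "(-1) *\<^sub>R \<theta>"] dual_space_scaleR[of \<theta> V N "-1"] by simp

text \<open>For \<open>N x\<close> > 0 one normalises. If \<open>N x\<close> = 0, which a seminorm
  permits for nonzero \<open>x\<close>, all multiples of \<open>x\<close> lie in the unit ball, so a
  finite bound there forces \<open>\<eta> x\<close> = 0.\<close>

lemma bounded_on_unit_ball_imp_bounded:
  fixes V :: "'v::real_vector set"
  assumes "x \<in> V"
    and V: "\<And>c x. x \<in> V \<Longrightarrow> c *\<^sub>R x \<in> V"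
    and N: "\<And>c x. x \<in> V \<Longrightarrow> N (c *\<^sub>R x) = \<bar>c\<bar> * N x" "\<And>x. x \<in> V \<Longrightarrow> 0 \<le> N x"
    and \<eta>: "\<And>c x. x \<in> V \<Longrightarrow> \<eta> (c *\<^sub>R x) = c * \<eta> x"
    and C: "\<And>x. x \<in> V \<Longrightarrow> N x \<le> 1 \<Longrightarrow> \<bar>\<eta> x\<bar> \<le> C"
  shows "\<bar>\<eta> x\<bar> \<le> C * N x"
proof (cases "N x = 0")
  case True
  have "\<bar>\<eta> x\<bar> \<le> \<epsilon>" if "\<epsilon> > 0" for \<epsilon> :: real
  proof -
    have C0: "0 \<le> C" using C[OF V[of x 0]] N(1)[of x 0] \<open>x \<in> V\<close> by auto
    \<comment> \<open>\<open>C + 1\<close> instead of \<open>C\<close> gives a positive factor,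
      which can be cancelled at the end even if \<open>C\<close> = 0.\<close>
    let ?c = "(C + 1) / \<epsilon>"
    have "\<bar>\<eta> (?c *\<^sub>R x)\<bar> \<le> C"
      using True \<open>x \<in> V\<close> by (intro C V) (auto simp: N)
    then have "(C + 1) / \<epsilon> * \<bar>\<eta> x\<bar> \<le> C"
      using C0 that \<open>x \<in> V\<close> by (simp add: \<eta> abs_mult)
    then have "(C + 1) * \<bar>\<eta> x\<bar> \<le> C * \<epsilon>"
      using that by (simp add: field_simps)
    also have "\<dots> \<le> (C + 1) * \<epsilon>" using that C0 by (intro mult_right_mono) auto
    finally show ?thesis using C0 by simp
  qed
  then have "\<bar>\<eta> x\<bar> \<le> 0" by (rule field_le_epsilon[of _ 0, simplified])
  then show ?thesis using True by simp
next
  case False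
  then have pos: "N x > 0" using N(2)[OF \<open>x \<in> V\<close>] by simp
  then have "\<bar>\<eta> ((1 / N x) *\<^sub>R x)\<bar> \<le> C"
    using \<open>x \<in> V\<close> by (intro C V) (auto simp: N)
  then show ?thesis using pos \<open>x \<in> V\<close> by (simp add: \<eta> abs_mult field_simps)
qed

lemma dual_norm_bound:
  fixes V :: "'v::real_vector set"
  assumes \<eta>: "\<eta> \<in> dual_space V N" and "x \<in> V"
    and V: "\<And>c x. x \<in> V \<Longrightarrow> c *\<^sub>R x \<in> V"
    and N: "\<And>c x. x \<in> V \<Longrightarrow> N (c *\<^sub>R x) = \<bar>c\<bar> * N x" "\<And>x. x \<in> V \<Longrightarrow> 0 \<le> N x"
  shows "\<bar>\<eta> x\<bar> \<le> dual_norm V N \<eta> * N x"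
proof (rule bounded_on_unit_ball_imp_bounded[OF \<open>x \<in> V\<close> V N])
  show "\<eta> (c *\<^sub>R x) = c * \<eta> x" if "x \<in> V" for c x
    using \<eta> that by (auto simp: dual_space_def)
  obtain C where C: "\<forall>x\<in>V. \<bar>\<eta> x\<bar> \<le> C * N x"
    using \<eta> by (auto simp: dual_space_def)
  \<comment> \<open>A real supremum is informative only for a non-empty set that is bounded above.
    The bound is \<open>\<bar>C\<bar>\<close> because the sign of the continuity constant is
    unknown.\<close>
  have "bdd_above ((\<lambda>x. \<bar>\<eta> x\<bar>) ` {x \<in> V. N x \<le> 1})"
  proof (rule bdd_aboveI2)
    fix x assume x: "x \<in> {x \<in> V. N x \<le> 1}"
    then have "\<bar>\<eta> x\<bar> \<le> C * N x" using C by auto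
    also have "\<dots> \<le> \<bar>C\<bar> * 1" using x N(2) by (intro mult_mono) auto
    finally show "\<bar>\<eta> x\<bar> \<le> \<bar>C\<bar>" by simp
  qed
  then show "\<bar>\<eta> x\<bar> \<le> dual_norm V N \<eta>" if "x \<in> V" "N x \<le> 1" for x
    unfolding dual_norm_def using that by (intro cSUP_upper) auto
qed

text \<open>The element \<open>x\<close> certifies that the unit ball is non-empty; the supremum of
  the empty set of reals would be an uninformative default.\<close>

lemma dual_norm_le:
  assumes "\<And>x. x \<in> V \<Longrightarrow> N x \<le> 1 \<Longrightarrow> \<bar>\<eta> x\<bar> \<le> C" "x \<in> V" "N x \<le> 1"
  shows "dual_norm V N \<eta> \<le> C"
  unfolding dual_norm_def by (rule cSUP_least) (use assms in auto)

section \<open>Lebesgue spaces and weak derivatives on bounded open sets\<close>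

text \<open>The constant 2^p comes from bounding the sum by twice the maximum; this suffices for
  closedness under addition of the Lebesgue and fractional Sobolev spaces.\<close>

lemma abs_add_powr_le:
  fixes a b p :: real
  assumes "p \<ge> 0"
  shows "\<bar>a + b\<bar> powr p \<le> 2 powr p * (\<bar>a\<bar> powr p + \<bar>b\<bar> powr p)"
proof -
  have "\<bar>a + b\<bar> powr p \<le> (2 * max \<bar>a\<bar> \<bar>b\<bar>) powr p"
    by (rule powr_mono2) (use assms in auto)
  also have "\<dots> = 2 powr p * max \<bar>a\<bar> \<bar>b\<bar> powr p"
    by (simp add: powr_mult)
  also have "\<dots> \<le> 2 powr p * (\<bar>a\<bar> powr p + \<bar>b\<bar> powr p)"
    by (intro mult_left_mono) (auto simp: max_def)
  finally show ?thesis .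
qed

text \<open>Replaces Hoelder's inequality: optimising over \<open>T\<close> recovers the right power of the radius.\<close>

lemma le_add_powr:
  fixes t T p :: real
  assumes "t \<ge> 0" "T > 0" "p \<ge> 1"
  shows "t \<le> T + T powr (1 - p) * t powr p"
proof (cases "t \<le> T")
  case True
  then show ?thesis by (smt (verit) mult_nonneg_nonneg powr_ge_zero)
next
  case False
  then have "t = t powr (1 - p) * t powr p"
    using assms by (simp flip: powr_add)
  also have "\<dots> \<le> T powr (1 - p) * t powr p"
    using assms False by (intro mult_right_mono powr_mono2') auto
  finally show ?thesis using assms by simp
qed

lemma Lp_space_add:
  assumes "u \<in> Lp_space \<Omega> p" "v \<in> Lp_space \<Omega> p" "p \<ge> 0"
  shows "(\<lambda>x. u x + v x) \<in> Lp_space \<Omega> p"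
proof -
  have [measurable]: "u \<in> borel_measurable (lebesgue_on \<Omega>)" "v \<in> borel_measurable (lebesgue_on \<Omega>)"
    and int: "integrable (lebesgue_on \<Omega>) (\<lambda>x. \<bar>u x\<bar> powr p)" "integrable (lebesgue_on \<Omega>) (\<lambda>x. \<bar>v x\<bar> powr p)"
    using assms by (auto simp: Lp_space_def)
  have "integrable (lebesgue_on \<Omega>) (\<lambda>x. \<bar>u x + v x\<bar> powr p)"
  proof (rule Bochner_Integration.integrable_bound)
    show "integrable (lebesgue_on \<Omega>) (\<lambda>x. 2 powr p * (\<bar>u x\<bar> powr p + \<bar>v x\<bar> powr p))"
      using int by auto
  qed (use abs_add_powr_le[OF assms(3)] in auto)
  then show ?thesis by (auto simp: Lp_space_def)
qed

lemma Lp_space_cmult: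
  assumes "u \<in> Lp_space \<Omega> p"
  shows "(\<lambda>x. c * u x) \<in> Lp_space \<Omega> p"
  using assms by (auto simp: Lp_space_def abs_mult powr_mult)

locale bounded_open =
  fixes \<Omega> :: "'a::euclidean_space set"
  assumes open_dom: "open \<Omega>" and bounded_dom: "bounded \<Omega>"
begin

lemma lebesgue_dom: "\<Omega> \<in> sets lebesgue"
  using open_dom by (simp add: borel_open)

lemma finite_measure_dom: "finite_measure (lebesgue_on \<Omega>)"
  by (intro finite_measure_lebesgue_on lmeasurable_open bounded_dom open_dom)

lemma continuous_on_measurable_dom: "continuous_on UNIV f \<Longrightarrow> f \<in> borel_measurable (lebesgue_on \<Omega>)"
  for f :: "'a \<Rightarrow> real"
  by (intro borel_measurable_lebesgue_onI borel_measurable_continuous_onI)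

text \<open>The majorant 1 + |u|^p, which is \<open>le_add_powr\<close> with T = 1, is integrable
  because the domain has finite measure.\<close>

lemma Lp_space_integrable:
  assumes "u \<in> Lp_space \<Omega> p" "p \<ge> 1"
  shows "integrable (lebesgue_on \<Omega>) u"
proof (rule Bochner_Integration.integrable_bound)
  interpret finite_measure "lebesgue_on \<Omega>" by (rule finite_measure_dom)
  show "integrable (lebesgue_on \<Omega>) (\<lambda>x. 1 + \<bar>u x\<bar> powr p)"
    using assms by (auto simp: Lp_space_def)
  show "AE x in lebesgue_on \<Omega>. norm (u x) \<le> norm (1 + \<bar>u x\<bar> powr p)"
    using le_add_powr[of "\<bar>u _\<bar>" 1 p] assms(2) by (intro AE_I2) simp
qed (use assms in \<open>auto simp: Lp_space_def\<close>)

lemma Lp_space_integrable_mult: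
  assumes "u \<in> Lp_space \<Omega> p" "p \<ge> 1" "v \<in> borel_measurable (lebesgue_on \<Omega>)"
    and bound: "AE x in lebesgue_on \<Omega>. \<bar>v x\<bar> \<le> C"
  shows "integrable (lebesgue_on \<Omega>) (\<lambda>x. u x * v x)"
proof (rule Bochner_Integration.integrable_bound)
  show "integrable (lebesgue_on \<Omega>) (\<lambda>x. \<bar>C\<bar> * u x)"
    using Lp_space_integrable[OF assms(1,2)] by simp
  show "AE x in lebesgue_on \<Omega>. norm (u x * v x) \<le> norm (\<bar>C\<bar> * u x)"
    using bound by eventually_elim (auto simp: abs_mult mult.commute[of "\<bar>u _\<bar>"] intro!: mult_right_mono)
qed (use assms in \<open>auto simp: Lp_space_def\<close>)

lemma Lp_space_integrable_test:
  assumes "u \<in> Lp_space \<Omega> p" "p \<ge> 1" "\<phi> \<in> test_functions \<Omega>" "b \<in> Basis"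
  shows "integrable (lebesgue_on \<Omega>) (\<lambda>x. u x * \<phi> x)"
    and "integrable (lebesgue_on \<Omega>) (\<lambda>x. u x * frechet_derivative \<phi> (at x) b)"
proof -
  obtain M where M: "\<And>x. \<bar>\<phi> x\<bar> \<le> M" "\<And>x. \<bar>frechet_derivative \<phi> (at x) b\<bar> \<le> M"
    by (rule test_functions_bounds[OF assms(3,4)]) (rule that)
  note C = test_functions_Ck[OF assms(3)]
  show "integrable (lebesgue_on \<Omega>) (\<lambda>x. u x * \<phi> x)"
    using M by (intro Lp_space_integrable_mult[OF assms(1,2), of _ M]
        continuous_on_measurable_dom Ck_continuous_on[OF C[of 0]] AE_I2)
  show "integrable (lebesgue_on \<Omega>) (\<lambda>x. u x * frechet_derivative \<phi> (at x) b)"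
    using M by (intro Lp_space_integrable_mult[OF assms(1,2), of _ M]
        continuous_on_measurable_dom Ck_continuous_on[OF Ck_frechet[OF C[of "Suc 0"] assms(4)]] AE_I2)
qed

lemma has_weak_partial_add:
  assumes "u \<in> Lp_space \<Omega> p" "v \<in> Lp_space \<Omega> p" "g \<in> Lp_space \<Omega> p" "h \<in> Lp_space \<Omega> p"
    and "p \<ge> 1" "b \<in> Basis" "has_weak_partial \<Omega> b u g" "has_weak_partial \<Omega> b v h"
  shows "has_weak_partial \<Omega> b (\<lambda>x. u x + v x) (\<lambda>x. g x + h x)"
  unfolding has_weak_partial_def
proof
  fix \<phi> assume \<phi>: "\<phi> \<in> test_functions \<Omega>"
  note int = Lp_space_integrable_test[OF _ assms(5) \<phi> assms(6)]
  show "(LINT x|lebesgue_on \<Omega>. (u x + v x) * frechet_derivative \<phi> (at x) b) =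
      - (LINT x|lebesgue_on \<Omega>. (g x + h x) * \<phi> x)"
    using assms(7,8) \<phi> unfolding has_weak_partial_def
    by (simp add: distrib_right int[OF assms(1)] int[OF assms(2)] int[OF assms(3)] int[OF assms(4)])
qed

lemma has_weak_partial_cmult:
  assumes "has_weak_partial \<Omega> b u g"
  shows "has_weak_partial \<Omega> b (\<lambda>x. c * u x) (\<lambda>x. c * g x)"
  using assms unfolding has_weak_partial_def by (simp add: mult.assoc)

text \<open>As \<open>weak_partial\<close> is an arbitrary choice, identities between chosen
  derivatives hold only almost everywhere and rest on this fact; homogeneity of the Sobolev norm for
  s = 1 is such a case.\<close>

lemma has_weak_partial_unique:
  assumes "g \<in> Lp_space \<Omega> p" "h \<in> Lp_space \<Omega> p" "p \<ge> 1"
    and "has_weak_partial \<Omega> b u g" "has_weak_partial \<Omega> b u h"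
  shows "AE x in lebesgue_on \<Omega>. g x = h x"
proof -
  have int: "integrable (lebesgue_on \<Omega>) g" "integrable (lebesgue_on \<Omega>) h"
    using assms by (auto intro: Lp_space_integrable)
  obtain c :: 'a where c: "c \<in> Basis" using nonempty_Basis by blast
  have "AE x in lebesgue_on \<Omega>. g x - h x = 0"
  proof (rule fundamental_lemma_calculus_of_variations[OF _ open_dom bounded_dom])
    fix \<phi> assume \<phi>: "\<phi> \<in> test_functions \<Omega>"
    have "(LINT x|lebesgue_on \<Omega>. g x * \<phi> x) = (LINT x|lebesgue_on \<Omega>. h x * \<phi> x)"
      using assms(4,5) \<phi> unfolding has_weak_partial_def by simp
    then show "(LINT x|lebesgue_on \<Omega>. (g x - h x) * \<phi> x) = 0"
      using Lp_space_integrable_test(1)[OF _ assms(3) \<phi> c] assms(1,2)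
      by (simp add: left_diff_distrib)
  qed (use int in simp)
  then show ?thesis by eventually_elim simp
qed

lemma weak_partial:
  assumes "g \<in> Lp_space \<Omega> p" "has_weak_partial \<Omega> b u g"
  shows "weak_partial \<Omega> p b u \<in> Lp_space \<Omega> p" "has_weak_partial \<Omega> b u (weak_partial \<Omega> p b u)"
  using someI[of "\<lambda>g. g \<in> Lp_space \<Omega> p \<and> has_weak_partial \<Omega> b u g" g] assms
  unfolding weak_partial_def by auto

end

section \<open>Sobolev spaces\<close>

locale sobolev_setting = bounded_open \<Omega> for \<Omega> :: "'a::euclidean_space set" +
  fixes s p :: real
  assumes s_pos: "0 < s" and s_le_1: "s \<le> 1" and p_gt_1: "1 < p"
begin

abbreviation W :: "('a \<Rightarrow> real) set" where "W \<equiv> sobolev_space \<Omega> s p"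
abbreviation snorm :: "('a \<Rightarrow> real) \<Rightarrow> real" where "snorm \<equiv> sobolev_norm \<Omega> s p"
abbreviation M2 :: "('a \<times> 'a) measure" where "M2 \<equiv> lebesgue_on \<Omega> \<Otimes>\<^sub>M lebesgue_on \<Omega>"

lemma sobolev_space_Lp: "u \<in> W \<Longrightarrow> u \<in> Lp_space \<Omega> p"
  by (auto simp: sobolev_space_def split: if_splits)

lemma slobodeckij_integrand_nonneg: "0 \<le> slobodeckij_integrand s p u z"
  by (auto simp: slobodeckij_integrand_def split: prod.split)

lemma slobodeckij_integrand_measurable:
  assumes [measurable]: "u \<in> borel_measurable (lebesgue_on \<Omega>)"
  shows "slobodeckij_integrand s p u \<in> borel_measurable M2"
proof -
  \<comment> \<open>Measurability of |x - y| on the product needs Borel-valued projections, which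
    come from the identity viewed as a map from the completed, restricted sigma-algebra to the Borel
    one.\<close>
  have [measurable]: "(\<lambda>x. x) \<in> borel_measurable (lebesgue_on \<Omega>)"
    by (intro borel_measurable_lebesgue_onI) simp
  have [measurable]: "(\<lambda>z. fst z) \<in> M2 \<rightarrow>\<^sub>M borel" "(\<lambda>z. snd z) \<in> M2 \<rightarrow>\<^sub>M borel"
    by (rule measurable_compose[OF measurable_fst \<open>(\<lambda>x. x) \<in> _\<close>])
       (rule measurable_compose[OF measurable_snd \<open>(\<lambda>x. x) \<in> _\<close>])
  show ?thesis
    unfolding slobodeckij_integrand_def case_prod_beta by measurable
qed

lemma slobodeckij_integrand_cmult:
  "slobodeckij_integrand s p (\<lambda>x. c * u x) z = \<bar>c\<bar> powr p * slobodeckij_integrand s p u z"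
proof -
  have "\<bar>c * a - c * b\<bar> powr p = \<bar>c\<bar> powr p * \<bar>a - b\<bar> powr p" for a b
    by (simp add: right_diff_distrib[symmetric] abs_mult powr_mult)
  then show ?thesis
    by (simp add: slobodeckij_integrand_def case_prod_beta)
qed

lemma slobodeckij_integrand_add_le:
  fixes u v :: "'a \<Rightarrow> real"
  shows "slobodeckij_integrand s p (\<lambda>x. u x + v x) z \<le>
    2 powr p * (slobodeckij_integrand s p u z + slobodeckij_integrand s p v z)"
proof -
  obtain x y where z: "z = (x, y)" by force
  have "\<bar>(u x - u y) + (v x - v y)\<bar> powr p \<le> 2 powr p * (\<bar>u x - u y\<bar> powr p + \<bar>v x - v y\<bar> powr p)"
    using p_gt_1 by (intro abs_add_powr_le) simp
  then have "\<bar>(u x - u y) + (v x - v y)\<bar> powr p / norm (x - y) powr (DIM('a) + s * p)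
      \<le> 2 powr p * (\<bar>u x - u y\<bar> powr p + \<bar>v x - v y\<bar> powr p) / norm (x - y) powr (DIM('a) + s * p)"
    by (intro divide_right_mono) auto
  then show ?thesis
    by (simp add: z slobodeckij_integrand_def algebra_simps add_divide_distrib)
qed

lemma weak_partial_sobolev:
  assumes "u \<in> W" "s = 1" "b \<in> Basis"
  shows "weak_partial \<Omega> p b u \<in> Lp_space \<Omega> p" "has_weak_partial \<Omega> b u (weak_partial \<Omega> p b u)"
  using assms weak_partial[of _ p b u] by (auto simp: sobolev_space_def)

lemma sobolev_space_add:
  assumes "u \<in> W" "v \<in> W"
  shows "u + v \<in> W"
proof -
  have Lp: "(\<lambda>x. u x + v x) \<in> Lp_space \<Omega> p"
    using assms p_gt_1 by (intro Lp_space_add sobolev_space_Lp) auto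
  show ?thesis
  proof (cases "s = 1")
    case True
    have "\<exists>g\<in>Lp_space \<Omega> p. has_weak_partial \<Omega> b (\<lambda>x. u x + v x) g" if "b \<in> Basis" for b
      using p_gt_1 that
      by (intro bexI[of _ "\<lambda>x. weak_partial \<Omega> p b u x + weak_partial \<Omega> p b v x"] has_weak_partial_add[where p=p]
          Lp_space_add) (auto intro: assms True weak_partial_sobolev sobolev_space_Lp)
    then show ?thesis
      using True Lp by (simp add: sobolev_space_def plus_fun_def)
  next
    case False
    have "integrable M2 (slobodeckij_integrand s p (\<lambda>x. u x + v x))"
    proof (rule Bochner_Integration.integrable_bound)
      show "integrable M2 (\<lambda>z. 2 powr p * (slobodeckij_integrand s p u z + slobodeckij_integrand s p v z))"
        using assms False by (simp add: sobolev_space_def)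
      show "slobodeckij_integrand s p (\<lambda>x. u x + v x) \<in> borel_measurable M2"
        using Lp by (intro slobodeckij_integrand_measurable) (auto simp: Lp_space_def)
      show "AE z in M2. norm (slobodeckij_integrand s p (\<lambda>x. u x + v x) z)
          \<le> norm (2 powr p * (slobodeckij_integrand s p u z + slobodeckij_integrand s p v z))"
        using slobodeckij_integrand_add_le[of u v] slobodeckij_integrand_nonneg[of "\<lambda>x. u x + v x"]
          slobodeckij_integrand_nonneg[of u] slobodeckij_integrand_nonneg[of v] by (intro AE_I2) (simp add: add_nonneg_nonneg)
    qed
    then show ?thesis
      using False Lp by (simp add: sobolev_space_def plus_fun_def)
  qed
qed

lemma sobolev_space_scaleR:
  assumes "u \<in> W"
  shows "c *\<^sub>R u \<in> W"
proof -
  have Lp: "(\<lambda>x. c * u x) \<in> Lp_space \<Omega> p"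
    using assms by (intro Lp_space_cmult sobolev_space_Lp)
  show ?thesis
  proof (cases "s = 1")
    case True
    have "\<exists>g\<in>Lp_space \<Omega> p. has_weak_partial \<Omega> b (\<lambda>x. c * u x) g" if "b \<in> Basis" for b
      using weak_partial_sobolev[OF assms True that]
      by (intro bexI[of _ "\<lambda>x. c * weak_partial \<Omega> p b u x"] has_weak_partial_cmult Lp_space_cmult)
    then show ?thesis
      using True Lp by (simp add: sobolev_space_def scaleR_fun_def)
  next
    case False
    have "slobodeckij_integrand s p (\<lambda>x. c * u x) = (\<lambda>z. \<bar>c\<bar> powr p * slobodeckij_integrand s p u z)"
      by (rule ext) (rule slobodeckij_integrand_cmult)
    then show ?thesis
      using assms False Lp by (simp add: sobolev_space_def scaleR_fun_def)
  qed
qed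

text \<open>For s = 1 the derivative chosen for c u and \<open>c\<close> times the one chosen for
  \<open>u\<close> agree almost everywhere by uniqueness; the other terms scale pointwise.\<close>

lemma sobolev_norm_scaleR:
  assumes "u \<in> W"
  shows "snorm (c *\<^sub>R u) = \<bar>c\<bar> * snorm u"
proof -
  have 1: "(LINT x|lebesgue_on \<Omega>. \<bar>c * u x\<bar> powr p) = \<bar>c\<bar> powr p * (LINT x|lebesgue_on \<Omega>. \<bar>u x\<bar> powr p)"
    by (simp add: abs_mult powr_mult)
  have 2: "(LINT x|lebesgue_on \<Omega>. \<bar>weak_partial \<Omega> p b (\<lambda>x. c * u x) x\<bar> powr p) =
      \<bar>c\<bar> powr p * (LINT x|lebesgue_on \<Omega>. \<bar>weak_partial \<Omega> p b u x\<bar> powr p)" if "s = 1" "b \<in> Basis" for b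
  proof -
    note wu = weak_partial_sobolev[OF assms that]
    have wcu: "weak_partial \<Omega> p b (\<lambda>x. c * u x) \<in> Lp_space \<Omega> p"
        "has_weak_partial \<Omega> b (\<lambda>x. c * u x) (weak_partial \<Omega> p b (\<lambda>x. c * u x))"
      using weak_partial_sobolev[OF sobolev_space_scaleR[OF assms, of c] that]
      by (simp_all add: scaleR_fun_def)
    have ae: "AE x in lebesgue_on \<Omega>. weak_partial \<Omega> p b (\<lambda>x. c * u x) x = c * weak_partial \<Omega> p b u x"
      using p_gt_1 by (intro has_weak_partial_unique[OF wcu(1) Lp_space_cmult[OF wu(1)] _ wcu(2)
          has_weak_partial_cmult[OF wu(2)]]) simp
    have [measurable]: "weak_partial \<Omega> p b u \<in> borel_measurable (lebesgue_on \<Omega>)"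
      "weak_partial \<Omega> p b (\<lambda>x. c * u x) \<in> borel_measurable (lebesgue_on \<Omega>)"
      using wu(1) wcu(1) unfolding Lp_space_def by blast+
    have "(LINT x|lebesgue_on \<Omega>. \<bar>weak_partial \<Omega> p b (\<lambda>x. c * u x) x\<bar> powr p) =
        (LINT x|lebesgue_on \<Omega>. \<bar>c\<bar> powr p * \<bar>weak_partial \<Omega> p b u x\<bar> powr p)"
    proof (rule integral_cong_AE)
      show "AE x in lebesgue_on \<Omega>. \<bar>weak_partial \<Omega> p b (\<lambda>x. c * u x) x\<bar> powr p =
          \<bar>c\<bar> powr p * \<bar>weak_partial \<Omega> p b u x\<bar> powr p"
        using ae by eventually_elim (simp add: abs_mult powr_mult)
    qed measurable
    also have "\<dots> = \<bar>c\<bar> powr p * (LINT x|lebesgue_on \<Omega>. \<bar>weak_partial \<Omega> p b u x\<bar> powr p)"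
      by (rule integral_mult_right_zero)
    finally show ?thesis .
  qed
  have 3: "slobodeckij_integrand s p (\<lambda>x. c * u x) = (\<lambda>z. \<bar>c\<bar> powr p * slobodeckij_integrand s p u z)"
    by (rule ext) (rule slobodeckij_integrand_cmult)
  have "(LINT x|lebesgue_on \<Omega>. \<bar>c * u x\<bar> powr p) +
      (if s = 1
       then (\<Sum>b\<in>Basis. LINT x|lebesgue_on \<Omega>. \<bar>weak_partial \<Omega> p b (\<lambda>x. c * u x) x\<bar> powr p)
       else (LINT z|M2. slobodeckij_integrand s p (\<lambda>x. c * u x) z)) =
      \<bar>c\<bar> powr p * ((LINT x|lebesgue_on \<Omega>. \<bar>u x\<bar> powr p) +
      (if s = 1
       then (\<Sum>b\<in>Basis. LINT x|lebesgue_on \<Omega>. \<bar>weak_partial \<Omega> p b u x\<bar> powr p)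
       else (LINT z|M2. slobodeckij_integrand s p u z)))"
  proof (cases "s = 1")
    case True
    show ?thesis
      unfolding 1 using True by (simp add: distrib_left sum_distrib_left 2[OF True])
  next
    case False
    then show ?thesis unfolding 1 3 by (simp add: distrib_left)
  qed
  then have "snorm (c *\<^sub>R u) = (\<bar>c\<bar> powr p) powr (1 / p) * snorm u"
    unfolding sobolev_norm_def scaleR_fun_def real_scaleR_def powr_mult[symmetric] by (rule arg_cong)
  then show ?thesis using p_gt_1 by (simp add: powr_powr)
qed

lemma sobolev_norm_nonneg: "0 \<le> snorm u"
  by (simp add: sobolev_norm_def)

text \<open>A sum of non-negative terms whose p-th root is at most 1 is itself at most 1, and so is
  every term. Estimates on the unit ball can therefore work with p-th powers, the form in which
  \<open>le_add_powr\<close> delivers them.\<close>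

lemma sobolev_unit_ball:
  assumes "snorm u \<le> 1"
  shows "(LINT x|lebesgue_on \<Omega>. \<bar>u x\<bar> powr p) \<le> 1"
    and "s = 1 \<Longrightarrow> b \<in> Basis \<Longrightarrow> (LINT x|lebesgue_on \<Omega>. \<bar>weak_partial \<Omega> p b u x\<bar> powr p) \<le> 1"
    and "s \<noteq> 1 \<Longrightarrow> (LINT z|M2. slobodeckij_integrand s p u z) \<le> 1"
proof -
  let ?A = "LINT x|lebesgue_on \<Omega>. \<bar>u x\<bar> powr p"
  let ?B = "\<lambda>b. LINT x|lebesgue_on \<Omega>. \<bar>weak_partial \<Omega> p b u x\<bar> powr p"
  let ?C = "LINT z|M2. slobodeckij_integrand s p u z"
  let ?X = "if s = 1 then (\<Sum>b\<in>Basis. ?B b) else ?C"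
  have nonneg: "0 \<le> ?A" "\<And>b. 0 \<le> ?B b" "0 \<le> ?C"
    by (simp_all add: slobodeckij_integrand_nonneg)
  then have X: "0 \<le> ?X" by (simp add: sum_nonneg)
  have "?A + ?X \<le> 1"
  proof (rule ccontr)
    assume "\<not> ?A + ?X \<le> 1"
    then have "1 < (?A + ?X) powr (1 / p)" using p_gt_1 by (intro gr_one_powr) auto
    then show False using assms by (simp add: sobolev_norm_def)
  qed
  then show "?A \<le> 1" using X by linarith
  show "?C \<le> 1" if "s \<noteq> 1"
  proof -
    have "?A + ?C \<le> 1" using \<open>?A + ?X \<le> 1\<close> that by simp
    then show ?thesis using nonneg(1) by linarith
  qed
  show "?B b \<le> 1" if "s = 1" "b \<in> Basis"
  proof -
    have "?B b \<le> (\<Sum>b\<in>Basis. ?B b)"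
      by (rule member_le_sum) (use that nonneg in auto)
    moreover have "?A + (\<Sum>b\<in>Basis. ?B b) \<le> 1" using \<open>?A + ?X \<le> 1\<close> that by simp
    ultimately show ?thesis using nonneg(1) by linarith
  qed
qed

end

section \<open>Finite Slobodeckij energy of smooth functions\<close>

lemma ex_dyadic:
  fixes q :: real
  assumes "0 < q" "q < 1"
  obtains n where "(1/2) ^ Suc n \<le> q" "q < (1/2) ^ n"
proof -
  obtain N where N: "(1/2) ^ N < q"
    using real_arch_pow_inv[OF assms(1), of "1/2"] by auto
  obtain n where n: "(1/2) ^ n < q" and least: "\<forall>i<n. \<not> (1/2) ^ i < q"
    using exists_least_iff[of "\<lambda>n. (1/2) ^ n < q"] N by blast
  have "n \<noteq> 0" using n assms(2) by (intro notI) simp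
  then obtain m where m: "n = Suc m" using not0_implies_Suc by blast
  have m_le: "q \<le> (1/2) ^ m" using least[rule_format, of m] unfolding m not_less by simp
  show thesis
  \<comment> \<open>The shells are half-open and exclude their outer radius, so a value that is
    exactly a power of 1/2 belongs to the next larger shell.\<close>
  proof (cases "q = (1/2) ^ m")
    case True
    with assms have "m \<noteq> 0" by (intro notI) simp
    then obtain k where k: "m = Suc k" using not0_implies_Suc by blast
    have "q * 2 = (1/2) ^ k" using True unfolding k by simp
    then have "q < (1/2) ^ k" using assms(1) by linarith
    moreover have "(1/2) ^ Suc k \<le> q" using True unfolding k by (rule eq_refl[OF sym])
    ultimately show thesis by (intro that[of k])
  next
    case False
    with m_le have "q < (1/2) ^ m" by simp
    moreover have "(1/2) ^ Suc m \<le> q" using n unfolding m by (rule less_imp_le)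
    ultimately show thesis by (intro that[of m])
  qed
qed

lemma ex_dyadic_scaled:
  fixes q D :: real
  assumes "0 < q" "q < D"
  shows "\<exists>n. D * (1/2) ^ n * (1/2) \<le> q \<and> q < D * (1/2) ^ n"
proof -
  have D: "0 < D" using assms by simp
  then have q: "0 < q / D" "q / D < 1" using assms by (auto simp: divide_simps)
  obtain n where n: "(1/2) ^ Suc n \<le> q / D" "q / D < (1/2) ^ n"
    by (rule ex_dyadic[OF q]) (rule that)
  define h :: real where "h = (1/2) ^ n"
  have "h * (1/2) \<le> q / D" "q / D < h"
    using n by (simp_all only: h_def power_Suc mult.commute)
  then have "D * h * (1/2) \<le> q \<and> q < D * h"
    using D by (simp add: field_simps)
  then show ?thesis unfolding h_def by (rule exI)
qed

lemma power_powr_swap: "(x ^ n) powr e = (x powr e) ^ n" if "x > 0" for x e :: real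
  by (induction n) (use that in \<open>simp_all add: powr_mult\<close>)

lemma le_suminf_ennreal: "f n \<le> (\<Sum>n. f n)" for f :: "nat \<Rightarrow> ennreal"
  using sum_le_suminf[of f "{n}"] by simp

text \<open>Split into dyadic shells about \<open>x\<close>. On the n-th the integrand is at most a
  constant times (D/2^n)^(\<epsilon> - d), and the enclosing ball has volume proportional to
  (D/2^n)^d, so the contributions form a geometric series with ratio 2^(-\<epsilon>). No term
  depends on \<open>x\<close>, which makes the bound uniform.\<close>

lemma nn_integral_norm_powr_bound:
  fixes \<Omega> :: "'a::euclidean_space set"
  assumes "\<Omega> \<in> sets lebesgue" "0 < \<epsilon>" "0 < D"
  shows "\<exists>C<\<infinity>. \<forall>x. (\<forall>y\<in>\<Omega>. norm (x - y) < D) \<longrightarrow>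
      (\<integral>\<^sup>+y. ennreal (norm (x - y) powr (\<epsilon> - real DIM('a))) \<partial>lebesgue_on \<Omega>) \<le> C"
proof -
  let ?d = "real DIM('a)"
  \<comment> \<open>On a shell |x - y| lies between half the outer radius and the outer radius. The
    exponent may have either sign, so the power may be largest at either end; \<open>c\<close>
    covers both.\<close>
  define c where "c = max 1 ((1/2) powr (\<epsilon> - ?d))"
  define t where "t n = c * ((D * (1/2) ^ n) powr (\<epsilon> - ?d)) * (unit_ball_vol ?d * (D * (1/2) ^ n) ^ DIM('a))" for n
  have c: "c \<ge> 1" by (simp add: c_def)
  have t_eq: "t n = (c * unit_ball_vol ?d * D powr \<epsilon>) * ((1/2) powr \<epsilon>) ^ n" for n
  proof -
    define r where "r = D * (1/2) ^ n"
    have r: "0 < r" using assms(3) by (simp add: r_def)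
    have "r powr (\<epsilon> - ?d) * r ^ DIM('a) = r powr (\<epsilon> - ?d + ?d)"
      unfolding powr_add powr_realpow[OF r] ..
    also have "\<dots> = D powr \<epsilon> * ((1/2) powr \<epsilon>) ^ n"
      using power_powr_swap[of "1/2" n \<epsilon>] by (simp only: r_def powr_mult diff_add_cancel)
    finally have "r powr (\<epsilon> - ?d) * r ^ DIM('a) = D powr \<epsilon> * ((1/2) powr \<epsilon>) ^ n" .
    moreover have "t n = (c * unit_ball_vol ?d) * (r powr (\<epsilon> - ?d) * r ^ DIM('a))"
      by (simp add: t_def r_def)
    ultimately show ?thesis by simp
  qed
  have "(1/2) powr \<epsilon> < (1::real)"
    using assms(2) powr_less_mono2[of \<epsilon> "1/2" 1] by simp
  then have sum: "summable t" "\<And>n. 0 \<le> t n"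
    unfolding t_eq using c by (auto intro!: summable_mult summable_geometric mult_nonneg_nonneg)
  show ?thesis
  proof (intro exI[of _ "\<Sum>n. ennreal (t n)"] conjI allI impI)
    show "(\<Sum>n. ennreal (t n)) < \<infinity>"
      by (subst suminf_ennreal2[OF sum(2,1)]) simp
    fix x :: 'a assume x: "\<forall>y\<in>\<Omega>. norm (x - y) < D"
    let ?f = "\<lambda>n y. ennreal (c * (D * (1/2) ^ n) powr (\<epsilon> - ?d)) * indicator (ball x (D * (1/2) ^ n)) y"
    have "(\<integral>\<^sup>+y. ennreal (norm (x - y) powr (\<epsilon> - ?d)) \<partial>lebesgue_on \<Omega>)
        = (\<integral>\<^sup>+y. ennreal (norm (x - y) powr (\<epsilon> - ?d)) * indicator \<Omega> y \<partial>lebesgue)"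
      using assms(1) by (simp add: nn_integral_restrict_space)
    also have "\<dots> \<le> (\<integral>\<^sup>+y. (\<Sum>n. ?f n y) \<partial>lebesgue)"
    proof (rule nn_integral_mono)
      fix y :: 'a
      show "ennreal (norm (x - y) powr (\<epsilon> - ?d)) * indicator \<Omega> y \<le> (\<Sum>n. ?f n y)"
      proof (cases "y \<in> \<Omega> \<and> x \<noteq> y")
        case True
        then obtain n where n': "D * (1/2) ^ n * (1/2) \<le> norm (x - y)" "norm (x - y) < D * (1/2) ^ n"
          using ex_dyadic_scaled[of "norm (x - y)" D] x by auto
        have Dn: "0 < D * (1/2) ^ n" using assms(3) by simp
        have "norm (x - y) powr (\<epsilon> - ?d) \<le> c * (D * (1/2) ^ n) powr (\<epsilon> - ?d)"
        proof (cases "\<epsilon> - ?d \<ge> 0")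
          case True
          have "norm (x - y) powr (\<epsilon> - ?d) \<le> 1 * (D * (1/2) ^ n) powr (\<epsilon> - ?d)"
            using n' True by (simp add: powr_mono2)
          also have "\<dots> \<le> c * (D * (1/2) ^ n) powr (\<epsilon> - ?d)"
            using c by (intro mult_right_mono) auto
          finally show ?thesis .
        next
          case False
          have "norm (x - y) powr (\<epsilon> - ?d) \<le> (D * (1/2) ^ n * (1/2)) powr (\<epsilon> - ?d)"
            using n' False Dn by (intro powr_mono2') auto
          also have "\<dots> = (1/2) powr (\<epsilon> - ?d) * (D * (1/2) ^ n) powr (\<epsilon> - ?d)"
            unfolding powr_mult[of "D * (1/2) ^ n" "1/2"] by (rule mult.commute)
          also have "\<dots> \<le> c * (D * (1/2) ^ n) powr (\<epsilon> - ?d)"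
            by (intro mult_right_mono) (auto simp: c_def)
          finally show ?thesis .
        qed
        then have "ennreal (norm (x - y) powr (\<epsilon> - ?d)) * indicator \<Omega> y \<le> ?f n y"
          using True n'(2) by (simp add: dist_norm ennreal_leI)
        also have "\<dots> \<le> (\<Sum>n. ?f n y)"
          by (rule le_suminf_ennreal)
        finally show ?thesis .
      next
        case False
        \<comment> \<open>For y = x this uses the convention that 0 to any real power is 0.\<close>
        then have "ennreal (norm (x - y) powr (\<epsilon> - ?d)) * indicator \<Omega> y = 0" by auto
        then show ?thesis by (simp only: zero_le)
      qed
    qed
    also have "\<dots> = (\<Sum>n. \<integral>\<^sup>+y. ?f n y \<partial>lebesgue)"
      by (intro nn_integral_suminf borel_measurable_times_ennreal borel_measurable_const
          borel_measurable_indicator) simp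
    also have "\<dots> = (\<Sum>n. ennreal (t n))"
    proof (rule suminf_cong)
      fix n
      define r where "r = D * (1/2) ^ n"
      have r: "0 \<le> r" using assms(3) by (simp add: r_def)
      have "(\<integral>\<^sup>+y. ?f n y \<partial>lebesgue) = ennreal (c * r powr (\<epsilon> - ?d)) * emeasure lebesgue (ball x r)"
        unfolding r_def[symmetric] by (rule nn_integral_cmult_indicator) simp
      also have "emeasure lebesgue (ball x r) = ennreal (unit_ball_vol ?d * r ^ DIM('a))"
        using emeasure_ball[OF r, of x] by simp
      also have "ennreal (c * r powr (\<epsilon> - ?d)) * ennreal (unit_ball_vol ?d * r ^ DIM('a)) = ennreal (t n)"
        unfolding t_def r_def[symmetric] by (rule ennreal_mult[symmetric]) (use c r in auto)
      finally show "(\<integral>\<^sup>+y. ?f n y \<partial>lebesgue) = ennreal (t n)" .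
    qed
    finally show "(\<integral>\<^sup>+y. ennreal (norm (x - y) powr (\<epsilon> - ?d)) \<partial>lebesgue_on \<Omega>) \<le> (\<Sum>n. ennreal (t n))" .
  qed
qed

text \<open>The mean value inequality on a closed ball, which is convex. Continuity is known for the
  partial derivatives, so the operator norm is controlled by the sum of their absolute values, which
  is bounded on the compact ball.\<close>

lemma Ck_lipschitz_bounded:
  fixes u :: "'a::euclidean_space \<Rightarrow> real"
  assumes "Ck (Suc 0) u"
  obtains L where "0 \<le> L" "\<And>x y. x \<in> cball 0 R \<Longrightarrow> y \<in> cball 0 R \<Longrightarrow> \<bar>u x - u y\<bar> \<le> L * norm (x - y)"
proof -
  let ?D = "\<lambda>x. \<Sum>b\<in>Basis. \<bar>frechet_derivative u (at x) b\<bar>"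
  have "continuous_on (cball 0 R) ?D"
    by (intro continuous_intros Ck_continuous_on[OF Ck_frechet[OF assms]])
  then have "bounded (?D ` cball 0 R)"
    by (intro compact_imp_bounded compact_continuous_image) auto
  then obtain L where L: "0 < L" "\<And>x. x \<in> cball 0 R \<Longrightarrow> ?D x \<le> L"
    unfolding bounded_pos by (auto simp: abs_le_iff)
  have onorm: "onorm (frechet_derivative u (at x)) \<le> L" if x: "x \<in> cball 0 R" for x
  proof (rule onorm_le)
    fix h
    let ?f = "frechet_derivative u (at x)"
    have lin: "linear ?f" by (rule has_derivative_linear[OF Ck_has_derivative[OF assms]])
    have "?f h = ?f (\<Sum>b\<in>Basis. (h \<bullet> b) *\<^sub>R b)" by (simp only: euclidean_representation)
    also have "\<dots> = (\<Sum>b\<in>Basis. (h \<bullet> b) * ?f b)"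
      by (simp add: linear_sum[OF lin] linear_cmul[OF lin])
    also have "\<bar>\<dots>\<bar> \<le> (\<Sum>b\<in>Basis. \<bar>(h \<bullet> b) * ?f b\<bar>)" by (rule sum_abs)
    also have "\<dots> \<le> (\<Sum>b\<in>Basis. norm h * \<bar>?f b\<bar>)"
      by (intro sum_mono) (auto simp: abs_mult intro!: mult_right_mono Basis_le_norm)
    also have "\<dots> = norm h * ?D x" by (simp add: sum_distrib_left)
    also have "\<dots> \<le> norm h * L" using L(2)[OF x] by (intro mult_left_mono) auto
    finally show "norm (?f h) \<le> L * norm h" by (simp add: mult.commute)
  qed
  show thesis
  proof (rule that[of L])
    fix x y :: 'a assume xy: "x \<in> cball 0 R" "y \<in> cball 0 R"
    have "norm (u x - u y) \<le> L * norm (x - y)"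
      by (rule differentiable_bound[OF convex_cball _ onorm xy])
         (rule has_derivative_at_withinI[OF Ck_has_derivative[OF assms]])
    then show "\<bar>u x - u y\<bar> \<le> L * norm (x - y)" by simp
  qed (use L in simp)
qed

context bounded_open
begin

lemma continuous_on_Lp_space:
  assumes "continuous_on UNIV f" "p \<ge> 0"
  shows "f \<in> Lp_space \<Omega> p"
proof -
  interpret finite_measure "lebesgue_on \<Omega>" by (rule finite_measure_dom)
  have [measurable]: "f \<in> borel_measurable (lebesgue_on \<Omega>)"
    by (rule continuous_on_measurable_dom[OF assms(1)])
  have "bounded (f ` closure \<Omega>)"
    using bounded_dom
    by (intro compact_imp_bounded compact_continuous_image continuous_on_subset[OF assms(1)]) (auto simp: compact_closure)
  then obtain M where "\<forall>x\<in>closure \<Omega>. \<bar>f x\<bar> \<le> M"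
    unfolding bounded_pos by auto
  then have M: "x \<in> \<Omega> \<Longrightarrow> \<bar>f x\<bar> \<le> M" for x
    using closure_subset by blast
  have "integrable (lebesgue_on \<Omega>) (\<lambda>x. \<bar>f x\<bar> powr p)"
  proof (rule integrable_const_bound[of _ "M powr p"])
    show "AE x in lebesgue_on \<Omega>. norm (\<bar>f x\<bar> powr p) \<le> M powr p"
      using M assms(2) by (intro AE_I2) (auto simp: space_restrict_space intro!: powr_mono2)
  qed measurable
  then show ?thesis by (auto simp: Lp_space_def)
qed

end

context sobolev_setting
begin

text \<open>A Lipschitz bound leaves at most L^p |x - y|^(\<epsilon> - d) with \<epsilon> = p (1 -
  s), which is positive because s < 1. This is integrable in y uniformly in x, and \<Omega> has
  finite measure.\<close>

lemma Ck_slobodeckij_integrable: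
  assumes "Ck (Suc 0) u" "s < 1"
  shows "integrable M2 (slobodeckij_integrand s p u)"
proof (rule integrableI_nonneg)
  let ?M = "lebesgue_on \<Omega>"
  let ?d = "real DIM('a)"
  interpret finite_measure ?M by (rule finite_measure_dom)
  obtain R where R: "0 < R" "\<And>x. x \<in> \<Omega> \<Longrightarrow> norm x \<le> R"
    using bounded_dom unfolding bounded_pos by blast
  obtain L where L: "0 \<le> L" "\<And>x y. x \<in> cball 0 R \<Longrightarrow> y \<in> cball 0 R \<Longrightarrow> \<bar>u x - u y\<bar> \<le> L * norm (x - y)"
    by (rule Ck_lipschitz_bounded[OF assms(1), of R]) (rule that)
  define \<epsilon> where "\<epsilon> = p - s * p"
  have \<epsilon>: "0 < \<epsilon>" using assms(2) p_gt_1 by (simp add: \<epsilon>_def)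
  \<comment> \<open>Distances within \<Omega> are at most 2 R; the extra 1 makes the bound
    strict.\<close>
  have D: "0 < 2 * R + 1" using R by simp
  obtain C where C: "C < \<infinity>"
    "\<And>x. \<forall>y\<in>\<Omega>. norm (x - y) < 2 * R + 1 \<Longrightarrow>
      (\<integral>\<^sup>+y. ennreal (norm (x - y) powr (\<epsilon> - ?d)) \<partial>?M) \<le> C"
    using nn_integral_norm_powr_bound[OF lebesgue_dom \<epsilon> D] by blast
  show meas: "slobodeckij_integrand s p u \<in> borel_measurable M2"
    by (intro slobodeckij_integrand_measurable continuous_on_measurable_dom Ck_continuous_on[OF assms(1)])
  have bound: "slobodeckij_integrand s p u (x, y) \<le> L powr p * norm (x - y) powr (\<epsilon> - ?d)"
    if "x \<in> \<Omega>" "y \<in> \<Omega>" for x y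
  proof (cases "x = y")
    case True
    then show ?thesis by (simp add: slobodeckij_integrand_def)
  next
    case False
    have "\<bar>u x - u y\<bar> powr p \<le> (L * norm (x - y)) powr p"
      using R(2) that p_gt_1 by (intro powr_mono2 L) auto
    then have "slobodeckij_integrand s p u (x, y) \<le> (L * norm (x - y)) powr p / norm (x - y) powr (?d + s * p)"
      unfolding slobodeckij_integrand_def by (simp add: divide_right_mono)
    also have "\<dots> = L powr p * (norm (x - y) powr p / norm (x - y) powr (?d + s * p))"
      by (simp add: powr_mult)
    also have "norm (x - y) powr p / norm (x - y) powr (?d + s * p) = norm (x - y) powr (\<epsilon> - ?d)"
      by (simp add: powr_diff[symmetric] \<epsilon>_def algebra_simps)
    finally show ?thesis .
  qed
  have inner: "(\<integral>\<^sup>+y. ennreal (slobodeckij_integrand s p u (x, y)) \<partial>?M) \<le> ennreal (L powr p) * C" if "x \<in> \<Omega>" for x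
  proof -
    have m: "(\<lambda>y. ennreal (norm (x - y) powr (\<epsilon> - ?d))) \<in> borel_measurable ?M"
      by (intro borel_measurable_lebesgue_onI) measurable
    have "(\<integral>\<^sup>+y. ennreal (slobodeckij_integrand s p u (x, y)) \<partial>?M)
        \<le> (\<integral>\<^sup>+y. ennreal (L powr p) * ennreal (norm (x - y) powr (\<epsilon> - ?d)) \<partial>?M)"
      using bound[OF that] by (intro nn_integral_mono) (simp add: space_restrict_space ennreal_mult[symmetric] ennreal_leI)
    also have "\<dots> = ennreal (L powr p) * (\<integral>\<^sup>+y. ennreal (norm (x - y) powr (\<epsilon> - ?d)) \<partial>?M)"
      by (rule nn_integral_cmult[OF m])
    also have "\<dots> \<le> ennreal (L powr p) * C"
    proof (intro mult_left_mono C(2) ballI)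
      fix y assume "y \<in> \<Omega>"
      then show "norm (x - y) < 2 * R + 1"
        using norm_triangle_ineq4[of x y] R(2)[OF that] R(2)[of y] by linarith
    qed simp
    finally show ?thesis .
  qed
  have "(\<integral>\<^sup>+z. ennreal (slobodeckij_integrand s p u z) \<partial>M2) =
      (\<integral>\<^sup>+x. \<integral>\<^sup>+y. ennreal (slobodeckij_integrand s p u (x, y)) \<partial>?M \<partial>?M)"
    using meas by (intro nn_integral_fst[symmetric]) simp
  also have "\<dots> \<le> (\<integral>\<^sup>+x. ennreal (L powr p) * C \<partial>?M)"
    using inner by (intro nn_integral_mono) (simp add: space_restrict_space)
  also have "\<dots> = ennreal (L powr p) * C * emeasure ?M (space ?M)" by simp
  also have "\<dots> < \<infinity>"
  proof -
    have "emeasure ?M (space ?M) < \<infinity>" using emeasure_finite[of "space ?M"] unfolding infinity_ennreal_def less_top .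
    then show ?thesis using C(1) by (simp add: ennreal_mult_less_top)
  qed
  finally show "(\<integral>\<^sup>+z. ennreal (slobodeckij_integrand s p u z) \<partial>M2) < \<infinity>" .
qed (simp add: AE_I2 slobodeckij_integrand_nonneg)

lemma Ck_sobolev_space:
  assumes "Ck (Suc 0) u"
  shows "u \<in> W"
proof -
  have Lp: "u \<in> Lp_space \<Omega> p"
    using p_gt_1 by (intro continuous_on_Lp_space Ck_continuous_on[OF assms]) simp
  show ?thesis
  proof (cases "s = 1")
    case True
    have "\<exists>g\<in>Lp_space \<Omega> p. has_weak_partial \<Omega> b u g" if "b \<in> Basis" for b
      using p_gt_1
      by (intro bexI[of _ "\<lambda>x. frechet_derivative u (at x) b"] has_weak_partial_frechet[OF open_dom assms that]
          continuous_on_Lp_space Ck_continuous_on[OF Ck_frechet[OF assms that]]) simp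
    then show ?thesis using Lp True by (simp add: sobolev_space_def)
  next
    case False
    then show ?thesis
      using Lp Ck_slobodeckij_integrable[OF assms] s_le_1 by (simp add: sobolev_space_def)
  qed
qed

end

section \<open>Radial mollifiers\<close>

text \<open>The argument stands for |y|^2 / r^2, so the mollifier built from it lives in the annulus
  r/2 < |y| < r. Staying away from the centre keeps negative powers of |y| harmless.\<close>

definition bump :: "real \<Rightarrow> real" where
  "bump t = flat_exp 0 (t - 1/4) * flat_exp 0 (1 - t)"

lemma bump_nonneg: "0 \<le> bump t"
  by (simp add: bump_def flat_exp_nonneg)

lemma bump_le_1: "bump t \<le> 1"
  by (simp add: bump_def mult_le_one flat_exp_nonneg flat_exp_0_le_1)

lemma bump_eq_0: "t \<le> 1/4 \<or> 1 \<le> t \<Longrightarrow> bump t = 0"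
  by (auto simp: bump_def flat_exp_def)

lemma bump_pos: "1/4 < t \<Longrightarrow> t < 1 \<Longrightarrow> 0 < bump t"
  by (simp add: bump_def flat_exp_0_pos_iff)

lemma Ck_bump: "Ck k bump"
proof -
  have "Ck k (\<lambda>t::real. t)" by (rule Ck_bounded_linear[OF bounded_linear_ident])
  then show ?thesis
    unfolding bump_def
    by (intro Ck_mult Ck_compose[OF Ck_flat_exp] Ck_diff Ck_const)
qed

text \<open>An antiderivative of the bump, normalised at 1/4. Vanishing below 1/4 masks the
  singularity of the radial field at the centre, and constancy beyond 1 lets the fields of different
  radii agree far out.\<close>

lemma smooth_step_exists:
  obtains a where "\<And>t. (a has_real_derivative bump t) (at t)" "\<And>k. Ck k a"
    "\<And>t. t \<le> 1/4 \<Longrightarrow> a t = 0" "\<And>t. 1 \<le> t \<Longrightarrow> a t = a 1" "\<And>t. 0 \<le> a t" "\<And>t. a t \<le> a 1"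
proof -
  have cont: "isCont bump t" for t
    using Ck_continuous_on[OF Ck_bump[of 0], of UNIV] by (simp add: continuous_on_eq_continuous_at)
  obtain A where A: "\<And>t. (A has_vector_derivative bump t) (at t)"
    using einterval_antiderivative[of "-\<infinity>" "\<infinity>" bump] cont by auto
  define a where "a t = A t - A (1/4)" for t
  have deriv: "(a has_real_derivative bump t) (at t)" for t
    unfolding a_def using A[of t]
    by (auto intro!: derivative_eq_intros simp: has_real_derivative_iff_has_vector_derivative)
  have mono: "a x \<le> a y" if "x \<le> y" for x y
    by (rule DERIV_nonneg_imp_nondecreasing[OF that]) (rule exI, rule conjI, rule deriv, rule bump_nonneg)
  have low: "a t = 0" if "t \<le> 1/4" for t
  proof -
    have "a (1/4) \<le> a t"
    proof (rule DERIV_nonpos_imp_nonincreasing[OF that])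
      fix x :: real assume "x \<le> 1/4"
      then have "bump x = 0" by (intro bump_eq_0) simp
      then show "\<exists>y. (a has_real_derivative y) (at x) \<and> y \<le> 0"
        using deriv[of x] by (intro exI[of _ 0]) simp
    qed
    then show ?thesis using mono[OF that] by (simp add: a_def)
  qed
  have high: "a t = a 1" if "1 \<le> t" for t
  proof -
    have "a t \<le> a 1"
    proof (rule DERIV_nonpos_imp_nonincreasing[OF that])
      fix x :: real assume "1 \<le> x"
      then have "bump x = 0" by (intro bump_eq_0) simp
      then show "\<exists>y. (a has_real_derivative y) (at x) \<and> y \<le> 0"
        using deriv[of x] by (intro exI[of _ 0]) simp
    qed
    then show ?thesis using mono[OF that] by simp
  qed
  show thesis
  proof (rule that[of a])
    show "Ck k a" for k
      by (rule Ck_Suc_D[OF Ck_real_SucI[OF deriv Ck_bump]])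
    show "0 \<le> a t" for t
    proof (cases "t \<le> 1/4")
      case False
      then show ?thesis using mono[of "1/4" t] low[of "1/4"] by simp
    qed (simp add: low)
    show "a t \<le> a 1" for t
    proof (cases "t \<le> 1")
      case False
      then show ?thesis using high[of t] by simp
    qed (rule mono)
    show "a t = a 1" if "1 \<le> t" for t by (rule high[OF that])
  qed (rule deriv, rule low)
qed

text \<open>The field y |y|^(-d) is divergence free off the origin, so multiplying it by the cut-off
  a(|y|^2/r^2) produces a divergence that contains only the derivative of \<open>a\<close>, that is,
  the bump. The flux through large spheres does not depend on \<open>r\<close>, which is the reason
  for the equal masses of the mollifiers.\<close>

lemma radial_mollifier_exists:
  fixes x0 :: "'a::euclidean_space"
  obtains h :: "real \<Rightarrow> 'a \<Rightarrow> real" and F :: "real \<Rightarrow> 'a \<Rightarrow> 'a \<Rightarrow> real" and M :: real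
  where "0 < M"
    "\<And>r. 0 < r \<Longrightarrow> continuous_on UNIV (h r)" "\<And>r x. 0 \<le> h r x"
    "\<And>r x. 0 < r \<Longrightarrow> h r x \<le> M * r powr (- real DIM('a))"
    "\<And>r x. 0 < r \<Longrightarrow> x \<notin> cball x0 r \<Longrightarrow> h r x = 0"
    "\<And>r. 0 < r \<Longrightarrow> \<exists>x. 0 < h r x"
    "\<And>r k b. 0 < r \<Longrightarrow> b \<in> Basis \<Longrightarrow> Ck k (F r b)"
    "\<And>r b x. 0 < r \<Longrightarrow> b \<in> Basis \<Longrightarrow> x \<notin> cball x0 r \<Longrightarrow> F r b x = 0"
    "\<And>r b x. 0 < r \<Longrightarrow> b \<in> Basis \<Longrightarrow> \<bar>F r b x\<bar> \<le> M * r powr (1 - real DIM('a))"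
    "\<And>r x. 0 < r \<Longrightarrow> h r x - h (r / 2) x = (\<Sum>b\<in>Basis. frechet_derivative (F r b) (at x) b)"
proof -
  let ?d = "real DIM('a)"
  obtain a where a: "\<And>t. (a has_real_derivative bump t) (at t)" "\<And>k. Ck k a"
    "\<And>t. t \<le> 1/4 \<Longrightarrow> a t = 0" "\<And>t. 1 \<le> t \<Longrightarrow> a t = a 1" "\<And>t. 0 \<le> a t" "\<And>t. a t \<le> a 1"
    by (rule smooth_step_exists) (rule that)
  \<comment> \<open>With \<open>y = x - x0\<close>, \<open>E r\<close> is the field \<open>y \<bar>y\<bar>\<^sup>-\<^sup>d a(\<bar>y\<bar>\<^sup>2/r\<^sup>2)\<close>, whose divergence is \<open>h r\<close>. The fields for \<open>r\<close> and \<open>r/2\<close>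
    coincide for \<open>\<bar>y\<bar> \<ge> r\<close>, so their difference \<open>F r\<close> is compactly supported.\<close>
  define \<tau> where "\<tau> x = (norm (x - x0))\<^sup>2" for x :: 'a
  define C where "C r t = t powr (- ?d / 2) * a (t / r\<^sup>2)" for r t
  define H where "H r t = 2 * t * t powr (- ?d / 2) * bump (t / r\<^sup>2) / r\<^sup>2" for r t
  define h where "h r x = H r (\<tau> x)" for r x
  define E where "E r b x = ((x - x0) \<bullet> b) * C r (\<tau> x)" for r b x
  define F where "F r b x = E r b x - E (r / 2) b x" for r b x
  \<comment> \<open>The first summand bounds \<open>h\<close>: on its annulus t^(-d/2) is at most
    2^d r^(-d) and 2 t / r^2 at most 2. The second bounds \<open>F\<close>, which reaches inwards to
    radius r/4, where |y|^(-d) is 4^d r^(-d).\<close>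
  define M where "M = 2 * 2 powr ?d + 4 powr ?d * (a 1 + 1)"
  have M: "2 * 2 powr ?d \<le> M" "4 powr ?d * a 1 \<le> M" "0 < M"
    using a(5)[of 1] by (auto simp: M_def distrib_left intro!: add_pos_nonneg mult_nonneg_nonneg)
  have \<tau>0: "0 \<le> \<tau> x" for x by (simp add: \<tau>_def)
  have Ck_C: "Ck k (C r)" if "0 < r" for r k
  proof -
    have "Ck k (\<lambda>t. a ((1 / r\<^sup>2) * t))"
      by (rule Ck_compose[OF a(2)]) (rule Ck_bounded_linear[OF bounded_linear_mult_right])
    then have "Ck k (\<lambda>t. a (t / r\<^sup>2))" by simp
    then show ?thesis
      unfolding C_def
      by (rule Ck_powr_mult[of _ _ "r\<^sup>2 / 4"]) (use that in \<open>auto intro!: a(3) simp: field_simps\<close>)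
  qed
  \<comment> \<open>The left-hand side is the divergence of y C(|y|^2) at t = |y|^2. The power
    t^(-d/2) in \<open>C\<close> is chosen so that the terms without the bump cancel.\<close>
  have H_eq: "?d * C r t + 2 * t * deriv (C r) t = H r t" if "0 < r" "0 \<le> t" for r t
  proof (cases "t = 0")
    case False
    with that have t: "0 < t" by simp
    have "((\<lambda>t. a (t / r\<^sup>2)) has_real_derivative bump (t / r\<^sup>2) * (1 / r\<^sup>2)) (at t)"
      by (rule DERIV_chain2[OF a(1) DERIV_cdivide[OF DERIV_ident]])
    from DERIV_mult[OF has_real_derivative_powr[OF t, of "- ?d / 2"] this]
    have "(C r has_real_derivative (- ?d / 2) * t powr (- ?d / 2 - 1) * a (t / r\<^sup>2) +
        t powr (- ?d / 2) * (bump (t / r\<^sup>2) / r\<^sup>2)) (at t)"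
      unfolding C_def by (simp add: mult.commute)
    then have deq: "deriv (C r) t = (- ?d / 2) * t powr (- ?d / 2 - 1) * a (t / r\<^sup>2) +
        t powr (- ?d / 2) * (bump (t / r\<^sup>2) / r\<^sup>2)"
      by (rule DERIV_imp_deriv)
    have "2 * t * deriv (C r) t = - ?d * (t * t powr (- ?d / 2 - 1)) * a (t / r\<^sup>2) +
        2 * t * t powr (- ?d / 2) * (bump (t / r\<^sup>2) / r\<^sup>2)"
      unfolding deq by (simp add: algebra_simps)
    also have "t * t powr (- ?d / 2 - 1) = t powr (- ?d / 2)"
      using t by (simp add: powr_diff)
    finally show ?thesis
      using C_def[of r t] by (simp add: H_def)
  qed (simp add: C_def H_def)
  have Ck_E: "Ck k (E r b)" if "0 < r" "b \<in> Basis" for r b k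
  proof -
    have "Ck k (\<lambda>x. x \<bullet> b - x0 \<bullet> b)"
      by (intro Ck_diff Ck_const Ck_bounded_linear bounded_linear_inner_left)
    moreover have "Ck k (\<lambda>x. C r (\<tau> x))"
      unfolding \<tau>_def by (rule Ck_compose[OF Ck_C[OF that(1)] Ck_sqnorm])
    ultimately show ?thesis
      unfolding E_def inner_diff_left by (rule Ck_mult)
  qed
  have E_deriv: "frechet_derivative (E r b) (at x) b = C r (\<tau> x) + 2 * ((x - x0) \<bullet> b)\<^sup>2 * deriv (C r) (\<tau> x)"
    if "0 < r" "b \<in> Basis" for r b x
  proof -
    have \<tau>': "(\<tau> has_derivative (\<lambda>h. 2 * ((x - x0) \<bullet> h))) (at x)"
      unfolding \<tau>_def power2_norm_eq_inner
      by (auto intro!: derivative_eq_intros simp: inner_commute)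
    have "((\<lambda>x. C r (\<tau> x)) has_derivative (\<lambda>h. deriv (C r) (\<tau> x) * (2 * ((x - x0) \<bullet> h)))) (at x)"
      by (rule has_derivative_compose[OF \<tau>' has_field_derivative_imp_has_derivative[OF
            Ck_real_deriv(1)[OF Ck_C[OF that(1), of "Suc 0"]]]])
    moreover have "((\<lambda>x. (x - x0) \<bullet> b) has_derivative (\<lambda>h. h \<bullet> b)) (at x)"
      by (auto intro!: derivative_eq_intros)
    ultimately have "(E r b has_derivative
        (\<lambda>h. ((x - x0) \<bullet> b) * (deriv (C r) (\<tau> x) * (2 * ((x - x0) \<bullet> h))) + (h \<bullet> b) * C r (\<tau> x))) (at x)"
      unfolding E_def by (intro has_derivative_mult)
    from frechet_derivative_at[OF this, symmetric] show ?thesis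
      using that(2) by (simp add: power2_eq_square)
  qed
  have div_E: "(\<Sum>b\<in>Basis. frechet_derivative (E r b) (at x) b) = h r x" if "0 < r" for r x
  proof -
    have "(\<Sum>b\<in>Basis. frechet_derivative (E r b) (at x) b) =
        ?d * C r (\<tau> x) + 2 * (\<Sum>b\<in>Basis. ((x - x0) \<bullet> b)\<^sup>2) * deriv (C r) (\<tau> x)"
      by (simp add: E_deriv[OF that] sum.distrib sum_distrib_left sum_distrib_right)
    also have "(\<Sum>b\<in>Basis. ((x - x0) \<bullet> b)\<^sup>2) = \<tau> x"
      unfolding \<tau>_def power2_norm_eq_inner unfolding euclidean_inner[of "x - x0" "x - x0"] power2_eq_square ..
    finally show ?thesis unfolding h_def using H_eq[OF that \<tau>0] by simp
  qed
  have outside: "r\<^sup>2 < \<tau> x" if "0 < r" "x \<notin> cball x0 r" for r x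
    using that by (auto simp: \<tau>_def dist_norm norm_minus_commute intro!: power_strict_mono)
  have powr_sq: "(c\<^sup>2) powr (- ?d / 2) = c powr (- ?d)" if "0 < c" for c
  proof -
    have "c\<^sup>2 = c powr 2" using that by (simp add: powr_numeral)
    then show ?thesis by (simp add: powr_powr)
  qed
  show thesis
  proof (rule that[of M h F])
    show "0 < M" by fact
    show "continuous_on UNIV (h r)" if "0 < r" for r
    proof -
      have "continuous_on UNIV (\<lambda>x. \<Sum>b\<in>Basis. frechet_derivative (E r b) (at x) b)"
        using that by (intro continuous_on_sum Ck_continuous_on[OF Ck_frechet[OF Ck_E]])
      then show ?thesis using div_E[OF that] by simp
    qed
    show "0 \<le> h r x" for r x
      unfolding h_def H_def using \<tau>0[of x] bump_nonneg by simp
    show "h r x \<le> M * r powr (- ?d)" if "0 < r" for r x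
    proof (cases "1/4 < \<tau> x / r\<^sup>2 \<and> \<tau> x / r\<^sup>2 < 1")
      case True
      then have t: "(r / 2)\<^sup>2 \<le> \<tau> x" "\<tau> x \<le> r\<^sup>2" using that by (auto simp: field_simps)
      have "\<tau> x powr (- ?d / 2) \<le> ((r / 2)\<^sup>2) powr (- ?d / 2)"
        using t that by (intro powr_mono2') auto
      also have "\<dots> = 2 powr ?d * r powr (- ?d)"
        using that by (simp only: powr_sq[of "r / 2"] half_gt_zero) (simp add: powr_divide powr_minus field_simps)
      finally have "\<tau> x * \<tau> x powr (- ?d / 2) * bump (\<tau> x / r\<^sup>2) \<le> r\<^sup>2 * (2 powr ?d * r powr (- ?d)) * 1"
        using t \<tau>0 bump_nonneg bump_le_1 by (intro mult_mono) auto
      then have "h r x \<le> 2 * (2 powr ?d * r powr (- ?d))"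
        using that by (simp add: h_def H_def field_simps)
      also have "\<dots> \<le> M * r powr (- ?d)"
        unfolding mult.assoc[symmetric] by (intro mult_right_mono M) auto
      finally show ?thesis .
    next
      case False
      then have "h r x = 0" unfolding h_def H_def using bump_eq_0[of "\<tau> x / r\<^sup>2"] by auto
      then show ?thesis using M by simp
    qed
    show "h r x = 0" if "0 < r" "x \<notin> cball x0 r" for r x
      unfolding h_def H_def using bump_eq_0[of "\<tau> x / r\<^sup>2"] outside[OF that] that(1) by simp
    show "\<exists>x. 0 < h r x" if "0 < r" for r
    proof -
      obtain b :: 'a where b: "b \<in> Basis" using nonempty_Basis by blast
      \<comment> \<open>At distance 3r/4 from the centre the argument of the bump is 9/16, inside
        the interval from 1/4 to 1.\<close>
      have \<tau>_eq: "\<tau> (x0 + (3/4 * r) *\<^sub>R b) = (9/16) * r\<^sup>2"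
        using b by (simp add: \<tau>_def power2_eq_square)
      have ratio: "(9/16) * r\<^sup>2 / r\<^sup>2 = (9/16 :: real)" using that by simp
      have "0 < h r (x0 + (3/4 * r) *\<^sub>R b)"
        unfolding h_def H_def \<tau>_eq ratio using that bump_pos[of "9/16"]
        by (intro divide_pos_pos mult_pos_pos) simp_all
      then show ?thesis by blast
    qed
    show "Ck k (F r b)" if "0 < r" "b \<in> Basis" for r k b
      unfolding F_def using that by (intro Ck_diff Ck_E) auto
    have F0: "F r b x = 0" if r: "0 < r" and x: "r\<^sup>2 < \<tau> x" for r b x
    proof -
      have q: "1 \<le> \<tau> x / r\<^sup>2" "1 \<le> \<tau> x / (r / 2)\<^sup>2"
        using r x \<tau>0[of x] by (auto simp: field_simps)
      show ?thesis unfolding F_def E_def C_def a(4)[OF q(1)] a(4)[OF q(2)] by simp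
    qed
    show "F r b x = 0" if "0 < r" "x \<notin> cball x0 r" for r b x
      by (rule F0[OF that(1) outside[OF that]])
    show "\<bar>F r b x\<bar> \<le> M * r powr (1 - ?d)" if r: "0 < r" and b: "b \<in> Basis" for r b x
    proof -
      \<comment> \<open>Far out both steps equal \<open>a 1\<close> and cancel; within radius r/4
        both vanish, the inner threshold belonging to the field for r/2. Only between these radii is
        an estimate required.\<close>
      consider "r\<^sup>2 < \<tau> x" | "\<tau> x \<le> (r / 4)\<^sup>2" | "(r / 4)\<^sup>2 \<le> \<tau> x" "\<tau> x \<le> r\<^sup>2" by linarith
      then show ?thesis
      proof cases
        case 1
        then show ?thesis using F0[OF r] M by simp
      next
        case 2
        then have q: "\<tau> x / r\<^sup>2 \<le> 1/4" "\<tau> x / (r / 2)\<^sup>2 \<le> 1/4"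
          using r \<tau>0[of x] by (auto simp: field_simps)
        have "F r b x = 0" unfolding F_def E_def C_def a(3)[OF q(1)] a(3)[OF q(2)] by simp
        then show ?thesis using M by simp
      next
        case 3
        have F_eq: "F r b x = ((x - x0) \<bullet> b) * (\<tau> x powr (- ?d / 2) * (a (\<tau> x / r\<^sup>2) - a (\<tau> x / (r / 2)\<^sup>2)))"
          unfolding F_def E_def C_def by (simp only: right_diff_distrib)
        have "norm (x - x0) \<le> r"
          by (rule power2_le_imp_le[OF 3(2)[unfolded \<tau>_def]]) (use r in simp)
        then have 1: "\<bar>(x - x0) \<bullet> b\<bar> \<le> r" using Basis_le_norm[OF b, of "x - x0"] by linarith
        have "\<tau> x powr (- ?d / 2) \<le> ((r / 4)\<^sup>2) powr (- ?d / 2)"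
          by (rule powr_mono2'[OF _ _ 3(1)]) (use r in simp_all)
        also have "\<dots> = 4 powr ?d * r powr (- ?d)"
        proof -
          have "((r / 4)\<^sup>2) powr (- ?d / 2) = (r / 4) powr (- ?d)" using r by (intro powr_sq) simp
          also have "\<dots> = r powr (- ?d) / 4 powr (- ?d)" by (rule powr_divide)
          also have "\<dots> = 4 powr ?d * r powr (- ?d)"
            unfolding powr_minus[of 4] divide_inverse inverse_inverse_eq by (rule mult.commute)
          finally show ?thesis .
        qed
        finally have 2: "\<tau> x powr (- ?d / 2) \<le> 4 powr ?d * r powr (- ?d)" .
        have 4: "\<bar>a (\<tau> x / r\<^sup>2) - a (\<tau> x / (r / 2)\<^sup>2)\<bar> \<le> a 1"
          using a(5,6)[of "\<tau> x / r\<^sup>2"] a(5,6)[of "\<tau> x / (r / 2)\<^sup>2"] by linarith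
        have "\<bar>F r b x\<bar> \<le> r * ((4 powr ?d * r powr (- ?d)) * a 1)"
          unfolding F_eq abs_mult using 1 2 4 r by (intro mult_mono) simp_all
        also have "\<dots> = (4 powr ?d * a 1) * (r powr 1 * r powr (- ?d))"
          using r by simp
        also have "\<dots> = (4 powr ?d * a 1) * r powr (1 - ?d)"
          unfolding powr_add[symmetric] by simp
        also have "\<dots> \<le> M * r powr (1 - ?d)" by (intro mult_right_mono M) simp
        finally show ?thesis .
      qed
    qed
    show "h r x - h (r / 2) x = (\<Sum>b\<in>Basis. frechet_derivative (F r b) (at x) b)" if r: "0 < r" for r x
    proof -
      have r2: "0 < r / 2" using r by simp
      have "frechet_derivative (F r b) (at x) b =
          frechet_derivative (E r b) (at x) b - frechet_derivative (E (r / 2) b) (at x) b" if "b \<in> Basis" for b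
      proof -
        have "(F r b has_derivative (\<lambda>h. frechet_derivative (E r b) (at x) h - frechet_derivative (E (r / 2) b) (at x) h)) (at x)"
          unfolding F_def
          by (intro has_derivative_diff Ck_has_derivative Ck_E[OF r that] Ck_E[OF r2 that])
        from frechet_derivative_at[OF this, symmetric] show ?thesis by simp
      qed
      then show ?thesis
        by (simp add: sum_subtractf div_E[OF r] div_E[OF r2])
    qed
  qed
qed

section \<open>Convergence of the mollifiers in the dual space\<close>

context bounded_open
begin

lemma measure_cball_dom:
  assumes "cball x r \<subseteq> \<Omega>" "0 \<le> r"
  shows "measure (lebesgue_on \<Omega>) (cball x r) = unit_ball_vol (real DIM('a)) * r ^ DIM('a)"
proof -
  have "measure (lebesgue_on \<Omega>) (cball x r) = measure lebesgue (cball x r)"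
    using assms lebesgue_dom by (intro measure_restrict_space) auto
  then show ?thesis using content_cball[OF assms(2), of x] by simp
qed

lemma integral_indicator_cball_dom:
  assumes "cball x r \<subseteq> \<Omega>" "0 \<le> r"
  shows "(LINT y|lebesgue_on \<Omega>. indicator (cball x r) y) = unit_ball_vol (real DIM('a)) * r ^ DIM('a)"
    and "integrable (lebesgue_on \<Omega>) (\<lambda>y. indicator (cball x r) y :: real)"
proof -
  interpret finite_measure "lebesgue_on \<Omega>" by (rule finite_measure_dom)
  have sets: "cball x r \<in> sets (lebesgue_on \<Omega>)"
    using assms(1) lebesgue_dom by (auto simp: sets_restrict_space_iff)
  show "(LINT y|lebesgue_on \<Omega>. indicator (cball x r) y) = unit_ball_vol (real DIM('a)) * r ^ DIM('a)"
    using assms(1) by (simp add: measure_cball_dom[OF assms] Int_absorb2 space_restrict_space)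
  show "integrable (lebesgue_on \<Omega>) (\<lambda>y. indicator (cball x r) y :: real)"
  proof (rule integrable_real_indicator[OF sets])
    show "emeasure (lebesgue_on \<Omega>) (cball x r) < \<infinity>"
      using emeasure_finite[of "cball x r"] unfolding infinity_ennreal_def less_top .
  qed
qed

text \<open>On the ball |g F| is at most N (T + T^(1-p) |g|^p). The parameter \<open>T\<close> stays
  free; the later choice r^(-d/p) makes T r^d and T^(1-p) of the same order.\<close>

lemma Lp_integral_cball_le:
  assumes g: "g \<in> Lp_space \<Omega> p" "(LINT x|lebesgue_on \<Omega>. \<bar>g x\<bar> powr p) \<le> 1" and p: "1 \<le> p" and T: "0 < T"
    and ball: "cball x0 r \<subseteq> \<Omega>" "0 \<le> r"
    and F: "F \<in> borel_measurable (lebesgue_on \<Omega>)" "\<And>x. \<bar>F x\<bar> \<le> N * indicator (cball x0 r) x"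
  shows "\<bar>LINT x|lebesgue_on \<Omega>. g x * F x\<bar>
    \<le> N * (T * (unit_ball_vol (real DIM('a)) * r ^ DIM('a)) + T powr (1 - p))"
proof -
  let ?M = "lebesgue_on \<Omega>"
  have N: "0 \<le> N" using F(2)[of x0] ball(2) by simp
  have int_g: "integrable ?M (\<lambda>x. \<bar>g x\<bar> powr p)" using g(1) by (simp add: Lp_space_def)
  have bound: "\<bar>g x * F x\<bar> \<le> N * (T * indicator (cball x0 r) x + T powr (1 - p) * \<bar>g x\<bar> powr p)" for x
  proof -
    have "\<bar>g x * F x\<bar> \<le> \<bar>g x\<bar> * (N * indicator (cball x0 r) x)"
      unfolding abs_mult by (rule mult_left_mono[OF F(2)]) simp
    also have "\<dots> = N * (\<bar>g x\<bar> * indicator (cball x0 r) x)" by simp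
    also have "\<dots> \<le> N * (T * indicator (cball x0 r) x + T powr (1 - p) * \<bar>g x\<bar> powr p)"
      using N le_add_powr[OF abs_ge_zero T p, of "g x"] by (intro mult_left_mono) (auto simp: indicator_def)
    finally show ?thesis .
  qed
  have int_b: "integrable ?M (\<lambda>x. N * (T * indicator (cball x0 r) x + T powr (1 - p) * \<bar>g x\<bar> powr p))"
    using integral_indicator_cball_dom(2)[OF ball] int_g by (intro integrable_mult_right Bochner_Integration.integrable_add)
  have "AE x in ?M. \<bar>F x\<bar> \<le> N"
  proof (rule AE_I2)
    show "\<bar>F x\<bar> \<le> N" for x
      using F(2)[of x] N by (cases "x \<in> cball x0 r") simp_all
  qed
  then have "integrable ?M (\<lambda>x. g x * F x)"
    by (rule Lp_space_integrable_mult[OF g(1) p F(1)])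
  then have "\<bar>LINT x|?M. g x * F x\<bar> \<le> (LINT x|?M. N * (T * indicator (cball x0 r) x + T powr (1 - p) * \<bar>g x\<bar> powr p))"
    using Bochner_Integration.integral_norm_bound_integral[OF _ int_b, of "\<lambda>x. g x * F x"] bound by simp
  also have "\<dots> = N * (T * (LINT x|?M. indicator (cball x0 r) x) + T powr (1 - p) * (LINT x|?M. \<bar>g x\<bar> powr p))"
    using integral_indicator_cball_dom(2)[OF ball] int_g by (subst Bochner_Integration.integral_add[symmetric] integral_mult_right_zero | simp)+
  also have "\<dots> \<le> N * (T * (unit_ball_vol (real DIM('a)) * r ^ DIM('a)) + T powr (1 - p) * 1)"
    unfolding integral_indicator_cball_dom(1)[OF ball] using N g(2) by (intro mult_left_mono add_left_mono) simp_all
  finally show ?thesis by simp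
qed

end

context sobolev_setting
begin

text \<open>The components \<open>F b\<close> are test functions because the ball lies in \<Omega>,
  so the definition of the weak derivative moves the derivative onto \<open>f\<close> without
  boundary terms. Summing over the coordinate directions gives the factor d.\<close>

lemma mollifier_difference_local:
  assumes f: "f \<in> W" "snorm f \<le> 1" and s: "s = 1" and T: "0 < T"
    and ball: "cball x0 r \<subseteq> \<Omega>" "0 \<le> r"
    and F: "\<And>b k. b \<in> Basis \<Longrightarrow> Ck k (F b)" "\<And>b x. b \<in> Basis \<Longrightarrow> x \<notin> cball x0 r \<Longrightarrow> F b x = 0"
      "\<And>b x. b \<in> Basis \<Longrightarrow> \<bar>F b x\<bar> \<le> N"
  shows "\<bar>LINT x|lebesgue_on \<Omega>. f x * (\<Sum>b\<in>Basis. frechet_derivative (F b) (at x) b)\<bar>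
    \<le> DIM('a) * (N * (T * (unit_ball_vol (real DIM('a)) * r ^ DIM('a)) + T powr (1 - p)))"
proof -
  let ?M = "lebesgue_on \<Omega>"
  let ?B = "N * (T * (unit_ball_vol (real DIM('a)) * r ^ DIM('a)) + T powr (1 - p))"
  have p: "1 \<le> p" using p_gt_1 by simp
  have test: "F b \<in> test_functions \<Omega>" if "b \<in> Basis" for b
    using F(1,2)[OF that] ball(1) by (intro test_functionsI[of _ "cball x0 r"]) auto
  have int: "integrable ?M (\<lambda>x. f x * frechet_derivative (F b) (at x) b)" if "b \<in> Basis" for b
    by (rule Lp_space_integrable_test(2)[OF sobolev_space_Lp[OF f(1)] p test[OF that] that])
  have each: "\<bar>LINT x|?M. f x * frechet_derivative (F b) (at x) b\<bar> \<le> ?B" if b: "b \<in> Basis" for b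
  proof -
    note wp = weak_partial_sobolev[OF f(1) s b]
    have "(LINT x|?M. f x * frechet_derivative (F b) (at x) b) = - (LINT x|?M. weak_partial \<Omega> p b f x * F b x)"
      using wp(2) test[OF b] unfolding has_weak_partial_def by blast
    moreover have "\<bar>LINT x|?M. weak_partial \<Omega> p b f x * F b x\<bar> \<le> ?B"
    proof (rule Lp_integral_cball_le[OF wp(1) sobolev_unit_ball(2)[OF f(2) s b] p T ball])
      show "F b \<in> borel_measurable ?M"
        by (intro continuous_on_measurable_dom Ck_continuous_on[OF F(1)[OF b]])
      show "\<bar>F b x\<bar> \<le> N * indicator (cball x0 r) x" for x
        using F(2)[OF b, of x] F(3)[OF b, of x] by (cases "x \<in> cball x0 r") simp_all
    qed
    ultimately show ?thesis by simp
  qed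
  have "(LINT x|?M. f x * (\<Sum>b\<in>Basis. frechet_derivative (F b) (at x) b)) =
      (\<Sum>b\<in>Basis. LINT x|?M. f x * frechet_derivative (F b) (at x) b)"
    unfolding sum_distrib_left using int by (rule Bochner_Integration.integral_sum)
  also have "\<bar>\<dots>\<bar> \<le> (\<Sum>b\<in>Basis. \<bar>LINT x|?M. f x * frechet_derivative (F b) (at x) b\<bar>)"
    by (rule sum_abs)
  also have "\<dots> \<le> (\<Sum>b\<in>(Basis::'a set). ?B)"
    by (rule sum_mono) (rule each)
  also have "\<dots> = DIM('a) * ?B" by simp
  finally show ?thesis .
qed

text \<open>Since both weights have mass \<open>m\<close>, the left-hand side is the absolute value
  of the double integral of h(x) h'(y) (f(x) - f(y)). \<open>le_add_powr\<close> brings in |f(x) -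
  f(y)|^p, which the Slobodeckij integrand controls on pairs from the ball.\<close>

lemma mollifier_difference_nonlocal:
  assumes f: "f \<in> W" "snorm f \<le> 1" and s: "s < 1" and T: "0 < T"
    and ball: "cball x0 r \<subseteq> \<Omega>" "0 < r"
    and h: "h \<in> borel_measurable (lebesgue_on \<Omega>)" "\<And>x. 0 \<le> h x" "\<And>x. h x \<le> H" "\<And>x. x \<notin> cball x0 r \<Longrightarrow> h x = 0"
    and h': "h' \<in> borel_measurable (lebesgue_on \<Omega>)" "\<And>x. 0 \<le> h' x" "\<And>x. h' x \<le> H'" "\<And>x. x \<notin> cball x0 r \<Longrightarrow> h' x = 0"
    and m: "(LINT x|lebesgue_on \<Omega>. h x) = m" "(LINT x|lebesgue_on \<Omega>. h' x) = m"
  shows "m * \<bar>(LINT x|lebesgue_on \<Omega>. f x * h x) - (LINT x|lebesgue_on \<Omega>. f x * h' x)\<bar>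
    \<le> H * H' * (T * (unit_ball_vol (real DIM('a)) * r ^ DIM('a))\<^sup>2 +
        T powr (1 - p) * (2 * r) powr (real DIM('a) + s * p))"
proof -
  let ?M = "lebesgue_on \<Omega>" and ?d = "real DIM('a)"
  let ?v = "unit_ball_vol ?d * r ^ DIM('a)"
  interpret finite_measure ?M by (rule finite_measure_dom)
  interpret P: pair_sigma_finite ?M ?M ..
  have p: "1 \<le> p" using p_gt_1 by simp
  have fLp: "f \<in> Lp_space \<Omega> p" by (rule sobolev_space_Lp[OF f(1)])
  have H: "0 \<le> H" "0 \<le> H'" using h(2,3)[of x0] h'(2,3)[of x0] by linarith+
  define ind :: "'a \<Rightarrow> real" where "ind = indicator (cball x0 r)"
  define c where "c = T powr (1 - p) * (2 * r) powr (?d + s * p)"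
  \<comment> \<open>An integrable majorant of the double integrand. The factor (2 r)^(d + s p) in
    \<open>c\<close> undoes the denominator of the Slobodeckij integrand, as two points of the ball
    are at most 2 r apart.\<close>
  define G where "G z = H * H' * (T * (ind (fst z) * ind (snd z)) + c * slobodeckij_integrand s p f z)" for z :: "'a \<times> 'a"
  have ind_int: "integrable ?M ind" "(LINT x|?M. ind x) = ?v"
    using integral_indicator_cball_dom[OF ball(1)] ball(2) unfolding ind_def by auto
  have h_int: "integrable ?M (\<lambda>x. f x * h x)" "integrable ?M (\<lambda>x. f x * h' x)"
    by (rule Lp_space_integrable_mult[OF fLp p h(1), of H], use h(2,3) in simp)
       (rule Lp_space_integrable_mult[OF fLp p h'(1), of H'], use h'(2,3) in simp)
  have h1: "integrable ?M h" "integrable ?M h'"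
    by (rule integrable_const_bound[of _ H], use h(1-3) in simp_all)
       (rule integrable_const_bound[of _ H'], use h'(1-3) in simp_all)
  have slob: "integrable M2 (slobodeckij_integrand s p f)"
    using f(1) s by (auto simp: sobolev_space_def)
  have ind2: "integrable M2 (\<lambda>z. ind (fst z) * ind (snd z))" and ind2_eq: "(LINT z|M2. ind (fst z) * ind (snd z)) = ?v\<^sup>2"
  proof -
    have [measurable]: "ind \<in> borel_measurable ?M" using ind_int by auto
    show int: "integrable M2 (\<lambda>z. ind (fst z) * ind (snd z))"
    proof (rule P.Fubini_integrable)
      show "(\<lambda>z. ind (fst z) * ind (snd z)) \<in> borel_measurable M2" by measurable
      show "integrable ?M (\<lambda>x. LINT y|?M. norm (ind (fst (x, y)) * ind (snd (x, y))))"
        using ind_int(1) by (simp add: abs_mult)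
      show "AE x in ?M. integrable ?M (\<lambda>y. ind (fst (x, y)) * ind (snd (x, y)))"
        using ind_int(1) by simp
    qed
    show "(LINT z|M2. ind (fst z) * ind (snd z)) = ?v\<^sup>2"
      using P.integral_fst'[OF int] ind_int(2) by (simp add: power2_eq_square)
  qed
  have G_int: "integrable M2 G"
    unfolding G_def using ind2 slob by (intro integrable_mult_right Bochner_Integration.integrable_add)
  have G_eq: "(LINT z|M2. G z) = H * H' * (T * ?v\<^sup>2 + c * (LINT z|M2. slobodeckij_integrand s p f z))"
    unfolding G_def using ind2 slob by (simp add: ind2_eq)
  have pointwise: "\<bar>h x * (h' y * (f x - f y))\<bar> \<le> G (x, y)" for x y
  proof (cases "x \<in> cball x0 r \<and> y \<in> cball x0 r")
    case True
    have "norm (x - y) \<le> 2 * r"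
      using True dist_triangle2[of x y x0] by (simp add: dist_norm norm_minus_commute)
    then have "\<bar>f x - f y\<bar> powr p \<le> (2 * r) powr (?d + s * p) * slobodeckij_integrand s p f (x, y)"
    proof (cases "x = y")
      case False
      then have pos: "0 < norm (x - y) powr (?d + s * p)" by simp
      have "\<bar>f x - f y\<bar> powr p = norm (x - y) powr (?d + s * p) * slobodeckij_integrand s p f (x, y)"
        using pos by (simp add: slobodeckij_integrand_def)
      also have "\<dots> \<le> (2 * r) powr (?d + s * p) * slobodeckij_integrand s p f (x, y)"
        using \<open>norm (x - y) \<le> 2 * r\<close> s_pos p_gt_1
        by (intro mult_right_mono powr_mono2 slobodeckij_integrand_nonneg) auto
      finally show ?thesis .
    qed (simp add: slobodeckij_integrand_def)
    then have "T powr (1 - p) * \<bar>f x - f y\<bar> powr p \<le> c * slobodeckij_integrand s p f (x, y)"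
      unfolding c_def mult.assoc by (intro mult_left_mono) auto
    with le_add_powr[OF abs_ge_zero T p, of "f x - f y"]
    have "\<bar>f x - f y\<bar> \<le> T + c * slobodeckij_integrand s p f (x, y)" by linarith
    then have "h x * (h' y * \<bar>f x - f y\<bar>) \<le> H * (H' * (T + c * slobodeckij_integrand s p f (x, y)))"
      using h(2,3) h'(2,3) H by (intro mult_mono mult_nonneg_nonneg) auto
    then show ?thesis
      using True h(2) h'(2) by (simp add: G_def ind_def abs_mult mult.assoc)
  next
    case False
    then have "h x * (h' y * (f x - f y)) = 0" using h(4) h'(4) by auto
    moreover have "0 \<le> G (x, y)"
      using H T slobodeckij_integrand_nonneg by (auto simp: G_def ind_def c_def intro!: mult_nonneg_nonneg add_nonneg_nonneg)
    ultimately show ?thesis by (simp only: abs_zero)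
  qed
  let ?I = "LINT x|?M. f x * h x" and ?I' = "LINT x|?M. f x * h' x"
  have inner_int: "integrable ?M (\<lambda>y. h x * (h' y * (f x - f y)))" for x
    using h1(2) h_int(2) by (simp add: right_diff_distrib mult.commute)
  \<comment> \<open>Integrating out y turns \<open>h'\<close> into its mass; integrating the result
    in x, where \<open>h\<close> has the same mass, yields m times the difference of the
    averages.\<close>
  have inner: "(LINT y|?M. h x * (h' y * (f x - f y))) = m * (f x * h x) - ?I' * h x" for x
  proof -
    have "(LINT y|?M. h x * (h' y * (f x - f y))) = h x * (LINT y|?M. f x * h' y - f y * h' y)"
      unfolding integral_mult_right_zero[symmetric]
      by (rule Bochner_Integration.integral_cong) (simp_all add: algebra_simps)
    also have "(LINT y|?M. f x * h' y - f y * h' y) = f x * m - ?I'"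
      using h1(2) h_int(2) m(2) by simp
    finally show ?thesis by (simp add: algebra_simps)
  qed
  have "m * (?I - ?I') = (LINT x|?M. m * (f x * h x) - ?I' * h x)"
    using h1(1) h_int(1) m(1) by (simp add: algebra_simps)
  also have "\<bar>\<dots>\<bar> \<le> (LINT x|?M. (LINT y|?M. G (x, y)))"
  proof -
    have int: "integrable ?M (\<lambda>x. m * (f x * h x) - ?I' * h x)"
      using h1(1) h_int(1) by simp
    have ae: "AE x in ?M. \<bar>m * (f x * h x) - ?I' * h x\<bar> \<le> (LINT y|?M. G (x, y))"
      using P.AE_integrable_fst'[OF G_int]
    proof eventually_elim
      case (elim x)
      show ?case
        unfolding inner[symmetric] using Bochner_Integration.integral_norm_bound_integral[OF inner_int elim] pointwise by simp
    qed
    have "\<bar>LINT x|?M. m * (f x * h x) - ?I' * h x\<bar> \<le> (LINT x|?M. \<bar>m * (f x * h x) - ?I' * h x\<bar>)"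
      by (rule integral_abs_bound)
    also have "\<dots> \<le> (LINT x|?M. (LINT y|?M. G (x, y)))"
      by (rule integral_mono_AE[OF integrable_abs[OF int] P.integrable_fst'[OF G_int] ae])
    finally show ?thesis .
  qed
  also have "\<dots> = (LINT z|M2. G z)" by (rule P.integral_fst'[OF G_int])
  also have "\<dots> \<le> H * H' * (T * ?v\<^sup>2 + c * 1)"
    unfolding G_eq using H sobolev_unit_ball(3)[OF f(2)] s
    by (intro mult_left_mono add_left_mono) (auto simp: c_def)
  finally have "\<bar>m * (?I - ?I')\<bar> \<le> H * H' * (T * ?v\<^sup>2 + c)" by simp
  moreover have "0 \<le> m" using m(1) h(2) by (metis Bochner_Integration.integral_nonneg)
  ultimately show ?thesis by (simp add: abs_mult c_def)
qed

end

section \<open>Scaling of the two estimates in the radius\<close>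

text \<open>With T = r^(-n/p) both terms in the bracket are of order r^(n - n/p); the field bound
  r^(1-n) turns this into r^(1 - n/p), the exponent s - d/p for s = 1.\<close>

lemma scaling_local:
  fixes r p V :: real
  assumes "0 < r" "p \<noteq> 0"
  shows "r powr (1 - real n) * (r powr (- real n / p) * (V * r ^ n) + (r powr (- real n / p)) powr (1 - p))
    = (V + 1) * r powr (1 - real n / p)"
proof -
  have "r powr (1 - real n) * (r powr (- real n / p) * (V * r ^ n)) =
      V * (r powr (1 - real n) * r powr (- real n / p) * r powr real n)"
    using assms(1) by (simp add: powr_realpow)
  also have "\<dots> = V * r powr (1 - real n / p)"
    unfolding powr_add[symmetric] by simp
  finally have 1: "r powr (1 - real n) * (r powr (- real n / p) * (V * r ^ n)) = V * r powr (1 - real n / p)" .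
  have "1 - real n + (- real n / p) * (1 - p) = 1 - real n / p"
    using assms(2) by (simp add: field_simps)
  then have 2: "r powr (1 - real n) * (r powr (- real n / p)) powr (1 - p) = r powr (1 - real n / p)"
    unfolding powr_powr powr_add[symmetric] by (simp only:)
  show ?thesis unfolding distrib_left 1 2 by (simp only: distrib_right mult_1)
qed

text \<open>The choice T = r^(s - n/p) balances the terms: after the factor r^(-2n) from the two
  mollifiers the first is of order T and the second of order T^(1-p) r^(s p - n) = T^(1-p)
  T^p.\<close>

lemma scaling_nonlocal:
  fixes r p s V M :: real
  assumes "0 < r" "p \<noteq> 0"
  shows "M * r powr (- real n) * (M * (r / 2) powr (- real n)) *
      (r powr (s - real n / p) * (V * r ^ n)\<^sup>2 + (r powr (s - real n / p)) powr (1 - p) * (2 * r) powr (real n + s * p))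
    = M\<^sup>2 * 2 powr real n * (V\<^sup>2 + 2 powr (real n + s * p)) * r powr (s - real n / p)"
proof -
  let ?n = "real n" and ?\<alpha> = "s - real n / p"
  have half: "(r / 2) powr (- ?n) = 2 powr ?n * r powr (- ?n)"
  proof -
    have "(r / 2) powr (- ?n) = r powr (- ?n) / 2 powr (- ?n)" by (rule powr_divide)
    also have "\<dots> = 2 powr ?n * r powr (- ?n)"
      unfolding powr_minus[of 2] divide_inverse inverse_inverse_eq by (rule mult.commute)
    finally show ?thesis .
  qed
  have "(V * r ^ n)\<^sup>2 = V\<^sup>2 * (r powr ?n * r powr ?n)"
    using assms(1) by (simp add: powr_realpow power2_eq_square)
  then have "r powr (- ?n) * r powr (- ?n) * (r powr ?\<alpha> * (V * r ^ n)\<^sup>2) =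
      V\<^sup>2 * (r powr (- ?n) * r powr (- ?n) * r powr ?\<alpha> * r powr ?n * r powr ?n)"
    by (simp only: ac_simps)
  also have "\<dots> = V\<^sup>2 * r powr ?\<alpha>" unfolding powr_add[symmetric] by simp
  finally have 1: "r powr (- ?n) * r powr (- ?n) * (r powr ?\<alpha> * (V * r ^ n)\<^sup>2) = V\<^sup>2 * r powr ?\<alpha>" .
  have "- ?n + - ?n + ?\<alpha> * (1 - p) + (?n + s * p) = ?\<alpha>"
    using assms(2) by (simp add: field_simps)
  then have "r powr (- ?n) * r powr (- ?n) * (r powr ?\<alpha>) powr (1 - p) * r powr (?n + s * p) = r powr ?\<alpha>"
    unfolding powr_powr powr_add[symmetric] by (simp only:)
  then have 2: "r powr (- ?n) * r powr (- ?n) * ((r powr ?\<alpha>) powr (1 - p) * (2 * r) powr (?n + s * p)) =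
      2 powr (?n + s * p) * r powr ?\<alpha>"
    unfolding powr_mult by (simp only: mult.assoc mult.left_commute)
  have "M * r powr (- ?n) * (M * (r / 2) powr (- ?n)) * X =
      M\<^sup>2 * 2 powr ?n * (r powr (- ?n) * r powr (- ?n) * X)" for X
    unfolding half by (simp only: power2_eq_square ac_simps)
  then show ?thesis
    by (simp only: distrib_left 1 2) (simp only: distrib_left distrib_right mult.assoc)
qed

context sobolev_setting
begin

lemma mollifier_sequence:
  assumes x0: "x0 \<in> \<Omega>" and sp: "real DIM('a) < s * p"
  obtains h :: "nat \<Rightarrow> 'a \<Rightarrow> real" and R m K q :: real
  where "0 < R" "cball x0 R \<subseteq> \<Omega>" "0 < m" "0 \<le> K" "0 < q" "q < 1"
    "\<And>n. continuous_on UNIV (h n)" "\<And>n x. 0 \<le> h n x" "\<And>n. \<exists>B>0. \<forall>x. h n x \<le> B"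
    "\<And>n x. x \<notin> cball x0 (R * (1/2) ^ n) \<Longrightarrow> h n x = 0"
    "\<And>n. (LINT x|lebesgue_on \<Omega>. h n x) = m"
    "\<And>f n. f \<in> W \<Longrightarrow> snorm f \<le> 1 \<Longrightarrow>
      \<bar>(LINT x|lebesgue_on \<Omega>. f x * h n x) - (LINT x|lebesgue_on \<Omega>. f x * h (Suc n) x)\<bar> \<le> K * q ^ n"
proof -
  let ?d = "real DIM('a)" and ?M = "lebesgue_on \<Omega>"
  define V where "V = unit_ball_vol ?d"
  define \<alpha> where "\<alpha> = s - ?d / p"
  have p: "0 < p" "1 \<le> p" using p_gt_1 by simp_all
  have \<alpha>: "0 < \<alpha>" using sp p by (simp add: \<alpha>_def field_simps)
  have V: "0 \<le> V" by (simp add: V_def)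
  obtain g F M where M: "0 < M" and gF:
    "\<And>r. 0 < r \<Longrightarrow> continuous_on UNIV (g r)" "\<And>r x. 0 \<le> g r x"
    "\<And>r x. 0 < r \<Longrightarrow> g r x \<le> M * r powr (- ?d)"
    "\<And>r x. 0 < r \<Longrightarrow> x \<notin> cball x0 r \<Longrightarrow> g r x = 0"
    "\<And>r. 0 < r \<Longrightarrow> \<exists>x. 0 < g r x"
    "\<And>r k b. 0 < r \<Longrightarrow> b \<in> Basis \<Longrightarrow> Ck k (F r b)"
    "\<And>r b x. 0 < r \<Longrightarrow> b \<in> Basis \<Longrightarrow> x \<notin> cball x0 r \<Longrightarrow> F r b x = 0"
    "\<And>r b x. 0 < r \<Longrightarrow> b \<in> Basis \<Longrightarrow> \<bar>F r b x\<bar> \<le> M * r powr (1 - ?d)"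
    "\<And>r x. 0 < r \<Longrightarrow> g r x - g (r / 2) x = (\<Sum>b\<in>Basis. frechet_derivative (F r b) (at x) b)"
    by (rule radial_mollifier_exists[of x0]) (rule that)
  obtain R where R: "0 < R" "cball x0 R \<subseteq> \<Omega>"
    using open_dom x0 unfolding open_contains_cball by blast
  have ball: "cball x0 r \<subseteq> \<Omega>" if "r \<le> R" for r
    using R(2) that by (meson order_trans subset_cball)
  have meas: "g r \<in> borel_measurable ?M" if "0 < r" for r
    by (rule continuous_on_measurable_dom[OF gF(1)[OF that]])
  have g_int: "integrable ?M (g r)" if "0 < r" for r
  proof -
    interpret finite_measure ?M by (rule finite_measure_dom)
    show ?thesis
      by (rule integrable_const_bound[of _ "M * r powr (- ?d)"])
         (use gF(2,3) meas that in simp_all)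
  qed
  have F_test: "F r b \<in> test_functions \<Omega>" if "0 < r" "r \<le> R" "b \<in> Basis" for r b
    using gF(6,7) that ball[OF that(2)] by (intro test_functionsI[of _ "cball x0 r"]) auto
  \<comment> \<open>The difference of consecutive mollifiers is the divergence of a compactly
    supported field and hence has integral 0.\<close>
  have mass: "(LINT x|?M. g r x) = (LINT x|?M. g (r / 2) x)" if r: "0 < r" "r \<le> R" for r
  proof -
    have zero: "(LINT x|?M. frechet_derivative (F r b) (at x) b) = 0" if b: "b \<in> Basis" for b
    proof -
      have C1: "Ck (Suc 0) (F r b)" by (rule gF(6)[OF r(1) b])
      have "F r b x = 0" if "norm x > norm x0 + r" for x
      proof (rule gF(7)[OF r(1) b])
        show "x \<notin> cball x0 r"
          using that norm_triangle_ineq2[of x x0] by (auto simp: dist_norm norm_minus_commute)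
      qed
      then have "(LINT x|lborel. frechet_derivative (F r b) (at x) b) = 0"
        by (rule integral_partial_eq_0[OF C1 b])
      then show ?thesis
        using lebesgue_on_integral_eq_lborel(1)[OF lebesgue_dom
            borel_measurable_continuous_onI[OF Ck_continuous_on[OF Ck_frechet[OF C1 b]]]
            test_functions_frechet_eq_0[OF F_test[OF r b]]] by simp
    qed
    have int: "integrable ?M (\<lambda>x. frechet_derivative (F r b) (at x) b)" if b: "b \<in> Basis" for b
    proof -
      have "(\<lambda>x. 1) \<in> Lp_space \<Omega> p" using p by (intro continuous_on_Lp_space) simp_all
      from Lp_space_integrable_test(2)[OF this p(2) F_test[OF r b] b] show ?thesis by simp
    qed
    have r2: "0 < r / 2" using r by simp
    have "(LINT x|?M. g r x) - (LINT x|?M. g (r / 2) x) = (LINT x|?M. g r x - g (r / 2) x)"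
      using g_int[OF r(1)] g_int[OF r2] by simp
    also have "\<dots> = (\<Sum>b\<in>Basis. LINT x|?M. frechet_derivative (F r b) (at x) b)"
      unfolding gF(9)[OF r(1)] using int by (rule Bochner_Integration.integral_sum)
    also have "\<dots> = 0" using zero by simp
    finally show ?thesis by simp
  qed
  define r where "r n = R * (1/2) ^ n" for n
  have r: "0 < r n" "r n \<le> R" "r (Suc n) = r n / 2" for n
    using R(1) by (simp_all add: r_def power_le_one)
  define m where "m = (LINT x|?M. g R x)"
  have m_n: "(LINT x|?M. g (r n) x) = m" for n
  proof (induction n)
    case 0
    show ?case by (simp add: r_def m_def)
  next
    case (Suc n)
    then show ?case unfolding r(3) using mass[OF r(1,2), of n] by simp
  qed
  \<comment> \<open>Otherwise the set where \<open>g R\<close> is positive would be null, although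
    it is open by continuity and non-empty. It lies in the ball of radius \<open>R\<close>, hence in
    \<Omega>.\<close>
  have m_pos: "0 < m"
  proof (rule ccontr)
    assume "\<not> 0 < m"
    moreover have "0 \<le> m" unfolding m_def using gF(2) by (intro Bochner_Integration.integral_nonneg)
    ultimately have "(LINT x|?M. g R x) = 0" by (simp add: m_def)
    then have "AE x in ?M. g R x = 0"
      using integral_nonneg_eq_0_iff_AE[OF g_int[OF R(1)] AE_I2[OF gF(2)]] by simp
    then have "AE x in lebesgue. x \<in> \<Omega> \<longrightarrow> g R x = 0"
      using lebesgue_dom by (simp add: AE_restrict_space_iff)
    then have "AE x in lebesgue. x \<notin> {x. 0 < g R x}"
    proof eventually_elim
      case (elim x)
      show ?case
      proof
        assume pos: "x \<in> {x. 0 < g R x}"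
        then have "x \<in> cball x0 R"
          using gF(4)[OF R(1), of x] by (cases "x \<in> cball x0 R") simp_all
        then show False using R(2) elim pos by auto
      qed
    qed
    moreover have U: "open {x. 0 < g R x}"
      by (intro open_Collect_less continuous_on_const gF(1)[OF R(1)])
    ultimately have "{x. 0 < g R x} \<in> null_sets lebesgue"
      by (subst (asm) AE_iff_null_sets[symmetric]) (simp_all add: borel_open)
    then show False
      using open_not_negligible[OF U] gF(5)[OF R(1)] by (auto simp: negligible_iff_null_sets)
  qed
  \<comment> \<open>The prefactors left by \<open>scaling_local\<close> and
    \<open>scaling_nonlocal\<close>; the division removes the factor \<open>m\<close> in front of
    the nonlocal difference.\<close>
  define K0 where "K0 = (if s = 1 then ?d * M * (V + 1) else M\<^sup>2 * 2 powr ?d * (V\<^sup>2 + 2 powr (?d + s * p)) / m)"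
  have K0: "0 \<le> K0" using M V m_pos by (auto simp: K0_def intro!: mult_nonneg_nonneg divide_nonneg_pos add_nonneg_nonneg)
  have step: "\<bar>(LINT x|?M. f x * g \<rho> x) - (LINT x|?M. f x * g (\<rho> / 2) x)\<bar> \<le> K0 * \<rho> powr \<alpha>"
    if f: "f \<in> W" "snorm f \<le> 1" and \<rho>: "0 < \<rho>" "\<rho> \<le> R" and m: "(LINT x|?M. g \<rho> x) = m" for f \<rho>
  proof (cases "s = 1")
    case True
    have \<rho>2: "0 < \<rho> / 2" using \<rho> by simp
    have int: "integrable ?M (\<lambda>x. f x * g t x)" if "0 < t" for t
      using gF(2,3) that
      by (intro Lp_space_integrable_mult[OF sobolev_space_Lp[OF f(1)] p(2) meas[OF that], of "M * t powr (- ?d)"] AE_I2) simp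
    have "(LINT x|?M. f x * g \<rho> x) - (LINT x|?M. f x * g (\<rho> / 2) x)
        = (LINT x|?M. f x * (g \<rho> x - g (\<rho> / 2) x))"
      using int[OF \<rho>(1)] int[OF \<rho>2] by (simp add: right_diff_distrib)
    also have "\<bar>\<dots>\<bar> \<le> ?d * (M * \<rho> powr (1 - ?d) * (\<rho> powr (- ?d / p) * (V * \<rho> ^ DIM('a)) + (\<rho> powr (- ?d / p)) powr (1 - p)))"
      unfolding gF(9)[OF \<rho>(1)] V_def
      by (rule mollifier_difference_local[OF f True _ ball[OF \<rho>(2)]])
         (use \<rho>(1) gF(6-8) in simp_all)
    also have "\<dots> = ?d * (M * ((V + 1) * \<rho> powr (1 - ?d / p)))"
      unfolding mult.assoc[of M] scaling_local[OF \<rho>(1) less_imp_neq[OF p(1), symmetric]] ..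
    also have "\<dots> = K0 * \<rho> powr \<alpha>"
      using True by (simp add: K0_def \<alpha>_def)
    finally show ?thesis .
  next
    case False
    then have s: "s < 1" using s_le_1 by simp
    have \<rho>2: "0 < \<rho> / 2" using \<rho> by simp
    have out: "g (\<rho> / 2) x = 0" if "x \<notin> cball x0 \<rho>" for x
      using that \<rho> by (intro gF(4)[OF \<rho>2]) auto
    have T: "0 < \<rho> powr \<alpha>" using \<rho> by simp
    have "m * \<bar>(LINT x|?M. f x * g \<rho> x) - (LINT x|?M. f x * g (\<rho> / 2) x)\<bar>
      \<le> M * \<rho> powr (- ?d) * (M * (\<rho> / 2) powr (- ?d)) * (\<rho> powr \<alpha> * (unit_ball_vol ?d * \<rho> ^ DIM('a))\<^sup>2 +
        (\<rho> powr \<alpha>) powr (1 - p) * (2 * \<rho>) powr (?d + s * p))"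
      by (rule mollifier_difference_nonlocal[OF f s T ball[OF \<rho>(2)] \<rho>(1)
          meas[OF \<rho>(1)] gF(2) gF(3)[OF \<rho>(1)] gF(4)[OF \<rho>(1)]
          meas[OF \<rho>2] gF(2) gF(3)[OF \<rho>2] out m m[unfolded mass[OF \<rho>]]])
    also have "\<dots> = M\<^sup>2 * 2 powr ?d * (V\<^sup>2 + 2 powr (?d + s * p)) * \<rho> powr \<alpha>"
      unfolding \<alpha>_def V_def[symmetric] by (rule scaling_nonlocal[OF \<rho>(1) less_imp_neq[OF p(1), symmetric]])
    finally show ?thesis
      using m_pos False by (simp add: K0_def field_simps)
  qed
  \<comment> \<open>Halving the radius multiplies the bound by (1/2)^\<alpha>, which is below 1
    because \<alpha> is positive: the place where s p > d enters.\<close>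
  have "(1/2) powr \<alpha> < (1::real)"
    using \<alpha> powr_less_mono2[of \<alpha> "1/2" 1] by simp
  then show thesis
  proof (intro that[of R m "K0 * R powr \<alpha>" "(1/2) powr \<alpha>" "\<lambda>n. g (r n)"])
    show "0 \<le> K0 * R powr \<alpha>" using K0 by simp
    show "\<exists>B>0. \<forall>x. g (r n) x \<le> B" for n
      using gF(3)[OF r(1), of n] M r(1)[of n] by (intro exI[of _ "M * r n powr (- ?d)"]) simp
    show "g (r n) x = 0" if "x \<notin> cball x0 (R * (1/2) ^ n)" for n x
      using gF(4)[OF r(1), of x n] that unfolding r_def by blast
    fix f :: "'a \<Rightarrow> real" and n assume f: "f \<in> W" "snorm f \<le> 1"
    have "\<bar>(LINT x|?M. f x * g (r n) x) - (LINT x|?M. f x * g (r (Suc n)) x)\<bar> \<le> K0 * r n powr \<alpha>"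
      unfolding r(3) by (rule step[OF f r(1,2) m_n])
    also have "\<dots> = K0 * R powr \<alpha> * ((1/2) powr \<alpha>) ^ n"
      unfolding r_def powr_mult using power_powr_swap[of "1/2" n \<alpha>] by (simp only: mult.assoc)
    finally show "\<bar>(LINT x|?M. f x * g (r n) x) - (LINT x|?M. f x * g (r (Suc n)) x)\<bar>
        \<le> K0 * R powr \<alpha> * ((1/2) powr \<alpha>) ^ n" .
  qed (use R m_pos gF(1,2) r(1) m_n in simp_all)
qed

end

section \<open>Point evaluation and non-polyhedricity\<close>

text \<open>The telescoping series is dominated by a geometric one. The explicit tail bound depends
  on \<open>X\<close> only through \<open>K\<close> and \<open>q\<close>, so it is uniform over the
  unit ball and becomes convergence in the dual norm.\<close>

lemma geometric_differences_limit:
  fixes X :: "nat \<Rightarrow> real"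
  assumes X: "\<And>n. \<bar>X n - X (Suc n)\<bar> \<le> K * q ^ n" and q: "0 \<le> q" "q < 1"
  shows "convergent X" "\<bar>lim X - X n\<bar> \<le> K / (1 - q) * q ^ n"
proof -
  have geo: "(\<lambda>k. K * q ^ n * q ^ k) sums (K * q ^ n * (1 / (1 - q)))" for n
    using q by (intro sums_mult geometric_sums) simp
  have bound: "norm (X (Suc k + n) - X (k + n)) \<le> K * q ^ n * q ^ k" for k n
    using X[of "k + n"] by (simp add: abs_minus_commute power_add ac_simps)
  have "summable (\<lambda>n. X (Suc n) - X n)"
  proof (rule summable_comparison_test'[OF sums_summable[OF geo[of 0]], of 0])
    show "norm (X (Suc n) - X n) \<le> K * q ^ 0 * q ^ n" for n
      using bound[of n 0] by (simp only: add_0_right)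
  qed
  then have "convergent (\<lambda>n. \<Sum>k<n. X (Suc k) - X k)"
    by (simp only: summable_iff_convergent)
  then have "convergent (\<lambda>n. X n + - X 0)"
    unfolding sum_lessThan_telescope by (simp only: diff_conv_add_uminus)
  then show conv: "convergent X"
    unfolding convergent_add_const_right_iff .
  have "(\<lambda>k. X (k + n)) \<longlonglongrightarrow> lim X"
    by (rule LIMSEQ_ignore_initial_segment) (use conv in \<open>simp only: convergent_LIMSEQ_iff\<close>)
  then have "(\<lambda>k. X (Suc k + n) - X (k + n)) sums (lim X - X (0 + n))"
    by (rule telescope_sums)
  then have "lim X - X n = (\<Sum>k. X (Suc k + n) - X (k + n))"
    by (simp add: sums_iff)
  also have "\<bar>\<dots>\<bar> \<le> (\<Sum>k. K * q ^ n * q ^ k)"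
    using norm_suminf_le[OF bound sums_summable[OF geo]] by simp
  also have "\<dots> = K / (1 - q) * q ^ n"
    using sums_unique[OF geo[of n]] by simp
  finally show "\<bar>lim X - X n\<bar> \<le> K / (1 - q) * q ^ n" .
qed

context sobolev_setting
begin

abbreviation "Lf \<equiv> Linfty_functional \<Omega> s p"
abbreviation "Wdual \<equiv> sobolev_dual \<Omega> s p"
abbreviation "dnorm \<equiv> sobolev_dual_norm \<Omega> s p"

lemma Linfty_spaceI:
  "v \<in> borel_measurable (lebesgue_on \<Omega>) \<Longrightarrow> (\<And>x. \<bar>v x\<bar> \<le> C) \<Longrightarrow> v \<in> Linfty_space \<Omega>"
  by (auto simp: Linfty_space_def)

lemma Linfty_integrable_mult:
  assumes "v \<in> Linfty_space \<Omega>" "f \<in> W"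
  shows "integrable (lebesgue_on \<Omega>) (\<lambda>x. v x * f x)"
proof -
  obtain C where "AE x in lebesgue_on \<Omega>. \<bar>v x\<bar> \<le> C" and v: "v \<in> borel_measurable (lebesgue_on \<Omega>)"
    using assms(1) by (auto simp: Linfty_space_def)
  then have "integrable (lebesgue_on \<Omega>) (\<lambda>x. f x * v x)"
    using p_gt_1 by (intro Lp_space_integrable_mult[OF sobolev_space_Lp[OF assms(2)]]) auto
  then show ?thesis by (simp add: mult.commute)
qed

lemma Linfty_functional_eq: "f \<in> W \<Longrightarrow> Lf v f = (LINT x|lebesgue_on \<Omega>. v x * f x)"
  by (simp add: Linfty_functional_def)

lemma sobolev_dualI:
  assumes add: "\<And>f g. f \<in> W \<Longrightarrow> g \<in> W \<Longrightarrow> \<phi> (f + g) = \<phi> f + \<phi> g"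
    and scale: "\<And>c f. f \<in> W \<Longrightarrow> \<phi> (c *\<^sub>R f) = c * \<phi> f"
    and bound: "\<And>f. f \<in> W \<Longrightarrow> snorm f \<le> 1 \<Longrightarrow> \<bar>\<phi> f\<bar> \<le> C"
    and zero: "\<And>f. f \<notin> W \<Longrightarrow> \<phi> f = 0"
  shows "\<phi> \<in> Wdual"
proof -
  have "\<bar>\<phi> f\<bar> \<le> C * snorm f" if "f \<in> W" for f
    by (rule bounded_on_unit_ball_imp_bounded[where V = W and N = snorm, OF that])
       (simp_all add: sobolev_space_scaleR sobolev_norm_scaleR sobolev_norm_nonneg scale bound)
  then show ?thesis
    using add scale zero unfolding sobolev_dual_def dual_space_def by blast
qed

lemma sobolev_dual_bound:
  "\<phi> \<in> Wdual \<Longrightarrow> f \<in> W \<Longrightarrow> \<bar>\<phi> f\<bar> \<le> dnorm \<phi> * snorm f"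
  unfolding sobolev_dual_def sobolev_dual_norm_def
  by (rule dual_norm_bound) (simp_all add: sobolev_space_scaleR sobolev_norm_scaleR sobolev_norm_nonneg)

text \<open>On the unit ball the integral of |f| is at most the measure of \<Omega> plus 1, by |f|
  \<le> 1 + |f|^p.\<close>

lemma Linfty_functional_dual:
  assumes v: "v \<in> Linfty_space \<Omega>"
  shows "Lf v \<in> Wdual"
proof -
  let ?M = "lebesgue_on \<Omega>"
  interpret finite_measure ?M by (rule finite_measure_dom)
  have p: "1 \<le> p" using p_gt_1 by simp
  obtain C where C: "AE x in ?M. \<bar>v x\<bar> \<le> C" using v by (auto simp: Linfty_space_def)
  show ?thesis
  proof (rule sobolev_dualI)
    fix f g assume "f \<in> W" "g \<in> W"
    then show "Lf v (f + g) = Lf v f + Lf v g"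
      by (simp add: Linfty_functional_eq sobolev_space_add Linfty_integrable_mult[OF v] distrib_left)
  next
    fix c f assume "f \<in> W"
    then show "Lf v (c *\<^sub>R f) = c * Lf v f"
      unfolding Linfty_functional_eq[OF sobolev_space_scaleR[OF \<open>f \<in> W\<close>]] Linfty_functional_eq[OF \<open>f \<in> W\<close>]
      by (simp add: scaleR_fun_def mult.left_commute)
  next
    fix f assume f: "f \<in> W" "snorm f \<le> 1"
    have int: "integrable ?M (\<lambda>x. \<bar>C\<bar> * (1 + \<bar>f x\<bar> powr p))"
      using sobolev_space_Lp[OF f(1)] by (auto simp: Lp_space_def)
    have "\<bar>Lf v f\<bar> \<le> (LINT x|?M. \<bar>v x * f x\<bar>)"
      unfolding Linfty_functional_eq[OF f(1)] by (rule integral_abs_bound)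
    also have "\<dots> \<le> (LINT x|?M. \<bar>C\<bar> * (1 + \<bar>f x\<bar> powr p))"
    proof (rule integral_mono_AE[OF integrable_abs[OF Linfty_integrable_mult[OF v f(1)]] int])
      show "AE x in ?M. \<bar>v x * f x\<bar> \<le> \<bar>C\<bar> * (1 + \<bar>f x\<bar> powr p)"
        using C
      proof eventually_elim
        case (elim x)
        have "\<bar>f x\<bar> \<le> 1 + \<bar>f x\<bar> powr p" using le_add_powr[OF abs_ge_zero _ p, of 1 "f x"] by simp
        then show ?case unfolding abs_mult using elim by (intro mult_mono) auto
      qed
    qed
    also have "\<dots> = \<bar>C\<bar> * (measure ?M (space ?M) + (LINT x|?M. \<bar>f x\<bar> powr p))"
      using sobolev_space_Lp[OF f(1)] by (simp add: Lp_space_def)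
    also have "\<dots> \<le> \<bar>C\<bar> * (measure ?M (space ?M) + 1)"
      using sobolev_unit_ball(1)[OF f(2)] by (intro mult_left_mono) auto
    finally show "\<bar>Lf v f\<bar> \<le> \<bar>C\<bar> * (measure ?M (space ?M) + 1)" .
  qed (simp add: Linfty_functional_def)
qed

lemma one_sobolev: "(\<lambda>x. 1) \<in> W"
  by (rule Ck_sobolev_space) (rule Ck_const)

text \<open>On continuous elements \<delta> is m times evaluation at \<open>x0\<close>; on the
  remaining ones it is given meaning by the limit. The conclusion records both norm approximation,
  for the tangent cone, and pointwise convergence, for computing the values at \<open>u\<close> and
  at 1.\<close>

lemma delta_functional_exists:
  assumes x0: "x0 \<in> \<Omega>" and sp: "real DIM('a) < s * p"
  obtains h :: "nat \<Rightarrow> 'a \<Rightarrow> real" and \<delta> and R m :: real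
  where "0 < R" "0 < m" "\<delta> \<in> Wdual" "\<And>\<epsilon>. 0 < \<epsilon> \<Longrightarrow> \<exists>n. dnorm (\<delta> - Lf (h n)) < \<epsilon>"
    "\<And>f. f \<in> W \<Longrightarrow> (\<lambda>n. Lf (h n) f) \<longlonglongrightarrow> \<delta> f"
    "\<And>n. h n \<in> Linfty_space \<Omega>" "\<And>n x. 0 \<le> h n x" "\<And>n. \<exists>B>0. \<forall>x. h n x \<le> B"
    "\<And>n x. x \<notin> cball x0 (R * (1/2) ^ n) \<Longrightarrow> h n x = 0"
    "\<And>n. Lf (h n) (\<lambda>x. 1) = m"
proof -
  obtain h :: "nat \<Rightarrow> 'a \<Rightarrow> real" and R m K q :: real where
    R: "0 < R" "cball x0 R \<subseteq> \<Omega>" and m: "0 < m" and K: "0 \<le> K" and q: "0 < q" "q < 1"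
    and cont: "\<And>n. continuous_on UNIV (h n)" and nonneg: "\<And>n x. 0 \<le> h n x"
    and bdd: "\<And>n. \<exists>B>0. \<forall>x. h n x \<le> B"
    and supp: "\<And>n x. x \<notin> cball x0 (R * (1/2) ^ n) \<Longrightarrow> h n x = 0"
    and mass: "\<And>n. (LINT x|lebesgue_on \<Omega>. h n x) = m"
    and step: "\<And>f n. f \<in> W \<Longrightarrow> snorm f \<le> 1 \<Longrightarrow>
      \<bar>(LINT x|lebesgue_on \<Omega>. f x * h n x) - (LINT x|lebesgue_on \<Omega>. f x * h (Suc n) x)\<bar> \<le> K * q ^ n"
    by (rule mollifier_sequence[OF x0 sp]) (rule that)
  have h_Linfty: "h n \<in> Linfty_space \<Omega>" for n
  proof -
    obtain B where "\<forall>x. h n x \<le> B" using bdd[of n] by blast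
    then show ?thesis
      using nonneg[of n] by (intro Linfty_spaceI[of _ B] continuous_on_measurable_dom[OF cont]) simp
  qed
  define X where "X f n = Lf (h n) f" for f n
  have X_dual: "Lf (h n) \<in> Wdual" for n by (rule Linfty_functional_dual[OF h_Linfty])
  have X_lin: "X (f + g) n = X f n + X g n" "X (c *\<^sub>R f) n = c * X f n" if "f \<in> W" "g \<in> W" for f g c n
    using X_dual[of n] that unfolding X_def sobolev_dual_def dual_space_def by blast+
  have X_step: "\<bar>X f n - X f (Suc n)\<bar> \<le> K * q ^ n" if "f \<in> W" "snorm f \<le> 1" for f n
    unfolding X_def Linfty_functional_eq[OF that(1)] using step[OF that, of n] by (simp only: mult.commute)
  \<comment> \<open>\<open>lim\<close> is meaningful only for convergent sequences; convergence is
    known on the unit ball and extended below to the whole space by scaling. Off the space the value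
    is 0, as \<open>dual_space\<close> prescribes.\<close>
  define \<delta> where "\<delta> f = (if f \<in> W then lim (X f) else 0)" for f
  have unit: "convergent (X f)" "\<bar>\<delta> f - X f n\<bar> \<le> K / (1 - q) * q ^ n" if "f \<in> W" "snorm f \<le> 1" for f n
    using geometric_differences_limit[of "X f" K q, OF X_step[OF that] less_imp_le[OF q(1)] q(2)] that
    by (simp_all add: \<delta>_def)
  have lim: "X f \<longlonglongrightarrow> \<delta> f" if f: "f \<in> W" for f
  proof -
    \<comment> \<open>Adding 1 gives a positive divisor even when the seminorm of \<open>f\<close>
      vanishes.\<close>
    define N where "N = snorm f + 1"
    have N: "0 < N" using sobolev_norm_nonneg[of f] by (simp add: N_def)
    let ?g = "(1 / N) *\<^sub>R f"
    have g: "?g \<in> W" "snorm ?g \<le> 1"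
      using f N by (simp_all add: sobolev_space_scaleR sobolev_norm_scaleR) (simp add: N_def)
    have "N *\<^sub>R ?g = f" using N by simp
    then have "X f = (\<lambda>n. N * X ?g n)"
      using X_lin(2)[OF g(1) g(1), of N] by auto
    moreover have "convergent (\<lambda>n. N * X ?g n)"
      using unit(1)[OF g] by (intro convergent_mult convergent_const)
    ultimately have "convergent (X f)" by simp
    then show ?thesis using f by (simp add: \<delta>_def convergent_LIMSEQ_iff)
  qed
  obtain C where C: "\<forall>f\<in>W. \<bar>Lf (h 0) f\<bar> \<le> C * snorm f"
    using X_dual[of 0] unfolding sobolev_dual_def dual_space_def by blast
  have \<delta>: "\<delta> \<in> Wdual"
  proof (rule sobolev_dualI)
    fix f g assume fg: "f \<in> W" "g \<in> W"
    have "(\<lambda>n. X (f + g) n) \<longlonglongrightarrow> \<delta> f + \<delta> g"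
      unfolding X_lin(1)[OF fg] by (intro tendsto_add lim fg)
    with lim[OF sobolev_space_add[OF fg]] show "\<delta> (f + g) = \<delta> f + \<delta> g"
      by (rule LIMSEQ_unique)
  next
    fix c f assume f: "f \<in> W"
    have "(\<lambda>n. X (c *\<^sub>R f) n) \<longlonglongrightarrow> c * \<delta> f"
      unfolding X_lin(2)[OF f f] by (intro tendsto_mult_left lim f)
    with lim[OF sobolev_space_scaleR[OF f]] show "\<delta> (c *\<^sub>R f) = c * \<delta> f"
      by (rule LIMSEQ_unique)
  next
    fix f assume f: "f \<in> W" "snorm f \<le> 1"
    have "\<bar>X f 0\<bar> \<le> C * snorm f" using C f(1) by (simp add: X_def)
    also have "\<dots> \<le> \<bar>C\<bar> * 1" using f(2) sobolev_norm_nonneg by (intro mult_mono) auto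
    finally show "\<bar>\<delta> f\<bar> \<le> \<bar>C\<bar> + K / (1 - q)" using unit(2)[OF f, of 0] by simp
  qed (simp add: \<delta>_def)
  show thesis
  proof (rule that[of R m \<delta> h])
    show "\<exists>n. dnorm (\<delta> - Lf (h n)) < \<epsilon>" if "0 < \<epsilon>" for \<epsilon>
    proof -
      \<comment> \<open>The zero function, written as a multiple of the constant 1, is the required
        element of the unit ball.\<close>
      have zero: "0 *\<^sub>R (\<lambda>x. 1) \<in> W" "snorm (0 *\<^sub>R (\<lambda>x. 1)) \<le> 1"
        using sobolev_space_scaleR[OF one_sobolev, of 0] sobolev_norm_scaleR[OF one_sobolev, of 0] by simp_all
      have le: "dnorm (\<delta> - Lf (h n)) \<le> K / (1 - q) * q ^ n" for n
        unfolding sobolev_dual_norm_def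
      proof (rule dual_norm_le)
        show "\<bar>(\<delta> - Lf (h n)) f\<bar> \<le> K / (1 - q) * q ^ n" if "f \<in> W" "snorm f \<le> 1" for f
          using unit(2)[OF that, of n] by (simp add: X_def)
      qed (fact zero)+
      have "(\<lambda>n. K / (1 - q) * q ^ n) \<longlonglongrightarrow> 0"
        using q by (intro tendsto_mult_right_zero LIMSEQ_realpow_zero) simp_all
      then have "\<forall>\<^sub>F n in sequentially. K / (1 - q) * q ^ n < \<epsilon>"
        using that by (rule order_tendstoD(2))
      then obtain n where "K / (1 - q) * q ^ n < \<epsilon>"
        by (auto simp: eventually_sequentially)
      with le[of n] show ?thesis by (intro exI[of _ n]) (rule le_less_trans)
    qed
    show "(\<lambda>n. Lf (h n) f) \<longlonglongrightarrow> \<delta> f" if "f \<in> W" for f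
      using lim[OF that] unfolding X_def .
    show "Lf (h n) (\<lambda>x. 1) = m" for n
      using mass[of n] by (simp add: Linfty_functional_eq one_sobolev)
  qed (fact R(1) m \<delta> h_Linfty nonneg bdd supp)+
qed

end

theorem corollary3p5:
  fixes \<Omega> :: "'a::euclidean_space set" and s p :: real
  assumes "open \<Omega>" and "connected \<Omega>" and "\<Omega> \<noteq> {}" and "bounded \<Omega>"
    and "lipschitz_boundary \<Omega>"
    and "0 < s" and "s \<le> 1" and "1 < p" and "s * p > real DIM('a)"
  shows "\<not> polyhedric (sobolev_dual \<Omega> s p) (sobolev_dual_norm \<Omega> s p)
           (Linfty_functional \<Omega> s p `
              {v \<in> Linfty_space \<Omega>. AE x in lebesgue_on \<Omega>. -1 \<le> v x \<and> v x \<le> 1})"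
proof -
  interpret sobolev_setting \<Omega> s p by standard fact+
  let ?M = "lebesgue_on \<Omega>"
  let ?B = "{v \<in> Linfty_space \<Omega>. AE x in ?M. -1 \<le> v x \<and> v x \<le> 1}"
  let ?K = "Lf ` ?B"
  obtain x0 where x0: "x0 \<in> \<Omega>" using assms(3) by blast
  define u :: "'a \<Rightarrow> real" where "u x = - (norm (x - x0))\<^sup>2" for x
  have u: "u \<in> W"
  proof (rule Ck_sobolev_space)
    have "u = (\<lambda>x. 0 - (norm (x - x0))\<^sup>2)" by (simp add: u_def fun_eq_iff)
    then show "Ck (Suc 0) u" by (simp only: Ck_diff Ck_const Ck_sqnorm)
  qed
  obtain h :: "nat \<Rightarrow> 'a \<Rightarrow> real" and \<delta> and R m :: real where
    R: "0 < R" and m: "0 < m" and \<delta>: "\<delta> \<in> Wdual"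
    and approx: "\<And>\<epsilon>. 0 < \<epsilon> \<Longrightarrow> \<exists>n. dnorm (\<delta> - Lf (h n)) < \<epsilon>"
    and lim: "\<And>f. f \<in> W \<Longrightarrow> (\<lambda>n. Lf (h n) f) \<longlonglongrightarrow> \<delta> f"
    and h: "\<And>n. h n \<in> Linfty_space \<Omega>" "\<And>n x. 0 \<le> h n x" "\<And>n. \<exists>B>0. \<forall>x. h n x \<le> B"
    and supp: "\<And>n x. x \<notin> cball x0 (R * (1/2) ^ n) \<Longrightarrow> h n x = 0"
    and mass: "\<And>n. Lf (h n) (\<lambda>x. 1) = m"
    by (rule delta_functional_exists[OF x0 assms(9)]) (rule that)
  have \<delta>_1: "\<delta> (\<lambda>x. 1) = m"
    using lim[OF one_sobolev] unfolding mass by (simp add: LIMSEQ_const_iff)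
  have \<delta>_u: "\<delta> u = 0"
  proof (rule LIMSEQ_unique[OF lim[OF u]])
    show "(\<lambda>n. Lf (h n) u) \<longlonglongrightarrow> 0"
    proof (rule Lim_null_comparison)
      \<comment> \<open>On the support of \<open>h n\<close> the distance to \<open>x0\<close> is at
        most R / 2^n, so |u| is at most the square of this radius.\<close>
      show "\<forall>\<^sub>F n in sequentially. norm (Lf (h n) u) \<le> m * (R * (1/2) ^ n)\<^sup>2"
      proof (rule always_eventually, rule allI)
        fix n
        let ?r = "R * (1/2) ^ n"
        have le: "norm (h n x * u x) \<le> h n x * 1 * ?r\<^sup>2" for x
        proof (cases "x \<in> cball x0 ?r")
          case True
          then have "\<bar>u x\<bar> \<le> ?r\<^sup>2"
            unfolding u_def by (simp add: dist_norm norm_minus_commute power_mono)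
          then show ?thesis using h(2)[of n x] by (simp add: abs_mult mult_left_mono)
        next
          case False
          then have "h n x = 0" by (rule supp)
          then show ?thesis by simp
        qed
        have "norm (Lf (h n) u) \<le> (LINT x|?M. h n x * 1 * ?r\<^sup>2)"
          unfolding Linfty_functional_eq[OF u]
          by (rule Bochner_Integration.integral_norm_bound_integral[OF Linfty_integrable_mult[OF h(1) u]
                integrable_mult_left[OF Linfty_integrable_mult[OF h(1) one_sobolev]] le])
        also have "\<dots> = m * ?r\<^sup>2"
          using mass[of n] unfolding Linfty_functional_eq[OF one_sobolev] by (simp only: integral_mult_left_zero)
        finally show "norm (Lf (h n) u) \<le> m * ?r\<^sup>2" .
      qed
      have "(\<lambda>n. m * (R * (1/2) ^ n)\<^sup>2) \<longlonglongrightarrow> m * (R * 0)\<^sup>2"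
        by (intro tendsto_intros LIMSEQ_realpow_zero) simp_all
      then show "(\<lambda>n. m * (R * (1/2) ^ n)\<^sup>2) \<longlonglongrightarrow> 0" by simp
    qed
  qed
  define w where "w = Lf (\<lambda>x. -1)"
  have const: "(\<lambda>x. c) \<in> Linfty_space \<Omega>" for c :: real by (rule Linfty_spaceI[of _ "\<bar>c\<bar>"]) simp_all
  have w_K: "w \<in> ?K" unfolding w_def using const by (intro imageI) simp
  have w_dual: "w \<in> Wdual" unfolding w_def by (rule Linfty_functional_dual[OF const])
  \<comment> \<open>Elements of the radial cone are represented by the density t (v + 1), which is
    non-negative almost everywhere; signs and zeros are read off from it.\<close>
  have radial: "\<exists>t>0. \<exists>v\<in>?B. \<phi> \<in> Wdual \<and> (\<forall>f\<in>W. \<phi> f = t * (LINT x|?M. (v x + 1) * f x))"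
    if "\<phi> \<in> radial_cone ?K w" for \<phi>
  proof -
    obtain t v where t: "0 < t" and v: "v \<in> ?B" and \<phi>: "\<phi> = t *\<^sub>R (Lf v - w)"
      using \<open>\<phi> \<in> radial_cone ?K w\<close> by (auto simp: radial_cone_def)
    have v_L: "v \<in> Linfty_space \<Omega>" using v by simp
    have "\<phi> f = t * (LINT x|?M. (v x + 1) * f x)" if f: "f \<in> W" for f
    proof -
      have "(LINT x|?M. (v x + 1) * f x) = (LINT x|?M. v x * f x - (-1) * f x)"
        by (simp add: distrib_right)
      also have "\<dots> = Lf v f - w f"
        unfolding w_def Linfty_functional_eq[OF f]
        by (rule Bochner_Integration.integral_diff[OF Linfty_integrable_mult[OF v_L f] Linfty_integrable_mult[OF const f]])
      finally show ?thesis by (simp add: \<phi> scaleR_fun_def)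
    qed
    moreover have "\<phi> \<in> Wdual"
      unfolding \<phi> using Linfty_functional_dual[OF v_L] w_dual unfolding sobolev_dual_def
      by (intro dual_space_scaleR dual_space_diff)
    ultimately show ?thesis using t v by blast
  qed
  have sign: "AE x in ?M. (v x + 1) * u x \<le> 0" if "v \<in> ?B" for v
  proof -
    have "AE x in ?M. -1 \<le> v x \<and> v x \<le> 1" using that by simp
    then show ?thesis by eventually_elim (simp add: u_def mult_nonneg_nonpos)
  qed
  have int_u: "integrable ?M (\<lambda>x. (v x + 1) * u x)" if "v \<in> ?B" for v
    using Linfty_integrable_mult[OF _ u, of v] Linfty_integrable_mult[OF const u, of 1] that
    by (simp add: distrib_right)
  have radial_u: "\<phi> u \<le> 0" if \<phi>: "\<phi> \<in> radial_cone ?K w" for \<phi>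
  proof -
    obtain t v where "0 < t" "v \<in> ?B" "\<phi> u = t * (LINT x|?M. (v x + 1) * u x)"
      using radial[OF \<phi>] u by blast
    moreover have "(LINT x|?M. (v x + 1) * u x) \<le> 0"
      using integral_mono_AE[OF int_u[OF \<open>v \<in> ?B\<close>] integrable_zero sign[OF \<open>v \<in> ?B\<close>]] by simp
    ultimately show ?thesis by (simp add: mult_nonneg_nonpos)
  qed
  have radial_dual: "\<phi> \<in> Wdual" if "\<phi> \<in> radial_cone ?K w" for \<phi>
    using radial[OF that] by blast
  have diff_dual: "\<phi> - \<psi> \<in> Wdual" if "\<phi> \<in> Wdual" "\<psi> \<in> Wdual" for \<phi> \<psi>
    using that unfolding sobolev_dual_def by (rule dual_space_diff)
  have add_dual: "\<phi> + \<psi> \<in> Wdual" if "\<phi> \<in> Wdual" "\<psi> \<in> Wdual" for \<phi> \<psi>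
    using that unfolding sobolev_dual_def by (rule dual_space_add)
  have scale_dual: "c *\<^sub>R \<phi> \<in> Wdual" if "\<phi> \<in> Wdual" for c \<phi>
    using that unfolding sobolev_dual_def by (rule dual_space_scaleR)
  \<comment> \<open>Functionals are by convention 0 outside their domain, hence the case
    distinction.\<close>
  define \<eta> where "\<eta> \<phi> = (if \<phi> \<in> Wdual then \<phi> u else 0)" for \<phi>
  have "\<bar>\<eta> \<phi>\<bar> \<le> snorm u * dnorm \<phi>" if "\<phi> \<in> Wdual" for \<phi>
    using sobolev_dual_bound[OF that u] that by (simp add: \<eta>_def mult.commute)
  then have "\<exists>C. \<forall>\<phi>\<in>Wdual. \<bar>\<eta> \<phi>\<bar> \<le> C * dnorm \<phi>" by blast
  moreover have "\<eta> (c *\<^sub>R \<phi>) = c * \<eta> \<phi>" if "\<phi> \<in> Wdual" for c \<phi>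
  proof -
    have "(c *\<^sub>R \<phi>) u = c * \<phi> u" by (simp add: scaleR_fun_def)
    then show ?thesis using scale_dual[OF that, of c] that by (simp add: \<eta>_def)
  qed
  moreover have "\<eta> (\<phi> + \<psi>) = \<eta> \<phi> + \<eta> \<psi>" if "\<phi> \<in> Wdual" "\<psi> \<in> Wdual" for \<phi> \<psi>
    using add_dual[OF that] that by (simp add: \<eta>_def)
  moreover have "\<eta> \<phi> = 0" if "\<phi> \<notin> Wdual" for \<phi> using that by (simp add: \<eta>_def)
  ultimately have \<eta>_dual: "\<eta> \<in> dual_space Wdual dnorm"
    unfolding dual_space_def by blast
  have \<eta>_normal: "\<eta> \<in> normal_cone Wdual dnorm ?K w"
    unfolding normal_cone_def
  proof (intro CollectI conjI ballI \<eta>_dual)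
    fix \<phi> assume "\<phi> \<in> tangent_cone Wdual dnorm ?K w"
    then have \<phi>: "\<phi> \<in> Wdual" "\<And>\<epsilon>. 0 < \<epsilon> \<Longrightarrow> \<exists>\<psi>\<in>radial_cone ?K w. dnorm (\<phi> - \<psi>) < \<epsilon>"
      by (auto simp: tangent_cone_def norm_closure_def)
    \<comment> \<open>Evaluation at \<open>u\<close> is continuous in the dual norm, so the sign on
      the radial cone passes to its closure.\<close>
    have "\<phi> u \<le> \<epsilon> * snorm u" if \<epsilon>: "0 < \<epsilon>" for \<epsilon>
    proof -
      obtain \<psi> where \<psi>: "\<psi> \<in> radial_cone ?K w" "dnorm (\<phi> - \<psi>) < \<epsilon>"
        using \<phi>(2)[OF \<epsilon>] by blast
      have "\<phi> u = (\<phi> - \<psi>) u + \<psi> u" by simp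
      also have "\<dots> \<le> dnorm (\<phi> - \<psi>) * snorm u + 0"
        using sobolev_dual_bound[OF diff_dual[OF \<phi>(1) radial_dual[OF \<psi>(1)]] u] radial_u[OF \<psi>(1)] by linarith
      also have "\<dots> \<le> \<epsilon> * snorm u"
        using \<psi>(2) sobolev_norm_nonneg[of u] by (simp add: mult_right_mono)
      finally show ?thesis .
    qed
    note bound = this
    have "\<phi> u \<le> 0"
    proof (rule field_le_epsilon)
      fix e :: real assume e: "0 < e"
      have pos: "0 < snorm u + 1" using sobolev_norm_nonneg[of u] by simp
      have "\<phi> u \<le> e / (snorm u + 1) * snorm u" using e pos by (intro bound) simp
      also have "\<dots> \<le> e" using e pos sobolev_norm_nonneg[of u] by (simp add: field_simps)
      finally show "\<phi> u \<le> 0 + e" by simp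
    qed
    then show "\<eta> \<phi> \<le> 0" using \<phi>(1) by (simp add: \<eta>_def)
  qed
  have h_radial: "Lf (h n) \<in> radial_cone ?K w" for n
  proof -
    obtain b where b: "0 < b" "\<forall>x. h n x \<le> b" using h(3) by blast
    \<comment> \<open>The affine map from [0, b] onto [-1, 1], chosen so that h n = (b / 2) (v -
      (-1)).\<close>
    define v where "v x = 2 / b * h n x - 1" for x
    have v_bound: "-1 \<le> v x" "v x \<le> 1" for x
      using b h(2)[of n x] by (auto simp: v_def field_simps)
    have [measurable]: "h n \<in> borel_measurable ?M" using h(1)[of n] by (simp add: Linfty_space_def)
    have v_L: "v \<in> Linfty_space \<Omega>"
    proof (rule Linfty_spaceI)
      show "v \<in> borel_measurable ?M" unfolding v_def by measurable
      show "\<bar>v x\<bar> \<le> 1" for x using v_bound[of x] by (simp add: abs_le_iff)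
    qed
    have "Lf (h n) f = ((b / 2) *\<^sub>R (Lf v - w)) f" for f
    proof (cases "f \<in> W")
      case True
      have "Lf v f - w f = (LINT x|?M. v x * f x - (-1) * f x)"
        unfolding w_def Linfty_functional_eq[OF True]
        by (rule Bochner_Integration.integral_diff[symmetric, OF Linfty_integrable_mult[OF v_L True] Linfty_integrable_mult[OF const True]])
      also have "\<dots> = (LINT x|?M. 2 / b * (h n x * f x))"
        by (simp add: v_def algebra_simps)
      also have "\<dots> = 2 / b * Lf (h n) f"
        unfolding Linfty_functional_eq[OF True] by (rule integral_mult_right_zero)
      finally show ?thesis using b by (simp add: scaleR_fun_def)
    next
      case False
      then show ?thesis by (simp add: Linfty_functional_def w_def scaleR_fun_def)
    qed
    then have "Lf (h n) = (b / 2) *\<^sub>R (Lf v - w)" by (rule ext)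
    moreover have "Lf v \<in> ?K" using v_L v_bound by (intro imageI) simp
    ultimately show ?thesis
      unfolding radial_cone_def using b(1) by (intro CollectI exI[of _ "b / 2"] exI[of _ "Lf v"]) simp
  qed
  have \<delta>_mem: "\<delta> \<in> tangent_cone Wdual dnorm ?K w \<inter> kernel_on Wdual \<eta>"
  proof
    show "\<delta> \<in> kernel_on Wdual \<eta>" using \<delta> \<delta>_u by (simp add: kernel_on_def \<eta>_def)
    show "\<delta> \<in> tangent_cone Wdual dnorm ?K w"
      unfolding tangent_cone_def norm_closure_def
      using \<delta> approx h_radial by (intro CollectI conjI allI impI) blast+
  qed
  have critical_1: "\<phi> (\<lambda>x. 1) = 0" if "\<phi> \<in> radial_cone ?K w \<inter> kernel_on Wdual \<eta>" for \<phi>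
  proof -
    have \<phi>: "\<phi> \<in> radial_cone ?K w" and "\<eta> \<phi> = 0" "\<phi> \<in> Wdual"
      using that by (auto simp: kernel_on_def)
    then have \<phi>u: "\<phi> u = 0" by (simp add: \<eta>_def)
    obtain t v where t: "0 < t" and v: "v \<in> ?B"
      and \<phi>_eq: "\<forall>f\<in>W. \<phi> f = t * (LINT x|?M. (v x + 1) * f x)"
      using radial[OF \<phi>] by blast
    have "(LINT x|?M. (v x + 1) * u x) = 0"
      using bspec[OF \<phi>_eq u] \<phi>u t by simp
    then have "(LINT x|?M. - ((v x + 1) * u x)) = 0" by simp
    moreover have nonneg: "AE x in ?M. 0 \<le> - ((v x + 1) * u x)"
      using sign[OF v] by eventually_elim simp
    ultimately have "AE x in ?M. - ((v x + 1) * u x) = 0"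
      using integral_nonneg_eq_0_iff_AE[OF integrable_minus[OF int_u[OF v]] nonneg] by (simp only:)
    moreover have "AE x in ?M. x \<noteq> x0"
    proof -
      have "AE x in lebesgue. x \<notin> {x0}"
        using negligible_sing[of x0] unfolding negligible_iff_null_sets by (rule AE_not_in)
      then show ?thesis
        using lebesgue_dom by (subst AE_restrict_space_iff) (auto elim!: eventually_mono)
    qed
    \<comment> \<open>The only zero of \<open>u\<close> is \<open>x0\<close>, a null set, so the
      density v + 1 vanishes almost everywhere.\<close>
    ultimately have "AE x in ?M. (v x + 1) * 1 = 0"
      by eventually_elim (simp add: u_def)
    then have "(LINT x|?M. (v x + 1) * 1) = 0" by (rule integral_eq_zero_AE)
    then show ?thesis using bspec[OF \<phi>_eq one_sobolev] by simp
  qed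
  have \<delta>_not_mem: "\<delta> \<notin> norm_closure Wdual dnorm (radial_cone ?K w \<inter> kernel_on Wdual \<eta>)"
  proof
    assume closure: "\<delta> \<in> norm_closure Wdual dnorm (radial_cone ?K w \<inter> kernel_on Wdual \<eta>)"
    \<comment> \<open>\<open>S\<close> is positive and exceeds the norm of the constant 1. An
      approximation of \<delta> within m / S by an element that vanishes at 1 would thus give m <
      m.\<close>
    define S where "S = snorm (\<lambda>x. 1) + 1"
    have S: "0 < S" "snorm (\<lambda>x. 1) < S" using sobolev_norm_nonneg[of "\<lambda>x. 1"] by (simp_all add: S_def)
    have "\<forall>\<epsilon>>0. \<exists>\<phi>\<in>radial_cone ?K w \<inter> kernel_on Wdual \<eta>. dnorm (\<delta> - \<phi>) < \<epsilon>"
      using closure unfolding norm_closure_def by blast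
    moreover have "0 < m / S" using m S by simp
    ultimately obtain \<phi> where \<phi>: "\<phi> \<in> radial_cone ?K w \<inter> kernel_on Wdual \<eta>" "dnorm (\<delta> - \<phi>) < m / S"
      by blast
    have "m = (\<delta> - \<phi>) (\<lambda>x. 1)" using critical_1[OF \<phi>(1)] \<delta>_1 by simp
    also have "\<dots> \<le> dnorm (\<delta> - \<phi>) * snorm (\<lambda>x. 1)"
      using sobolev_dual_bound[OF diff_dual[OF \<delta> radial_dual] one_sobolev, of \<phi>] \<phi>(1) by simp
    also have "\<dots> \<le> m / S * snorm (\<lambda>x. 1)"
      using \<phi>(2) by (intro mult_right_mono sobolev_norm_nonneg) simp
    also have "\<dots> < m / S * S"
      using S m by (intro mult_strict_left_mono) simp_all
    also have "\<dots> = m" using S by simp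
    finally show False by simp
  qed
  have "\<not> polyhedric_at Wdual dnorm ?K w \<eta>"
    unfolding polyhedric_at_def using \<delta>_mem \<delta>_not_mem by blast
  then show ?thesis
    unfolding polyhedric_def using w_K \<eta>_normal by blast
qed

end
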